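(* Let $\mathbb{P}$ be the law of a ROSt that is invariant under the cavity mapping $\Phi_{\lambda,l_p}$ for a given $\lambda>0$ and for infinitely many $p\in\mathbb{N}$. Let $\mu$ be its sampling measure and suppose that $\mu^{\otimes 2}\{(v,v')\in\mathcal{B}^2:\ |v\cdot v'|=r_{\max}^2(\mu)\}>0$ on a set of positive $\mathbb{P}$-probability, where $r_{\max}(\mu)=\sup\{0\le r\le 1:\ \mu\{v\in\mathcal{B}:\|v\|\ge r\}>0\}$. Then $$\mu\{v\in\mathcal{B}:\ \|v\|=r_{\max}(\mu)\}=1\qquad \mathbb{P}\text{-a.s.}$$
   Context: Let $\mathbb{N}=\{1,2,\dots\}$. A Random Overlap Structure (ROSt) is a random symmetric positive semidefinite $\mathbb{N}\times\mathbb{N}$ matrix $Q=\{q_{ij}\}$ with $1$'s on the diagonal which is weakly exchangeable: $\tau Q\tau^{-1}$ has the same law as $Q$ for every permutation matrix $\tau$ that fixes all but finitely many elements. $\mathcal{H}$ is a fixed infinite-dimensional separable real Hilbert space with inner product $\cdot$ and norm $\|\cdot\|$, $\mathcal{B}$ is its closed unit ball, and $\mathcal{M}(\mathcal{B})$ is the set of Borel probability measures on $\mathcal{B}$. By the Dovbysh–Sudakov theorem, for every ROSt $Q$ there is a random element $\mu$ of $\mathcal{M}(\mathcal{B})$, called a sampling measure of $Q$, such that conditionally on $\mu$, $(q_{ij})_{i\neq j}$ has the law of $(v^i\cdot v^j)_{i\ne j}$ with $v^1,v^2,\dots$ i.i.d. of law $\mu$. Conversely every random element of $\mathcal{M}(\mathcal{B})$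 is a sampling measure of the ROSt so constructed (diagonal entries set to $1$). The sampling measure is determined by the law of $Q$ up to isometry of $\mathcal{B}$. The law of a ROSt (and of its sampling measure) is denoted $\mathbb{P}$. For $p\in\mathbb{N}$, the cavity field $l_p=(l_p(v),v\in\mathcal{B})$ is a centered Gaussian process (jointly measurable version), independent of $\mathbb{P}$, of law $P_l$, with covariance $E_l[l_p(v)l_p(v')]=(v\cdot v')^p$. The cavity mapping $\Phi_{\lambda,l_p}$ sends $\mathbb{P}$ to the law (under $\mathbb{P}\times P_l$) of the ROSt with sampling measure $$\Phi_{\lambda,l_p}\mu(dv)=\frac{e^{\lambda l_p(v)-\frac{\lambda^2}{2}\|v\|^{2p}}\mu(dv)}{\int_{\mathcal{B}} e^{\lambda l_p(w)-\frac{\lambda^2}{2}\|w\|^{2p}}\mu(dw)}.$$ The image law does not depend on the choice of $\mu$. $\mathbb{P}$ is invariant if it equals its image. *)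

theory Defs
  imports "HOL-Probability.Probability"
begin

text \<open>The closed unit ball with its Borel \<open>\<sigma>\<close>-algebra. The random elements of the space of Borel
  probability measures on the ball are the measurable maps into \<^term>\<open>prob_algebra ball_borel\<close>.\<close>

definition ball_borel :: "'h::real_inner measure" where
  "ball_borel = restrict_space borel (cball 0 1)"

definition matrices :: "(nat \<times> nat \<Rightarrow> real) measure" where
  "matrices = PiM UNIV (\<lambda>_. borel)"

definition is_ROSt :: "'w measure \<Rightarrow> ('w \<Rightarrow> nat \<times> nat \<Rightarrow> real) \<Rightarrow> bool" where
  "is_ROSt M Q \<longleftrightarrow>
     prob_space M \<and> Q \<in> M \<rightarrow>\<^sub>M matrices \<and>
     (AE \<omega> in M.
        (\<forall>i j. Q \<omega> (i, j) = Q \<omega> (j, i)) \<and>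
        (\<forall>n (c :: nat \<Rightarrow> real). 0 \<le> (\<Sum>i<n. \<Sum>j<n. c i * c j * Q \<omega> (i, j))) \<and>
        (\<forall>i. Q \<omega> (i, i) = 1)) \<and>
     (\<forall>\<tau>. bij \<tau> \<and> finite {i. \<tau> i \<noteq> i} \<longrightarrow>
        distr M matrices (\<lambda>\<omega> (i, j). Q \<omega> (\<tau> i, \<tau> j)) = distr M matrices Q)"

definition overlaps :: "(nat \<Rightarrow> 'h::real_inner) \<Rightarrow> nat \<times> nat \<Rightarrow> real" where
  "overlaps v = (\<lambda>(i, j). if i = j then 1 else v i \<bullet> v j)"

text \<open>The law of the overlap matrix of an i.i.d. sample from \<open>m\<close>.\<close>

definition overlap_law :: "'h::real_inner measure \<Rightarrow> (nat \<times> nat \<Rightarrow> real) measure" where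
  "overlap_law m = distr (PiM UNIV (\<lambda>_. m)) matrices overlaps"

text \<open>The conditional law of \<open>Q\<close> given \<open>\<sigma>(\<mu>)\<close> is the overlap law of \<open>\<mu>\<close>. Comparing whole
  matrices amounts to comparing off-diagonal entries, as both diagonals are almost surely 1.\<close>

definition sampling_measure ::
    "'w measure \<Rightarrow> ('w \<Rightarrow> nat \<times> nat \<Rightarrow> real) \<Rightarrow> ('w \<Rightarrow> 'h::real_inner measure) \<Rightarrow> bool" where
  "sampling_measure M Q \<mu> \<longleftrightarrow>
     is_ROSt M Q \<and> \<mu> \<in> M \<rightarrow>\<^sub>M prob_algebra ball_borel \<and>
     (\<forall>A \<in> sets matrices. AE \<omega> in M.
        real_cond_exp M (vimage_algebra (space M) \<mu> (prob_algebra ball_borel))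
          (\<lambda>\<omega>. indicator A (Q \<omega>)) \<omega> = measure (overlap_law (\<mu> \<omega>)) A)"

text \<open>Standard deviation 0 stands for a constant variable.\<close>

definition gaussian_rv :: "'l measure \<Rightarrow> ('l \<Rightarrow> real) \<Rightarrow> bool" where
  "gaussian_rv L X \<longleftrightarrow> X \<in> borel_measurable L \<and>
     (\<exists>a s. 0 \<le> s \<and>
        distr L borel X =
          (if s = 0 then return borel a else density lborel (\<lambda>x. ennreal (normal_density a s x))))"

definition gaussian_process :: "'l measure \<Rightarrow> 't set \<Rightarrow> ('t \<Rightarrow> 'l \<Rightarrow> real) \<Rightarrow> bool" where
  "gaussian_process L T X \<longleftrightarrow> prob_space L \<and>
     (\<forall>F c. finite F \<and> F \<subseteq> T \<longrightarrow> gaussian_rv L (\<lambda>x. \<Sum>t\<in>F. c t * X t x))"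

definition cavity_field :: "nat \<Rightarrow> 'l measure \<Rightarrow> ('h::real_inner \<Rightarrow> 'l \<Rightarrow> real) \<Rightarrow> bool" where
  "cavity_field p L l \<longleftrightarrow>
     gaussian_process L (cball 0 1) l \<and>
     (\<lambda>(v, x). l v x) \<in> borel_measurable (ball_borel \<Otimes>\<^sub>M L) \<and>
     (\<forall>v \<in> cball 0 1. (\<integral>x. l v x \<partial>L) = 0) \<and>
     (\<forall>v \<in> cball 0 1. \<forall>v' \<in> cball 0 1. (\<integral>x. l v x * l v' x \<partial>L) = (v \<bullet> v') ^ p)"

definition cavity_weight :: "real \<Rightarrow> nat \<Rightarrow> ('h::real_inner \<Rightarrow> real) \<Rightarrow> 'h \<Rightarrow> real" where
  "cavity_weight lam p f v = exp (lam * f v - lam\<^sup>2 / 2 * norm v ^ (2 * p))"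

text \<open>For a cavity field the normalising constant \<open>Z\<close> has mean 1, so it is almost surely finite; on
  the exceptional null set the measure is left unchanged, which keeps the map total and measurable.\<close>

definition cavity_tilt ::
    "real \<Rightarrow> nat \<Rightarrow> ('h::real_inner \<Rightarrow> real) \<Rightarrow> 'h measure \<Rightarrow> 'h measure" where
  "cavity_tilt lam p f m =
     (let Z = (\<integral>\<^sup>+w. ennreal (cavity_weight lam p f w) \<partial>m)
      in if Z = \<infinity> then m else density m (\<lambda>v. ennreal (cavity_weight lam p f v) / Z))"

text \<open>The argument \<open>D\<close> is the law of a sampling measure, the value is the law of the ROSt whose
  sampling measure is the tilted one, under the product of \<open>D\<close> and the law of the field.\<close>

definition cavity_mapping ::
    "real \<Rightarrow> nat \<Rightarrow> 'l measure \<Rightarrow> ('h::real_inner \<Rightarrow> 'l \<Rightarrow> real) \<Rightarrow> 'h measure measure \<Rightarrow>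
     (nat \<times> nat \<Rightarrow> real) measure" where
  "cavity_mapping lam p L l D =
     (D \<Otimes>\<^sub>M L) \<bind> (\<lambda>(m, x). overlap_law (cavity_tilt lam p (\<lambda>v. l v x) m))"

text \<open>The image law does not depend on which sampling measure of \<open>Q\<close> is used.\<close>

definition cavity_invariant ::
    "real \<Rightarrow> nat \<Rightarrow> 'l measure \<Rightarrow> ('h::real_inner \<Rightarrow> 'l \<Rightarrow> real) \<Rightarrow>
     'w measure \<Rightarrow> ('w \<Rightarrow> nat \<times> nat \<Rightarrow> real) \<Rightarrow> ('w \<Rightarrow> 'h measure) \<Rightarrow> bool" where
  "cavity_invariant lam p L l M Q \<mu> \<longleftrightarrow>
     cavity_mapping lam p L l (distr M (prob_algebra ball_borel) \<mu>) = distr M matrices Q"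

definition r_max :: "'h::real_inner measure \<Rightarrow> real" where
  "r_max m = Sup {r. 0 \<le> r \<and> r \<le> 1 \<and> measure m {v \<in> cball 0 1. r \<le> norm v} > 0}"

end

theory Submission
  imports Defs
begin

text \<open>Let \<open>r = r_max \<mu>\<close>, so that \<open>r\<^sup>2\<close> is the essential supremum of \<open>\<bar>v \<bullet> w\<bar>\<close>, fix \<open>a < 1\<close>, and let \<open>N\<close> be the set of
  \<open>v\<close> with \<open>\<bar>v \<bullet> w\<bar> \<le> a\<close> for almost all \<open>w\<close>. Tilting produces an equivalent measure, so it does not change \<open>N\<close>,
  and the mean of \<open>\<mu>(N) R_k\<close>, with \<open>R_k\<close> the \<open>k\<close>-th moment of the overlap, is a functional of the law of
  the overlap matrix, hence invariant. It suffices to show \<open>\<mu>(N) = 0\<close> whenever \<open>a < r\<^sup>2\<close>, as this forces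
  \<open>\<parallel>v\<parallel> \<ge> r\<close> almost surely.

  Let \<open>Z\<close> be the normalisation of the tilt by \<open>l_p\<close>. A vector of \<open>N\<close> is almost uncorrelated
  with \<open>Z\<close>, and \<open>E (1/Z) - 1\<close> is at least a multiple of \<open>E Z\<^sup>2 - 1 \<ge> lam\<^sup>2 R_p\<close>, so tilting multiplies \<open>\<mu>(N)\<close> on
  average by at least \<open>1 + c R_p - C a ^ p\<close>. Invariance therefore gives \<open>E (\<mu>(N) R_p) \<le> C' a ^ p\<close>. The
  same bound holds after tilting by one fixed \<open>l_q\<close>, with \<open>q\<close> of the parity of \<open>p\<close>. For odd \<open>p\<close>
  this is essential, since \<open>R_p\<close> vanishes if \<open>\<mu>\<close> is symmetric: the tilt breaks the symmetry, because
  \<open>(exp (lam\<^sup>2 (v \<bullet> w) ^ q) - 1) (v \<bullet> w) ^ p\<close> is nonnegative and comparable to \<open>\<bar>v \<bullet> w\<bar> ^ (p + q)\<close>. By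
  Cauchy-Schwarz the mean of \<open>\<mu>(N) R_p\<close> under that tilt is at least \<open>c(\<mu>) (b\<^sup>2 / r\<^sup>2) ^ p\<close> for every
  \<open>b < r\<^sup>2\<close>, with \<open>c(\<mu>) > 0\<close> if \<open>\<mu>(N) > 0\<close>. Letting \<open>p\<close> tend to infinity, Fatou's lemma yields a
  contradiction unless \<open>\<mu>(N) = 0\<close>.\<close>

section \<open>Sampling from a measure on the ball\<close>

text \<open>The threshold \<open>a\<close> separates two rates. On \<open>N\<close> every error
  decays like \<open>a ^ p\<close>, while after the fixed tilt the gain decays only at about the
  rate of the essential supremum of the overlap, which exceeds \<open>a\<close>; invariance forbids
  a gain that outlives its error. The obstacle is the factor \<open>1 / Z\<close>: Gaussian
  integration gives moments of products of weights, hence of powers of \<open>Z\<close>, but no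
  formula for \<open>1 / Z\<close>. In the upper bound \<open>1 / Z\<close> is replaced by a cubic
  that lies below it and touches it at two points, so that only powers of \<open>Z\<close> up to the
  third occur. In the lower bound Cauchy-Schwarz is applied to \<open>Z\<^sup>2 * R_k\<close>,
  because \<open>Z\<^sup>2\<close> clears both normalisations of the tilted moment and leaves an
  integral over two replicas; the price is a finite mean of \<open>Z ^ 5 / W N\<close>, hence a
  negative moment of the tilted mass \<open>W N\<close>. The constants of the upper bound depend on
  \<open>lam\<close> alone, since it is averaged over the random measure and used for all large
  \<open>p\<close>. Those of the lower bound may depend on the measure, because after Fatou's lemma
  the contradiction is reached for each realisation separately.\<close>

lemma space_ball_borel [simp]: "space ball_borel = cball 0 1"
  by (simp add: ball_borel_def space_restrict_space)

lemma measurable_ball_borelD: "f \<in> M \<rightarrow>\<^sub>M ball_borel \<Longrightarrow> f \<in> borel_measurable M"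
  unfolding ball_borel_def by (simp add: measurable_restrict_space2_iff)

lemma borel_measurable_ident_ball [measurable (raw)]: "(\<lambda>v. v) \<in> ball_borel \<rightarrow>\<^sub>M borel"
  by (rule measurable_ball_borelD) simp

lemma borel_measurable_inner_ball [measurable (raw)]:
  fixes f g :: "'a \<Rightarrow> 'h::{real_inner, second_countable_topology}"
  assumes "f \<in> M \<rightarrow>\<^sub>M ball_borel" "g \<in> M \<rightarrow>\<^sub>M ball_borel"
  shows "(\<lambda>x. f x \<bullet> g x) \<in> borel_measurable M"
  using assms by (intro borel_measurable_inner measurable_ball_borelD)

lemma borel_measurable_norm_ball [measurable (raw)]:
  fixes f :: "'a \<Rightarrow> 'h::{real_inner, second_countable_topology}"
  assumes "f \<in> M \<rightarrow>\<^sub>M ball_borel"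
  shows "(\<lambda>x. norm (f x)) \<in> borel_measurable M"
  by (rule measurable_compose[OF measurable_ball_borelD[OF assms] borel_measurable_norm])

lemma abs_inner_ball_le:
  assumes "v \<in> cball 0 1" "w \<in> cball 0 1"
  shows "\<bar>v \<bullet> w\<bar> \<le> 1"
proof -
  have "\<bar>v \<bullet> w\<bar> \<le> norm v * norm w" by (rule Cauchy_Schwarz_ineq2)
  also have "\<dots> \<le> 1 * 1" using assms by (intro mult_mono) auto
  finally show ?thesis by simp
qed

text \<open>Cylinders form a generating pi-system, and on a cylinder the product measure is a finite
  product of evaluations \<open>emeasure m (E j)\<close>, each measurable in \<open>m\<close>.
  Sampling from a random measure thereby becomes a measurable operation.\<close>

lemma measurable_PiM_iid [measurable]:
  "(\<lambda>m. PiM UNIV (\<lambda>_::nat. m)) \<in> prob_algebra N \<rightarrow>\<^sub>M prob_algebra (PiM UNIV (\<lambda>_. N))"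
proof (rule measurable_prob_algebra_generated[OF sets_PiM Int_stable_prod_algebra prod_algebra_sets_into_space])
  fix m assume m: "m \<in> space (prob_algebra N)"
  then interpret prob_space m by (simp add: space_prob_algebra)
  show "prob_space (PiM UNIV (\<lambda>_::nat. m))" by (intro prob_space_PiM) unfold_locales
  show "sets (PiM UNIV (\<lambda>_::nat. m)) = sets (PiM UNIV (\<lambda>_. N))"
    using m by (intro sets_PiM_cong) (auto simp: space_prob_algebra)
next
  fix A assume "A \<in> prod_algebra UNIV (\<lambda>_::nat. N)"
  then obtain J E where A: "A = prod_emb UNIV (\<lambda>_. N) J (Pi\<^sub>E J E)" "finite J"
      and E: "\<And>i. i \<in> J \<Longrightarrow> E i \<in> sets N"
    by (elim prod_algebraE) auto
  have "(\<lambda>m. \<Prod>j\<in>J. emeasure m (E j)) \<in> borel_measurable (prob_algebra N)"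
    using E by (intro borel_measurable_prod_ennreal)
      (auto simp: prob_algebra_def intro!: measurable_restrict_space1 measurable_emeasure_subprob_algebra)
  also have "?this \<longleftrightarrow> (\<lambda>m. emeasure (PiM UNIV (\<lambda>_::nat. m)) A) \<in> borel_measurable (prob_algebra N)"
  proof (intro measurable_cong)
    fix m assume "m \<in> space (prob_algebra N)"
    then have m: "prob_space m" "sets m = sets N" by (auto simp: space_prob_algebra)
    interpret product_prob_space "\<lambda>_. m" UNIV
      by (rule product_prob_spaceI) (rule m)
    show "(\<Prod>j\<in>J. emeasure m (E j)) = emeasure (PiM UNIV (\<lambda>_::nat. m)) A"
      using A E m sets_eq_imp_space_eq[OF m(2)]
      by (subst emeasure_PiM_emb[symmetric]) (auto simp: prod_emb_def)
  qed
  finally show "(\<lambda>m. emeasure (PiM UNIV (\<lambda>_::nat. m)) A) \<in> borel_measurable (prob_algebra N)" .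
qed

lemma measurable_overlaps [measurable]:
  "overlaps \<in> PiM UNIV (\<lambda>_::nat. ball_borel :: 'h::{real_inner, second_countable_topology} measure) \<rightarrow>\<^sub>M matrices"
  unfolding matrices_def
proof (rule measurable_PiM_single')
  fix ij :: "nat \<times> nat"
  show "(\<lambda>v. overlaps v ij) \<in> borel_measurable (PiM UNIV (\<lambda>_::nat. ball_borel :: 'h measure))"
    by (cases ij; cases "fst ij = snd ij") (auto simp: overlaps_def)
qed (auto simp: overlaps_def)

lemma measurable_overlap_law [measurable]:
  "overlap_law \<in> prob_algebra (ball_borel :: 'h::{real_inner, second_countable_topology} measure) \<rightarrow>\<^sub>M prob_algebra matrices"
  unfolding overlap_law_def by measurable

text \<open>An i.i.d. sequence keeps its law when one independent draw is put in front. Repeated use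
  peels off replicas one at a time.\<close>

lemma sequence_space_integral_iter:
  fixes g :: "(nat \<Rightarrow> 'a) \<Rightarrow> real"
  assumes m: "prob_space m"
    and g [measurable]: "g \<in> borel_measurable (PiM UNIV (\<lambda>_. m))"
    and bnd: "\<And>\<omega>. \<omega> \<in> space (PiM UNIV (\<lambda>_. m)) \<Longrightarrow> \<bar>g \<omega>\<bar> \<le> B"
  shows "(\<integral>\<omega>. g \<omega> \<partial>PiM UNIV (\<lambda>_. m)) = (\<integral>s. (\<integral>\<omega>. g (case_nat s \<omega>) \<partial>PiM UNIV (\<lambda>_. m)) \<partial>m)"
proof -
  interpret m: prob_space m by fact
  interpret sequence_space m by unfold_locales
  interpret S: prob_space S by (rule prob_space_PiM) (rule m)
  interpret mS: pair_prob_space m S ..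
  have meas [measurable]: "(\<lambda>(s, \<omega>). case_nat s \<omega>) \<in> m \<Otimes>\<^sub>M S \<rightarrow>\<^sub>M S"
    by measurable
  have int: "integrable (m \<Otimes>\<^sub>M S) (\<lambda>(s, \<omega>). g (case_nat s \<omega>))"
    by (rule mS.integrable_const_bound[where B=B])
       (auto intro!: AE_I2 bnd simp: space_pair_measure space_PiM PiE_iff split: nat.split)
  have "(\<integral>\<omega>. g \<omega> \<partial>S) = (\<integral>x. g ((\<lambda>(s, \<omega>). case_nat s \<omega>) x) \<partial>(m \<Otimes>\<^sub>M S))"
    by (subst (1) PiM_iter[symmetric]) (rule integral_distr, measurable)
  also have "\<dots> = (\<integral>x. (\<lambda>(s, \<omega>). g (case_nat s \<omega>)) x \<partial>(m \<Otimes>\<^sub>M S))"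
    by (intro Bochner_Integration.integral_cong) auto
  also have "\<dots> = (\<integral>s. (\<integral>\<omega>. g (case_nat s \<omega>) \<partial>S) \<partial>m)"
    using mS.integral_fst'[OF int] by simp
  finally show ?thesis .
qed

text \<open>The first \<open>n\<close> draws all lie in \<open>B\<close> with probability
  \<open>measure m B ^ n\<close>, whose limit is 0 or 1. An infinite row of overlaps therefore
  decides an almost-sure statement exactly.\<close>

lemma measure_iid_all:
  assumes m: "prob_space m" and B: "B \<in> sets m"
  shows "measure (PiM UNIV (\<lambda>_::nat. m)) {\<omega> \<in> space (PiM UNIV (\<lambda>_. m)). \<forall>j. \<omega> j \<in> B} = of_bool (AE w in m. w \<in> B)"
proof -
  interpret m: prob_space m by fact
  interpret sequence_space m by unfold_locales
  have "{\<omega> \<in> space S. \<forall>j. \<omega> j \<in> B} = Pi UNIV (\<lambda>_. B)"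
    using sets.sets_into_space[OF B] by (auto simp: space_PiM Pi_iff)
  moreover have "(\<lambda>n. measure m B ^ Suc n) \<longlonglongrightarrow> measure S (Pi UNIV (\<lambda>_. B))"
    using measure_PiM_countable[of "\<lambda>_. B"] B by simp
  moreover have "(\<lambda>n. measure m B ^ Suc n) \<longlonglongrightarrow> of_bool (AE w in m. w \<in> B)"
  proof (cases "AE w in m. w \<in> B")
    case True
    then have "measure m B = 1" using B m.prob_eq_1 by auto
    with True show ?thesis by simp
  next
    case False
    then have "measure m B < 1" using B m.prob_eq_1[OF B] m.prob_le_1[of B] by (auto simp: less_le)
    then have "(\<lambda>n. measure m B ^ n) \<longlonglongrightarrow> 0" by (intro LIMSEQ_power_zero) simp
    from LIMSEQ_Suc[OF this] show ?thesis using False by simp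
  qed
  ultimately show ?thesis using LIMSEQ_unique by metis
qed

section \<open>The small overlap set as seen from the overlap matrix\<close>

definition small_overlap_set :: "real \<Rightarrow> 'h::real_inner measure \<Rightarrow> 'h set" where
  "small_overlap_set a m = {v \<in> cball 0 1. AE w in m. \<bar>v \<bullet> w\<bar> \<le> a}"

definition overlap_moment :: "nat \<Rightarrow> 'h::real_inner measure \<Rightarrow> real" where
  "overlap_moment k m = (\<integral>v. (\<integral>w. (v \<bullet> w) ^ k \<partial>m) \<partial>m)"

text \<open>Row 0 decides whether the first replica lies in the small overlap set, and replicas 1 and 2, which
  that row skips, carry an independent overlap moment. Clipping changes nothing on the ball but
  keeps the function bounded on all matrices.\<close>

definition overlap_test :: "real \<Rightarrow> nat \<Rightarrow> (nat \<times> nat \<Rightarrow> real) \<Rightarrow> real" where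
  "overlap_test a k Q = of_bool (\<forall>j. \<bar>Q (0, j + 3)\<bar> \<le> a) * max (- 1) (min 1 (Q (1, 2))) ^ k"

lemma abs_overlap_test_le: "\<bar>overlap_test a k Q\<bar> \<le> 1"
proof -
  have "\<bar>max (- 1) (min 1 (Q (1, 2)))\<bar> ^ k \<le> 1" by (intro power_le_one) auto
  then show ?thesis by (simp add: overlap_test_def power_abs)
qed

lemma measurable_overlap_test [measurable]: "overlap_test a k \<in> borel_measurable matrices"
  unfolding overlap_test_def[abs_def] matrices_def by measurable

text \<open>Membership says that a section over \<open>v\<close> has mass 0, and the mass of a
  section is a measurable function of \<open>v\<close>.\<close>

lemma sets_small_overlap_set [measurable]:
  fixes m :: "'h::{real_inner, second_countable_topology} measure"
  assumes m: "m \<in> space (prob_algebra ball_borel)"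
  shows "small_overlap_set a m \<in> sets m"
proof -
  have s [measurable_cong]: "sets m = sets ball_borel" and "prob_space m" using m by (auto simp: space_prob_algebra)
  interpret prob_space m by fact
  have sp: "space m = cball 0 1" using sets_eq_imp_space_eq[OF s] by simp
  have "small_overlap_set a m = {v \<in> space m. emeasure m {w \<in> space m. \<not> \<bar>v \<bullet> w\<bar> \<le> a} = 0}"
  proof -
    have "(AE w in m. \<bar>v \<bullet> w\<bar> \<le> a) \<longleftrightarrow> emeasure m {w \<in> space m. \<not> \<bar>v \<bullet> w\<bar> \<le> a} = 0" if "v \<in> space m" for v
      using that by (intro AE_iff_measurable[OF _ refl]) measurable
    then show ?thesis by (auto simp: small_overlap_set_def sp)
  qed
  also have "\<dots> \<in> sets m"
    by measurable
  finally show ?thesis .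
qed

text \<open>Once three draws are peeled off, the rest of the sample is independent of them: by
  \<open>measure_iid_all\<close> it evaluates the membership of the first draw, while the second and
  third contribute the moment.\<close>

lemma integral_overlap_test:
  fixes m :: "'h::{real_inner, second_countable_topology} measure"
  assumes m: "m \<in> space (prob_algebra ball_borel)"
  shows "(\<integral>Q. overlap_test a k Q \<partial>overlap_law m) = measure m (small_overlap_set a m) * overlap_moment k m"
proof -
  have s [measurable_cong]: "sets m = sets ball_borel" and pm: "prob_space m" using m by (auto simp: space_prob_algebra)
  interpret m: prob_space m by fact
  have sp [simp]: "space m = cball 0 1" using sets_eq_imp_space_eq[OF s] by simp
  let ?S = "PiM UNIV (\<lambda>_::nat. m)"
  interpret S: prob_space ?S by (rule prob_space_PiM) (rule pm)
  define g where "g v = overlap_test a k (overlaps v)" for v :: "nat \<Rightarrow> 'h"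
  have ov: "overlaps \<in> ?S \<rightarrow>\<^sub>M matrices"
    by (subst measurable_cong_sets[OF sets_PiM_cong refl]) (auto simp: s)
  have g [measurable]: "g \<in> borel_measurable ?S"
    unfolding g_def by (rule measurable_compose[OF ov measurable_overlap_test])
  have gB: "\<bar>g \<omega>\<bar> \<le> 1" for \<omega>
    by (simp add: g_def abs_overlap_test_le)
  \<comment> \<open>The shift by 3 in \<open>overlap_test\<close> turns the entry
    \<open>(0, j + 3)\<close> into the overlap of \<open>x\<close> with \<open>\<omega> j\<close>.
    Clipping is void because \<open>y\<close> and \<open>z\<close> lie in the ball.\<close>
  have g3: "g (case_nat x (case_nat y (case_nat z \<omega>))) = of_bool (\<forall>j. \<bar>x \<bullet> \<omega> j\<bar> \<le> a) * (y \<bullet> z) ^ k"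
    if "y \<in> space m" "z \<in> space m" for x y z \<omega>
    using abs_inner_ball_le[of y z] that by (simp add: abs_le_iff min_absorb2 max_absorb2 g_def overlap_test_def overlaps_def numeral_eq_Suc)
  have meas1: "(\<lambda>\<omega>. case_nat x \<omega>) \<in> ?S \<rightarrow>\<^sub>M ?S" if "x \<in> space m" for x using that by measurable
  have "(\<integral>Q. overlap_test a k Q \<partial>overlap_law m) = (\<integral>\<omega>. g \<omega> \<partial>?S)"
    unfolding overlap_law_def g_def by (rule integral_distr[OF ov measurable_overlap_test])
  also have "\<dots> = (\<integral>x. (\<integral>\<omega>. g (case_nat x \<omega>) \<partial>?S) \<partial>m)"
    by (rule sequence_space_integral_iter[OF pm g gB])
  also have "\<dots> = (\<integral>x. (\<integral>y. (\<integral>\<omega>. g (case_nat x (case_nat y \<omega>)) \<partial>?S) \<partial>m) \<partial>m)"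
    by (intro Bochner_Integration.integral_cong refl sequence_space_integral_iter[OF pm, where B=1]
        measurable_compose[OF meas1 g] gB)
  also have "\<dots> = (\<integral>x. (\<integral>y. (\<integral>z. (\<integral>\<omega>. g (case_nat x (case_nat y (case_nat z \<omega>))) \<partial>?S) \<partial>m) \<partial>m) \<partial>m)"
    by (intro Bochner_Integration.integral_cong refl sequence_space_integral_iter[OF pm, where B=1]
        measurable_compose[OF meas1 measurable_compose[OF meas1 g]] gB)
  also have "\<dots> = (\<integral>x. (\<integral>y. (\<integral>z. indicator (small_overlap_set a m) x * (y \<bullet> z) ^ k \<partial>m) \<partial>m) \<partial>m)"
  proof (intro Bochner_Integration.integral_cong refl)
    fix x y z assume x: "x \<in> space m" and yz: "y \<in> space m" "z \<in> space m"
    have B: "{w \<in> space m. \<bar>x \<bullet> w\<bar> \<le> a} \<in> sets m" using x by measurable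
    have "(\<integral>\<omega>. of_bool (\<forall>j. \<bar>x \<bullet> \<omega> j\<bar> \<le> a) \<partial>?S) =
      (\<integral>\<omega>. indicator {\<omega> \<in> space ?S. \<forall>j. \<omega> j \<in> {w \<in> space m. \<bar>x \<bullet> w\<bar> \<le> a}} \<omega> \<partial>?S :: real)"
      by (intro Bochner_Integration.integral_cong refl) (auto simp: indicator_def space_PiM Pi_iff)
    also have "\<dots> = of_bool (AE w in m. w \<in> {w \<in> space m. \<bar>x \<bullet> w\<bar> \<le> a})"
      using measure_iid_all[OF pm B] by simp
    also have "\<dots> = indicator (small_overlap_set a m) x"
      using x by (auto simp: small_overlap_set_def indicator_def)
    finally show "(\<integral>\<omega>. g (case_nat x (case_nat y (case_nat z \<omega>))) \<partial>?S) = indicator (small_overlap_set a m) x * (y \<bullet> z) ^ k"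
      by (simp add: g3[OF yz])
  qed
  also have "\<dots> = measure m (small_overlap_set a m) * overlap_moment k m"
    using sets.Int_space_eq2[OF sets_small_overlap_set[OF m]] by (simp add: overlap_moment_def)
  finally show ?thesis .
qed

section \<open>Exponential moments of the cavity field\<close>

lemma nn_integral_exp_normal_density:
  assumes "0 < s"
  shows "(\<integral>\<^sup>+x. ennreal (normal_density 0 s x) * ennreal (exp x) \<partial>lborel) = ennreal (exp (s\<^sup>2 / 2))"
proof -
  \<comment> \<open>Completing the square: the exponential factor moves the mean of the normal
    density to \<open>s\<^sup>2\<close>.\<close>
  have *: "normal_density 0 s x * exp x = exp (s\<^sup>2 / 2) * normal_density (s\<^sup>2) s x" for x
  proof -
    have "- x\<^sup>2 / (2 * s\<^sup>2) + x = s\<^sup>2 / 2 + - (x - s\<^sup>2)\<^sup>2 / (2 * s\<^sup>2)"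
      using assms by (simp add: field_simps power2_eq_square)
    then have "exp (- x\<^sup>2 / (2 * s\<^sup>2)) * exp x = exp (s\<^sup>2 / 2) * exp (- (x - s\<^sup>2)\<^sup>2 / (2 * s\<^sup>2))"
      by (simp only: exp_add [symmetric])
    then show ?thesis by (simp add: normal_density_def)
  qed
  have "(\<integral>\<^sup>+x. ennreal (normal_density 0 s x) * ennreal (exp x) \<partial>lborel) =
      (\<integral>\<^sup>+x. ennreal (exp (s\<^sup>2 / 2)) * ennreal (normal_density (s\<^sup>2) s x) \<partial>lborel)"
    by (intro nn_integral_cong) (simp add: ennreal_mult'[symmetric] *)
  also have "\<dots> = ennreal (exp (s\<^sup>2 / 2)) * (\<integral>\<^sup>+x. ennreal (normal_density (s\<^sup>2) s x) \<partial>lborel)"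
    by (rule nn_integral_cmult) simp
  also have "(\<integral>\<^sup>+x. ennreal (normal_density (s\<^sup>2) s x) \<partial>lborel) = 1"
    using assms by (subst nn_integral_eq_integral) (auto simp: normal_density_nonneg)
  finally show ?thesis by simp
qed

text \<open>The case \<open>s = 0\<close> is treated apart because a point mass has no density; the
  field at the origin is of this kind when the exponent is positive. The exponential moment is a
  nonnegative integral, so that its finiteness is part of the conclusion.\<close>

lemma
  assumes L: "prob_space L" and X: "gaussian_rv L X"
  shows gaussian_rv_integrable: "integrable L X"
    and gaussian_rv_integrable_square: "integrable L (\<lambda>x. (X x)\<^sup>2)"
    and gaussian_rv_exp: "(\<integral>x. X x \<partial>L) = 0 \<Longrightarrow>
      (\<integral>\<^sup>+x. ennreal (exp (X x)) \<partial>L) = ennreal (exp ((\<integral>x. (X x)\<^sup>2 \<partial>L) / 2))"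
proof -
  interpret L: prob_space L by fact
  from X obtain a s where [measurable]: "X \<in> borel_measurable L" and s: "0 \<le> s"
    and d: "distr L borel X = (if s = 0 then return borel a else density lborel (\<lambda>x. ennreal (normal_density a s x)))"
    unfolding gaussian_rv_def by blast
  have "integrable L X \<and> integrable L (\<lambda>x. (X x)\<^sup>2) \<and> ((\<integral>x. X x \<partial>L) = 0 \<longrightarrow>
      (\<integral>\<^sup>+x. ennreal (exp (X x)) \<partial>L) = ennreal (exp ((\<integral>x. (X x)\<^sup>2 \<partial>L) / 2)))"
  proof (cases "s = 0")
    case True
    have "AE y in distr L borel X. y = a" unfolding d using True by (simp add: AE_return)
    then have ae: "AE x in L. X x = a" by (subst (asm) AE_distr_iff) auto
    have "integrable L X"
      by (rule L.integrable_const_bound[where B="\<bar>a\<bar>"]) (use ae in auto)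
    moreover have "integrable L (\<lambda>x. (X x)\<^sup>2)"
      by (rule L.integrable_const_bound[where B="a\<^sup>2"]) (use ae in auto)
    moreover have "(\<integral>x. X x \<partial>L) = (\<integral>x. a \<partial>L)"
      by (rule integral_cong_AE) (use ae in auto)
    moreover have "(\<integral>x. (X x)\<^sup>2 \<partial>L) = (\<integral>x. a\<^sup>2 \<partial>L)"
      by (rule integral_cong_AE) (use ae in auto)
    moreover have "(\<integral>\<^sup>+x. ennreal (exp (X x)) \<partial>L) = (\<integral>\<^sup>+x. ennreal (exp a) \<partial>L)"
      by (rule nn_integral_cong_AE) (use ae in auto)
    ultimately show ?thesis by (simp add: L.emeasure_space_1 L.prob_space)
  next
    case False
    with s have s0: "0 < s" by simp
    have "distr L lborel X = distr L borel X" by (rule distr_cong) auto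
    then have D: "distributed L lborel X (\<lambda>x. ennreal (normal_density a s x))"
      using False d unfolding distributed_def by auto
    have mean: "(\<integral>x. X x \<partial>L) = a"
      using L.normal_distributed_expectation[OF s0 D] .
    have i1: "integrable L X"
      using distributed_integrable[OF D, of "\<lambda>x. x"] integrable_normal_moment_nz_1[OF s0, of a]
      by (auto simp: normal_density_nonneg)
    have i2': "integrable L (\<lambda>x. (X x - a)\<^sup>2)"
      using distributed_integrable[OF D, of "\<lambda>x. (x - a)\<^sup>2"] integrable_normal_moment[OF s0, of a 2]
      by (auto simp: normal_density_nonneg)
    have "integrable L (\<lambda>x. (X x - a)\<^sup>2 + 2 * a * X x - a\<^sup>2)"
      using i1 i2' by auto
    then have i2: "integrable L (\<lambda>x. (X x)\<^sup>2)"
      by (simp add: power2_eq_square algebra_simps)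
    have "(\<integral>\<^sup>+x. ennreal (exp (X x)) \<partial>L) = ennreal (exp ((\<integral>x. (X x)\<^sup>2 \<partial>L) / 2))" if "(\<integral>x. X x \<partial>L) = 0"
    proof -
      have a: "a = 0" using that mean by simp
      have "(\<integral>x. (X x)\<^sup>2 \<partial>L) = s\<^sup>2"
        using L.normal_distributed_variance[OF s0 D] that by simp
      moreover have "(\<integral>\<^sup>+x. ennreal (exp (X x)) \<partial>L) = (\<integral>\<^sup>+x. ennreal (normal_density a s x) * ennreal (exp x) \<partial>lborel)"
        by (rule distributed_nn_integral[OF D, symmetric]) simp
      ultimately show ?thesis using nn_integral_exp_normal_density[OF s0] a by simp
    qed
    with i1 i2 show ?thesis by simp
  qed
  then show "integrable L X" "integrable L (\<lambda>x. (X x)\<^sup>2)"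
    "(\<integral>x. X x \<partial>L) = 0 \<Longrightarrow> (\<integral>\<^sup>+x. ennreal (exp (X x)) \<partial>L) = ennreal (exp ((\<integral>x. (X x)\<^sup>2 \<partial>L) / 2))"
    by auto
qed

text \<open>The coupling \<open>lam\<close> is a parameter so that the same field can be
  reinterpreted at another coupling, as is done to prove that overlap moments are
  nonnegative.\<close>

locale cavity =
  fixes p :: nat and L :: "'l measure" and l :: "'h::{real_inner, polish_space} \<Rightarrow> 'l \<Rightarrow> real" and lam :: real
  assumes cavity_field: "cavity_field p L l"
begin

lemma prob_space_L: "prob_space L"
  using cavity_field by (simp add: cavity_field_def gaussian_process_def)

sublocale L: prob_space L
  by (rule prob_space_L)

lemma measurable_field [measurable]: "(\<lambda>(v, x). l v x) \<in> borel_measurable (ball_borel \<Otimes>\<^sub>M L)"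
  using cavity_field by (simp add: cavity_field_def)

lemma measurable_field_comp [measurable (raw)]:
  assumes "f \<in> K \<rightarrow>\<^sub>M ball_borel" "g \<in> K \<rightarrow>\<^sub>M L"
  shows "(\<lambda>k. l (f k) (g k)) \<in> borel_measurable K"
  using measurable_compose[OF measurable_Pair[OF assms] measurable_field] by simp

lemma gaussian_combination: "finite F \<Longrightarrow> F \<subseteq> cball 0 1 \<Longrightarrow> gaussian_rv L (\<lambda>x. \<Sum>t\<in>F. c t * l t x)"
  using cavity_field by (auto simp: cavity_field_def gaussian_process_def)

lemma gaussian_field: "v \<in> cball 0 1 \<Longrightarrow> gaussian_rv L (l v)"
  using gaussian_combination[of "{v}" "\<lambda>_. 1"] by simp

lemma field_mean: "v \<in> cball 0 1 \<Longrightarrow> (\<integral>x. l v x \<partial>L) = 0"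
  and field_covariance: "v \<in> cball 0 1 \<Longrightarrow> w \<in> cball 0 1 \<Longrightarrow> (\<integral>x. l v x * l w x \<partial>L) = (v \<bullet> w) ^ p"
  using cavity_field by (auto simp: cavity_field_def)

lemma integrable_field: "v \<in> cball 0 1 \<Longrightarrow> integrable L (l v)"
  using gaussian_rv_integrable[OF prob_space_L gaussian_field] .

lemma integrable_field_mult:
  assumes "v \<in> cball 0 1" "w \<in> cball 0 1"
  shows "integrable L (\<lambda>x. l v x * l w x)"
proof (rule Bochner_Integration.integrable_bound)
  show "integrable L (\<lambda>x. (l v x)\<^sup>2 + (l w x)\<^sup>2)"
    using assms by (intro Bochner_Integration.integrable_add gaussian_rv_integrable_square[OF prob_space_L] gaussian_field)
  show "(\<lambda>x. l v x * l w x) \<in> borel_measurable L"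
    using assms by (intro borel_measurable_times borel_measurable_integrable integrable_field)
  have "\<bar>a * b\<bar> \<le> a\<^sup>2 + b\<^sup>2" for a b :: real
  proof -
    have "2 * (\<bar>a\<bar> * \<bar>b\<bar>) \<le> a\<^sup>2 + b\<^sup>2" using sum_squares_bound[of "\<bar>a\<bar>" "\<bar>b\<bar>"] by simp
    moreover have "0 \<le> \<bar>a\<bar> * \<bar>b\<bar>" by simp
    ultimately show ?thesis by (simp only: abs_mult)
  qed
  then show "AE x in L. norm (l v x * l w x) \<le> norm ((l v x)\<^sup>2 + (l w x)\<^sup>2)"
    by simp
qed

lemma nn_integral_exp_combination:
  fixes v :: "'i \<Rightarrow> 'h"
  assumes I: "finite I" and v: "\<And>i. i \<in> I \<Longrightarrow> v i \<in> cball 0 1"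
  shows "(\<integral>\<^sup>+x. ennreal (exp (\<Sum>i\<in>I. c i * l (v i) x)) \<partial>L) =
    ennreal (exp ((\<Sum>i\<in>I. \<Sum>j\<in>I. c i * c j * (v i \<bullet> v j) ^ p) / 2))"
proof -
  have nv: "norm (v i) \<le> 1" if "i \<in> I" for i using v[OF that] by simp
  define X where "X x = (\<Sum>i\<in>I. c i * l (v i) x)" for x
  \<comment> \<open>Replicas may coincide, whereas \<open>gaussian_process\<close> speaks of sets of
    points; the coefficients of equal vectors are therefore added up first.\<close>
  have "X = (\<lambda>x. \<Sum>t\<in>v ` I. (\<Sum>i\<in>{i \<in> I. v i = t}. c i) * l t x)"
    unfolding X_def by (rule ext, subst sum.image_gen[OF I, of _ v]) (auto simp: sum_distrib_right intro!: sum.cong)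
  then have X: "gaussian_rv L X"
    using gaussian_combination[of "v ` I" "\<lambda>t. \<Sum>i\<in>{i \<in> I. v i = t}. c i"] I v by (simp add: image_subset_iff)
  have "(\<integral>x. X x \<partial>L) = 0"
    unfolding X_def by (subst Bochner_Integration.integral_sum) (simp_all add: integrable_field nv field_mean[OF v])
  moreover have "(\<integral>x. (X x)\<^sup>2 \<partial>L) = (\<Sum>i\<in>I. \<Sum>j\<in>I. c i * c j * (v i \<bullet> v j) ^ p)"
  proof -
    have "(\<integral>x. (X x)\<^sup>2 \<partial>L) = (\<integral>x. (\<Sum>i\<in>I. \<Sum>j\<in>I. c i * c j * (l (v i) x * l (v j) x)) \<partial>L)"
      by (intro Bochner_Integration.integral_cong refl)
        (simp add: X_def power2_eq_square sum_product ac_simps)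
    also have "\<dots> = (\<Sum>i\<in>I. \<Sum>j\<in>I. c i * c j * (v i \<bullet> v j) ^ p)"
      by (simp add: integrable_field_mult nv field_covariance)
    finally show ?thesis .
  qed
  ultimately show ?thesis
    using gaussian_rv_exp[OF prob_space_L X] by (simp add: X_def)
qed

definition wt :: "'h \<Rightarrow> 'l \<Rightarrow> real" where
  "wt v x = cavity_weight lam p (\<lambda>v. l v x) v"

lemma wt_pos [simp]: "0 < wt v x"
  by (simp add: wt_def cavity_weight_def)

lemma wt_nonneg [simp]: "0 \<le> wt v x"
  by (simp add: wt_def cavity_weight_def)

lemma wt_eq: "wt v x = exp (lam * l v x - lam\<^sup>2 / 2 * (v \<bullet> v) ^ p)"
  by (simp add: wt_def cavity_weight_def power_mult dot_square_norm)

lemma measurable_wt [measurable (raw)]: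
  assumes [measurable]: "f \<in> K \<rightarrow>\<^sub>M ball_borel" "g \<in> K \<rightarrow>\<^sub>M L"
  shows "(\<lambda>k. wt (f k) (g k)) \<in> borel_measurable K"
  unfolding wt_eq by measurable

text \<open>The compensator \<open>lam\<^sup>2 / 2 * norm v ^ (2 * p)\<close> of each weight cancels
  the diagonal of the covariance form, so only overlaps between different replicas survive. In
  particular a single weight has mean 1.\<close>

lemma nn_integral_prod_wt:
  fixes v :: "nat \<Rightarrow> 'h"
  assumes v: "\<And>i. i < n \<Longrightarrow> v i \<in> cball 0 1"
  shows "(\<integral>\<^sup>+x. ennreal (\<Prod>i<n. wt (v i) x) \<partial>L) =
    ennreal (exp (lam\<^sup>2 / 2 * ((\<Sum>i<n. \<Sum>j<n. (v i \<bullet> v j) ^ p) - (\<Sum>i<n. (v i \<bullet> v i) ^ p))))"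
proof -
  have nv: "norm (v i) \<le> 1" if "i < n" for i using v[OF that] by simp
  let ?c = "lam\<^sup>2 / 2 * (\<Sum>i<n. (v i \<bullet> v i) ^ p)"
  have "(\<Prod>i<n. wt (v i) x) = exp (- ?c) * exp (\<Sum>i<n. lam * l (v i) x)" for x
    unfolding wt_eq exp_sum[symmetric, OF finite_lessThan] exp_add[symmetric]
    by (simp add: sum_subtractf sum_distrib_left)
  then have "(\<integral>\<^sup>+x. ennreal (\<Prod>i<n. wt (v i) x) \<partial>L) = (\<integral>\<^sup>+x. ennreal (exp (- ?c)) * ennreal (exp (\<Sum>i<n. lam * l (v i) x)) \<partial>L)"
    by (simp add: ennreal_mult')
  also have "\<dots> = ennreal (exp (- ?c)) * (\<integral>\<^sup>+x. ennreal (exp (\<Sum>i<n. lam * l (v i) x)) \<partial>L)"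
    by (intro nn_integral_cmult) (measurable, simp_all add: nv)
  also have "\<dots> = ennreal (exp (- ?c) * exp ((\<Sum>i<n. \<Sum>j<n. lam * lam * (v i \<bullet> v j) ^ p) / 2))"
    by (subst nn_integral_exp_combination) (auto simp: nv ennreal_mult')
  also have "exp (- ?c) * exp ((\<Sum>i<n. \<Sum>j<n. lam * lam * (v i \<bullet> v j) ^ p) / 2) =
    exp (lam\<^sup>2 / 2 * ((\<Sum>i<n. \<Sum>j<n. (v i \<bullet> v j) ^ p) - (\<Sum>i<n. (v i \<bullet> v i) ^ p)))"
    by (simp add: exp_add[symmetric] sum_distrib_left[symmetric] power2_eq_square algebra_simps)
  finally show ?thesis .
qed

text \<open>The cases of one to four replicas, bracketed as they arise when a weight is multiplied
  by powers of the normalisation. Four are reached by one vector of \<open>N\<close> against the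
  third power.\<close>

lemma nn_integral_wt:
  assumes "a \<in> cball 0 1" "b \<in> cball 0 1" "c \<in> cball 0 1" "d \<in> cball 0 1"
  shows "(\<integral>\<^sup>+x. wt a x \<partial>L) = 1"
    and "(\<integral>\<^sup>+x. ennreal (wt a x) * wt b x \<partial>L) = exp (lam\<^sup>2 * (a \<bullet> b) ^ p)"
    and "(\<integral>\<^sup>+x. ennreal (wt a x) * (ennreal (wt b x) * wt c x) \<partial>L) =
      exp (lam\<^sup>2 * ((a \<bullet> b) ^ p + (a \<bullet> c) ^ p + (b \<bullet> c) ^ p))"
    and "(\<integral>\<^sup>+x. ennreal (wt a x) * (ennreal (wt b x) * (ennreal (wt c x) * wt d x)) \<partial>L) =
      exp (lam\<^sup>2 * ((a \<bullet> b) ^ p + (a \<bullet> c) ^ p + (a \<bullet> d) ^ p + (b \<bullet> c) ^ p + (b \<bullet> d) ^ p + (c \<bullet> d) ^ p))"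
proof -
  let ?v = "(!) [a, b, c, d]"
  have v: "?v i \<in> cball 0 1" if "i < n" "n \<le> 4" for i n
  proof -
    have "i = 0 \<or> i = 1 \<or> i = 2 \<or> i = 3" using that by auto
    then show ?thesis using assms by auto
  qed
  have prod_wt: "(\<integral>\<^sup>+x. ennreal (\<Prod>i<n. wt (?v i) x) \<partial>L) =
      ennreal (exp (lam\<^sup>2 / 2 * ((\<Sum>i<n. \<Sum>j<n. (?v i \<bullet> ?v j) ^ p) - (\<Sum>i<n. (?v i \<bullet> ?v i) ^ p))))" if "n \<le> 4" for n
    using that v by (intro nn_integral_prod_wt) auto
  have prods: "(\<Prod>i<1. wt (?v i) x) = wt a x"
    "(\<Prod>i<2. wt (?v i) x) = wt a x * wt b x"
    "(\<Prod>i<3. wt (?v i) x) = wt a x * (wt b x * wt c x)"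
    "(\<Prod>i<4. wt (?v i) x) = wt a x * (wt b x * (wt c x * wt d x))" for x
    by (simp_all add: numeral_eq_Suc ac_simps)
  have sums: "(\<Sum>i<n. f i) = (if n = 1 then f 0 else if n = 2 then f 0 + f 1 else if n = 3 then f 0 + f 1 + f 2 else f 0 + f 1 + f 2 + f 3)"
    if "n \<in> {1, 2, 3, 4}" for f :: "nat \<Rightarrow> real" and n :: nat
    using that by (auto simp: numeral_eq_Suc)
  note expand = prods sums inner_commute[of b a] inner_commute[of c a] inner_commute[of c b]
    inner_commute[of d a] inner_commute[of d b] inner_commute[of d c]
  show "(\<integral>\<^sup>+x. wt a x \<partial>L) = 1"
    using prod_wt[of 1] by simp
  have "lam\<^sup>2 / 2 * ((\<Sum>i<2. \<Sum>j<2. (?v i \<bullet> ?v j) ^ p) - (\<Sum>i<2. (?v i \<bullet> ?v i) ^ p)) = lam\<^sup>2 * (a \<bullet> b) ^ p"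
    by (simp add: expand)
  with prod_wt[of 2] show "(\<integral>\<^sup>+x. ennreal (wt a x) * wt b x \<partial>L) = exp (lam\<^sup>2 * (a \<bullet> b) ^ p)"
    by (simp add: prods ennreal_mult')
  have "lam\<^sup>2 / 2 * ((\<Sum>i<3. \<Sum>j<3. (?v i \<bullet> ?v j) ^ p) - (\<Sum>i<3. (?v i \<bullet> ?v i) ^ p)) =
      lam\<^sup>2 * ((a \<bullet> b) ^ p + (a \<bullet> c) ^ p + (b \<bullet> c) ^ p)"
    by (simp add: expand)
  with prod_wt[of 3] show "(\<integral>\<^sup>+x. ennreal (wt a x) * (ennreal (wt b x) * wt c x) \<partial>L) =
      exp (lam\<^sup>2 * ((a \<bullet> b) ^ p + (a \<bullet> c) ^ p + (b \<bullet> c) ^ p))"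
    by (simp add: prods ennreal_mult')
  have "lam\<^sup>2 / 2 * ((\<Sum>i<4. \<Sum>j<4. (?v i \<bullet> ?v j) ^ p) - (\<Sum>i<4. (?v i \<bullet> ?v i) ^ p)) =
      lam\<^sup>2 * ((a \<bullet> b) ^ p + (a \<bullet> c) ^ p + (a \<bullet> d) ^ p + (b \<bullet> c) ^ p + (b \<bullet> d) ^ p + (c \<bullet> d) ^ p)"
    by (simp add: expand)
  with prod_wt[of 4] show "(\<integral>\<^sup>+x. ennreal (wt a x) * (ennreal (wt b x) * (ennreal (wt c x) * wt d x)) \<partial>L) =
      exp (lam\<^sup>2 * ((a \<bullet> b) ^ p + (a \<bullet> c) ^ p + (a \<bullet> d) ^ p + (b \<bullet> c) ^ p + (b \<bullet> d) ^ p + (c \<bullet> d) ^ p))"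
    by (simp add: prods ennreal_mult')
qed

text \<open>The exact exponent is
  \<open>lam\<^sup>2 * ((c\<^sup>2 - c) / 2) * norm v ^ (2 * p)\<close>; the bound removes
  \<open>v\<close> and \<open>p\<close>. It serves below with \<open>c = -2\<close>, to control a
  negative moment of the tilted mass.\<close>

lemma nn_integral_wt_powr:
  assumes v: "v \<in> cball 0 1"
  shows "(\<integral>\<^sup>+x. ennreal (wt v x powr c) \<partial>L) \<le> ennreal (exp (lam\<^sup>2 * (c\<^sup>2 + \<bar>c\<bar>)))"
proof -
  let ?y = "(v \<bullet> v) ^ p"
  have y: "0 \<le> ?y" "?y \<le> 1"
    using abs_inner_ball_le[OF v v] by (auto intro: power_le_one)
  have "wt v x powr c = exp (- (c * lam\<^sup>2 / 2 * ?y)) * exp (\<Sum>i<1::nat. c * lam * l v x)" for x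
    by (simp add: wt_eq powr_def exp_add[symmetric] algebra_simps)
  then have "(\<integral>\<^sup>+x. ennreal (wt v x powr c) \<partial>L) = (\<integral>\<^sup>+x. ennreal (exp (- (c * lam\<^sup>2 / 2 * ?y))) * ennreal (exp (\<Sum>i<1::nat. c * lam * l v x)) \<partial>L)"
    by (simp add: ennreal_mult')
  also have "\<dots> = ennreal (exp (- (c * lam\<^sup>2 / 2 * ?y))) * (\<integral>\<^sup>+x. ennreal (exp (\<Sum>i<1::nat. c * lam * l v x)) \<partial>L)"
    using v by (intro nn_integral_cmult) measurable
  also have "\<dots> = ennreal (exp (- (c * lam\<^sup>2 / 2 * ?y)) * exp (c * lam * (c * lam) * ?y / 2))"
    using v by (subst nn_integral_exp_combination) (auto simp: ennreal_mult')
  also have "exp (- (c * lam\<^sup>2 / 2 * ?y)) * exp (c * lam * (c * lam) * ?y / 2) = exp (lam\<^sup>2 * ((c\<^sup>2 - c) / 2 * ?y))"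
    by (simp add: exp_add[symmetric] power2_eq_square field_simps)
  also have "\<dots> \<le> exp (lam\<^sup>2 * (c\<^sup>2 + \<bar>c\<bar>))"
  proof -
    have "(c\<^sup>2 - c) / 2 * ?y \<le> (c\<^sup>2 + \<bar>c\<bar>) * 1"
    proof (intro mult_mono)
      show "(c\<^sup>2 - c) / 2 \<le> c\<^sup>2 + \<bar>c\<bar>"
        by (rule order_trans[of _ "(c\<^sup>2 + \<bar>c\<bar>) / 2"]) (use abs_ge_minus_self[of c] in auto)
    qed (use y in auto)
    then have "lam\<^sup>2 * ((c\<^sup>2 - c) / 2 * ?y) \<le> lam\<^sup>2 * (c\<^sup>2 + \<bar>c\<bar>)"
      by (intro mult_left_mono) simp_all
    then show ?thesis by (simp only: exp_le_cancel_iff)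
  qed
  finally show ?thesis by (simp add: ennreal_leI)
qed

end

section \<open>Tilting a fixed measure\<close>

text \<open>Taylor's formula of first and second order; the intermediate point of the remainder
  contributes a factor between \<open>exp (- y)\<close> and \<open>exp y\<close>.\<close>

lemma exp_minus_one_bounds:
  fixes x y :: real
  assumes "\<bar>x\<bar> \<le> y"
  shows "\<bar>exp x - 1\<bar> \<le> \<bar>x\<bar> * exp y" and "exp (- y) * x\<^sup>2 / 2 \<le> exp x - 1 - x"
    and "exp x - 1 - x \<le> exp y * x\<^sup>2 / 2" and "\<bar>x\<bar> * exp (- y) \<le> \<bar>exp x - 1\<bar>"
proof -
  obtain t where t: "\<bar>t\<bar> \<le> \<bar>x\<bar>" "exp x = 1 + exp t * x"
    using Maclaurin_exp_le[of x 1] by (auto simp: mult.commute)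
  obtain u where u: "\<bar>u\<bar> \<le> \<bar>x\<bar>" "exp x = 1 + x + exp u * x\<^sup>2 / 2"
    using Maclaurin_exp_le[of x 2] by (auto simp: numeral_eq_Suc)
  have *: "exp (- y) \<le> exp t" "exp t \<le> exp y" "exp (- y) \<le> exp u" "exp u \<le> exp y"
    using t u assms by auto
  show "\<bar>exp x - 1\<bar> \<le> \<bar>x\<bar> * exp y" "\<bar>x\<bar> * exp (- y) \<le> \<bar>exp x - 1\<bar>"
    using * by (auto simp: t abs_mult mult.commute intro: mult_left_mono)
  show "exp (- y) * x\<^sup>2 / 2 \<le> exp x - 1 - x" "exp x - 1 - x \<le> exp y * x\<^sup>2 / 2"
    using * by (auto simp: u intro!: mult_right_mono divide_right_mono)
qed

text \<open>Both sides are of second order in \<open>x\<close>. The right-hand side is linear in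
  \<open>exp x\<close> and \<open>x\<close>, so that integrating it over two replicas produces only
  the second moment of \<open>Z\<close> and an overlap moment.\<close>

lemma exp_minus_one_square_le:
  fixes x y :: real
  assumes "\<bar>x\<bar> \<le> y"
  shows "(exp x - 1)\<^sup>2 \<le> 2 * exp (3 * y) * (exp x - 1 - x)"
proof -
  have "(exp x - 1)\<^sup>2 \<le> (\<bar>x\<bar> * exp y)\<^sup>2"
    using exp_minus_one_bounds(1)[OF assms] by (simp add: abs_le_square_iff[symmetric])
  also have "\<dots> = 2 * exp (3 * y) * (exp (- y) * x\<^sup>2 / 2)"
    by (simp add: power_mult_distrib exp_double[symmetric] exp_add[symmetric] field_simps)
  also have "\<dots> \<le> 2 * exp (3 * y) * (exp x - 1 - x)"
    using exp_minus_one_bounds(2)[OF assms] by (intro mult_left_mono) auto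
  finally show ?thesis .
qed

text \<open>In terms of the deviations from 1 the linear parts of both sides agree, and products of
  two or three deviations are dominated by squares; the bound \<open>Y\<close> pulls one factor out
  of the triple product.\<close>

lemma triple_product_le:
  fixes a b c Y :: real
  assumes "\<bar>a - 1\<bar> \<le> Y" "0 \<le> Y"
  shows "a * b * c + 2 \<le> a + b + c + (1 + Y) * ((a - 1)\<^sup>2 + (b - 1)\<^sup>2 + (c - 1)\<^sup>2)"
proof -
  define u v w where uvw: "u = a - 1" "v = b - 1" "w = c - 1"
  have amgm: "\<bar>s\<bar> * \<bar>t\<bar> \<le> (s\<^sup>2 + t\<^sup>2) / 2" for s t :: real
    using sum_squares_bound[of "\<bar>s\<bar>" "\<bar>t\<bar>"] by simp
  have "u * v \<le> (u\<^sup>2 + v\<^sup>2) / 2" "u * w \<le> (u\<^sup>2 + w\<^sup>2) / 2" "v * w \<le> (v\<^sup>2 + w\<^sup>2) / 2"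
    using sum_squares_bound[of u v] sum_squares_bound[of u w] sum_squares_bound[of v w] by simp_all
  moreover have "u * v * w \<le> Y * (u\<^sup>2 + v\<^sup>2 + w\<^sup>2)"
  proof -
    have "u * v * w \<le> \<bar>u\<bar> * (\<bar>v\<bar> * \<bar>w\<bar>)" by (metis abs_ge_self abs_mult mult.assoc)
    also have "\<dots> \<le> Y * ((v\<^sup>2 + w\<^sup>2) / 2)"
      using assms amgm[of v w] by (intro mult_mono) (auto simp: uvw)
    also have "\<dots> \<le> Y * (u\<^sup>2 + v\<^sup>2 + w\<^sup>2)"
      using assms by (intro mult_left_mono) auto
    finally show ?thesis .
  qed
  ultimately have "u * v + u * w + v * w + u * v * w \<le> (1 + Y) * (u\<^sup>2 + v\<^sup>2 + w\<^sup>2)"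
    by (simp add: algebra_simps)
  then show ?thesis unfolding uvw by (simp add: algebra_simps)
qed

locale cavity_measure = cavity p L l lam
  for p :: nat and L :: "'l measure" and l :: "'h::{real_inner, polish_space} \<Rightarrow> 'l \<Rightarrow> real" and lam :: real +
  fixes m :: "'h measure"
  assumes m_in: "m \<in> space (prob_algebra ball_borel)"
begin

lemma sets_m [measurable_cong]: "sets m = sets ball_borel"
  using m_in by (simp add: space_prob_algebra)

lemma space_m [simp]: "space m = cball 0 1"
  using sets_eq_imp_space_eq[OF sets_m] by simp

sublocale m: prob_space m
  using m_in by (simp add: space_prob_algebra)

sublocale mL: pair_prob_space m L ..
sublocale mm: pair_prob_space m m ..

text \<open>The unnormalised mass of \<open>A\<close> after tilting: where \<open>Z x\<close> is
  finite, the tilted measure gives \<open>A\<close> the mass \<open>W A x / Z x\<close>. Values in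
  \<open>ennreal\<close> allow Fubini before finiteness is known.\<close>

definition W :: "'h set \<Rightarrow> 'l \<Rightarrow> ennreal" where
  "W A x = (\<integral>\<^sup>+v. ennreal (wt v x) * indicator A v \<partial>m)"

definition Z :: "'l \<Rightarrow> ennreal" where
  "Z x = (\<integral>\<^sup>+v. ennreal (wt v x) \<partial>m)"

definition tilt :: "'l \<Rightarrow> 'h measure" where
  "tilt x = cavity_tilt lam p (\<lambda>v. l v x) m"

text \<open>The two-replica kernel: for vectors of the ball, the mean of
  \<open>wt v x * wt w x\<close> over the field.\<close>

definition K :: "'h \<Rightarrow> 'h \<Rightarrow> real" where
  "K v w = exp (lam\<^sup>2 * (v \<bullet> w) ^ p)"

lemma K_pos [simp]: "0 < K v w" "0 \<le> K v w"
  by (simp_all add: K_def)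

lemma measurable_K [measurable (raw)]:
  assumes [measurable]: "f \<in> S \<rightarrow>\<^sub>M ball_borel" "g \<in> S \<rightarrow>\<^sub>M ball_borel"
  shows "(\<lambda>s. K (f s) (g s)) \<in> borel_measurable S"
  unfolding K_def by measurable

lemma measurable_Z [measurable]: "Z \<in> borel_measurable L"
  unfolding Z_def by measurable

lemma measurable_W [measurable]:
  assumes [measurable]: "A \<in> sets ball_borel"
  shows "W A \<in> borel_measurable L"
  unfolding W_def by measurable

lemma W_le_Z: "W A x \<le> Z x"
  unfolding W_def Z_def by (intro nn_integral_mono) (auto simp: indicator_def)

lemma nn_integral_W_mult:
  assumes [measurable]: "h \<in> borel_measurable L" "A \<in> sets ball_borel"
  shows "(\<integral>\<^sup>+x. W A x * h x \<partial>L) = (\<integral>\<^sup>+v. (\<integral>\<^sup>+x. ennreal (wt v x) * h x \<partial>L) * indicator A v \<partial>m)"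
proof -
  have "(\<integral>\<^sup>+x. W A x * h x \<partial>L) = (\<integral>\<^sup>+x. (\<integral>\<^sup>+v. ennreal (wt v x) * indicator A v * h x \<partial>m) \<partial>L)"
    unfolding W_def by (intro nn_integral_cong nn_integral_multc[symmetric]) measurable
  also have "\<dots> = (\<integral>\<^sup>+v. (\<integral>\<^sup>+x. ennreal (wt v x) * indicator A v * h x \<partial>L) \<partial>m)"
    by (rule mL.Fubini') measurable
  also have "\<dots> = (\<integral>\<^sup>+v. (\<integral>\<^sup>+x. ennreal (wt v x) * h x * indicator A v \<partial>L) \<partial>m)"
    by (intro nn_integral_cong) (simp add: ac_simps)
  also have "\<dots> = (\<integral>\<^sup>+v. (\<integral>\<^sup>+x. ennreal (wt v x) * h x \<partial>L) * indicator A v \<partial>m)"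
    by (intro nn_integral_cong nn_integral_multc) measurable
  finally show ?thesis .
qed

text \<open>One factor \<open>Z\<close> is traded for a further replica drawn from \<open>m\<close>;
  \<open>g\<close> holds the weights already expanded and \<open>h\<close> the powers still to
  come.\<close>

lemma nn_integral_mult_Z_mult:
  assumes [measurable]: "g \<in> borel_measurable L" "h \<in> borel_measurable L"
  shows "(\<integral>\<^sup>+x. g x * (Z x * h x) \<partial>L) = (\<integral>\<^sup>+v. (\<integral>\<^sup>+x. g x * (ennreal (wt v x) * h x) \<partial>L) \<partial>m)"
proof -
  have "(\<integral>\<^sup>+x. g x * (Z x * h x) \<partial>L) = (\<integral>\<^sup>+x. (\<integral>\<^sup>+v. g x * (ennreal (wt v x) * h x) \<partial>m) \<partial>L)"
  proof (rule nn_integral_cong)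
    fix x assume x: "x \<in> space L"
    show "g x * (Z x * h x) = (\<integral>\<^sup>+v. g x * (ennreal (wt v x) * h x) \<partial>m)"
      unfolding Z_def using x by (simp add: nn_integral_multc nn_integral_cmult)
  qed
  also have "\<dots> = (\<integral>\<^sup>+v. (\<integral>\<^sup>+x. g x * (ennreal (wt v x) * h x) \<partial>L) \<partial>m)"
    by (rule mL.Fubini') measurable
  finally show ?thesis .
qed

text \<open>Every \<open>Z\<close> becomes a replica, and the Gaussian formula turns the product of
  weights into the product of \<open>K\<close> over all pairs.\<close>

lemma nn_integral_wt_Z:
  assumes v: "v \<in> space m"
  shows "(\<integral>\<^sup>+x. ennreal (wt v x) * Z x \<partial>L) = (\<integral>\<^sup>+b. ennreal (K v b) \<partial>m)"
    and "(\<integral>\<^sup>+x. ennreal (wt v x) * (Z x * Z x) \<partial>L) = (\<integral>\<^sup>+b. (\<integral>\<^sup>+c. ennreal (K v b * K v c * K b c) \<partial>m) \<partial>m)"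
    and "(\<integral>\<^sup>+x. ennreal (wt v x) * (Z x * (Z x * Z x)) \<partial>L) =
      (\<integral>\<^sup>+b. (\<integral>\<^sup>+c. (\<integral>\<^sup>+d. ennreal (K v b * K v c * K v d * K b c * K b d * K c d) \<partial>m) \<partial>m) \<partial>m)"
proof -
  have Z1: "(\<integral>\<^sup>+x. g x * Z x \<partial>L) = (\<integral>\<^sup>+v. (\<integral>\<^sup>+x. g x * ennreal (wt v x) \<partial>L) \<partial>m)"
    if "g \<in> borel_measurable L" for g
    using nn_integral_mult_Z_mult[of g "\<lambda>_. 1"] that by simp
  have mw [measurable]: "wt u \<in> borel_measurable L" if "u \<in> space m" for u
    using measurable_wt[of "\<lambda>_. u" L "\<lambda>x. x"] that by simp
  show "(\<integral>\<^sup>+x. ennreal (wt v x) * Z x \<partial>L) = (\<integral>\<^sup>+b. ennreal (K v b) \<partial>m)"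
    using v by (subst Z1) (auto simp: nn_integral_wt K_def intro!: nn_integral_cong)
  have "(\<integral>\<^sup>+x. ennreal (wt v x) * (Z x * Z x) \<partial>L) =
      (\<integral>\<^sup>+b. (\<integral>\<^sup>+x. (ennreal (wt v x) * ennreal (wt b x)) * Z x \<partial>L) \<partial>m)"
    using v by (subst nn_integral_mult_Z_mult) (auto simp: mult.assoc)
  also have "\<dots> = (\<integral>\<^sup>+b. (\<integral>\<^sup>+c. (\<integral>\<^sup>+x. ennreal (wt v x) * (ennreal (wt b x) * ennreal (wt c x)) \<partial>L) \<partial>m) \<partial>m)"
    using v by (intro nn_integral_cong, subst Z1) (auto simp: mult.assoc)
  also have "\<dots> = (\<integral>\<^sup>+b. (\<integral>\<^sup>+c. ennreal (K v b * K v c * K b c) \<partial>m) \<partial>m)"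
    using v by (intro nn_integral_cong) (simp add: nn_integral_wt K_def exp_add[symmetric] distrib_left)
  finally show "(\<integral>\<^sup>+x. ennreal (wt v x) * (Z x * Z x) \<partial>L) = \<dots>" .
  have "(\<integral>\<^sup>+x. ennreal (wt v x) * (Z x * (Z x * Z x)) \<partial>L) =
      (\<integral>\<^sup>+b. (\<integral>\<^sup>+x. (ennreal (wt v x) * ennreal (wt b x)) * (Z x * Z x) \<partial>L) \<partial>m)"
    using v by (subst nn_integral_mult_Z_mult) (auto simp: mult.assoc)
  also have "\<dots> = (\<integral>\<^sup>+b. (\<integral>\<^sup>+c. (\<integral>\<^sup>+x. (ennreal (wt v x) * ennreal (wt b x) * ennreal (wt c x)) * Z x \<partial>L) \<partial>m) \<partial>m)"
    using v by (intro nn_integral_cong, subst nn_integral_mult_Z_mult) (auto simp: mult.assoc)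
  also have "\<dots> = (\<integral>\<^sup>+b. (\<integral>\<^sup>+c. (\<integral>\<^sup>+d. (\<integral>\<^sup>+x. ennreal (wt v x) * (ennreal (wt b x) * (ennreal (wt c x) * ennreal (wt d x))) \<partial>L) \<partial>m) \<partial>m) \<partial>m)"
    using v by (intro nn_integral_cong, subst Z1) (auto simp: mult.assoc)
  also have "\<dots> = (\<integral>\<^sup>+b. (\<integral>\<^sup>+c. (\<integral>\<^sup>+d. ennreal (K v b * K v c * K v d * K b c * K b d * K c d) \<partial>m) \<partial>m) \<partial>m)"
    using v by (intro nn_integral_cong) (simp add: nn_integral_wt K_def exp_add[symmetric] distrib_left)
  finally show "(\<integral>\<^sup>+x. ennreal (wt v x) * (Z x * (Z x * Z x)) \<partial>L) = \<dots>" .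
qed

lemma W_cball: "W (cball 0 1) x = Z x"
  unfolding W_def Z_def by (intro nn_integral_cong) auto

lemma sets_cball [measurable]: "(cball 0 1 :: 'h set) \<in> sets ball_borel"
  using sets.top[of "ball_borel :: 'h measure"] by (simp only: space_ball_borel)

lemma nn_integral_Z: "(\<integral>\<^sup>+x. Z x \<partial>L) = 1"
  and nn_integral_Z2: "(\<integral>\<^sup>+x. Z x * Z x \<partial>L) = (\<integral>\<^sup>+v. (\<integral>\<^sup>+w. ennreal (K v w) \<partial>m) \<partial>m)"
  and nn_integral_Z3: "(\<integral>\<^sup>+x. Z x * (Z x * Z x) \<partial>L) = (\<integral>\<^sup>+v. (\<integral>\<^sup>+b. (\<integral>\<^sup>+c. ennreal (K v b * K v c * K b c) \<partial>m) \<partial>m) \<partial>m)"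
proof -
  have *: "(\<integral>\<^sup>+x. Z x * h x \<partial>L) = (\<integral>\<^sup>+v. (\<integral>\<^sup>+x. ennreal (wt v x) * h x \<partial>L) \<partial>m)"
    if "h \<in> borel_measurable L" for h
    using nn_integral_mult_Z_mult[of "\<lambda>_. 1" h] that by simp
  show "(\<integral>\<^sup>+x. Z x \<partial>L) = 1"
    using *[of "\<lambda>_. 1"] nn_integral_cong[of m "\<lambda>v. \<integral>\<^sup>+x. ennreal (wt v x) \<partial>L" "\<lambda>_. 1"]
    by (simp add: nn_integral_wt(1) m.emeasure_space_1[simplified])
  show "(\<integral>\<^sup>+x. Z x * Z x \<partial>L) = (\<integral>\<^sup>+v. (\<integral>\<^sup>+w. ennreal (K v w) \<partial>m) \<partial>m)"
    by (subst *) (auto simp: nn_integral_wt_Z intro!: nn_integral_cong)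
  show "(\<integral>\<^sup>+x. Z x * (Z x * Z x) \<partial>L) = (\<integral>\<^sup>+v. (\<integral>\<^sup>+b. (\<integral>\<^sup>+c. ennreal (K v b * K v c * K b c) \<partial>m) \<partial>m) \<partial>m)"
    by (subst *) (auto simp: nn_integral_wt_Z intro!: nn_integral_cong)
qed

end

lemma integral_enn2real:
  assumes [measurable]: "f \<in> borel_measurable M" and f: "(\<integral>\<^sup>+x. f x \<partial>M) = ennreal r" "0 \<le> r"
  shows "integrable M (\<lambda>x. enn2real (f x))" and "(\<integral>x. enn2real (f x) \<partial>M) = r"
proof -
  have "AE x in M. f x \<noteq> \<infinity>" by (rule nn_integral_PInf_AE) (auto simp: f)
  then have e: "AE x in M. f x = ennreal (enn2real (f x))" by eventually_elim (auto simp: less_top)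
  have eq: "(\<integral>\<^sup>+x. ennreal (enn2real (f x)) \<partial>M) = ennreal r"
    using f nn_integral_cong_AE[OF e] by simp
  then show "integrable M (\<lambda>x. enn2real (f x))"
    by (intro integrableI_nonneg) auto
  show "(\<integral>x. enn2real (f x) \<partial>M) = r"
    using eq f by (subst integral_eq_nn_integral) auto
qed

lemma integral_enn2real_le:
  assumes [measurable]: "f \<in> borel_measurable M" and f: "(\<integral>\<^sup>+x. f x \<partial>M) \<le> ennreal r" "0 \<le> r"
  shows "integrable M (\<lambda>x. enn2real (f x))" and "(\<integral>x. enn2real (f x) \<partial>M) \<le> r"
proof -
  obtain s where s: "(\<integral>\<^sup>+x. f x \<partial>M) = ennreal s" "0 \<le> s" "s \<le> r"
    using f by (cases "\<integral>\<^sup>+x. f x \<partial>M") (auto simp: top_unique)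
  then show "integrable M (\<lambda>x. enn2real (f x))" "(\<integral>x. enn2real (f x) \<partial>M) \<le> r"
    using integral_enn2real[OF _ s(1,2)] by auto
qed

section \<open>The tilted measure: mass, null sets and measurability\<close>

context cavity_measure
begin

lemma Z_pos: "x \<in> space L \<Longrightarrow> 0 < Z x"
proof -
  assume x: "x \<in> space L"
  have "Z x \<noteq> 0"
    unfolding Z_def using x
    by (subst nn_integral_0_iff_AE) (auto simp: ennreal_eq_0_iff not_le[THEN iffD2, OF wt_pos] m.AE_False)
  then show ?thesis by (simp add: zero_less_iff_neq_zero)
qed

lemma AE_Z_finite: "AE x in L. Z x \<noteq> \<infinity>"
  by (rule nn_integral_PInf_AE) (auto simp: nn_integral_Z)

lemma tilt_eq: "tilt x = (if Z x = \<infinity> then m else density m (\<lambda>v. ennreal (wt v x) / Z x))"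
  unfolding tilt_def cavity_tilt_def Let_def Z_def wt_def ..

lemma sets_tilt: "sets (tilt x) = sets ball_borel"
  by (simp add: tilt_eq sets_m)

lemma emeasure_tilt:
  assumes x: "x \<in> space L" and Z: "Z x \<noteq> \<infinity>" and A [measurable]: "A \<in> sets ball_borel"
  shows "emeasure (tilt x) A = W A x / Z x"
proof -
  have "emeasure (tilt x) A = (\<integral>\<^sup>+v. ennreal (wt v x) / Z x * indicator A v \<partial>m)"
    using x Z by (simp add: tilt_eq emeasure_density)
  also have "\<dots> = (\<integral>\<^sup>+v. ennreal (wt v x) * indicator A v / Z x \<partial>m)"
    by (intro nn_integral_cong) (simp add: indicator_def)
  also have "\<dots> = W A x / Z x"
    unfolding W_def using x by (intro nn_integral_divide) measurable
  finally show ?thesis .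
qed

lemma tilt_in: "x \<in> space L \<Longrightarrow> tilt x \<in> space (prob_algebra ball_borel)"
proof -
  assume x: "x \<in> space L"
  have "emeasure (tilt x) (cball 0 1) = 1"
  proof (cases "Z x = \<infinity>")
    case True
    then show ?thesis using m.emeasure_space_1 by (simp add: tilt_eq)
  next
    case False
    then show ?thesis
      using emeasure_tilt[OF x False sets_cball] Z_pos[OF x] by (simp add: W_cball less_top[symmetric])
  qed
  moreover have "space (tilt x) = cball 0 1"
    using sets_eq_imp_space_eq[OF sets_tilt] by simp
  ultimately show ?thesis
    by (auto simp: space_prob_algebra sets_tilt intro!: prob_spaceI)
qed

text \<open>The weight is strictly positive and the normalisation finite, so the density never
  vanishes; in the exceptional case the tilt is \<open>m\<close> itself.\<close>

lemma AE_tilt: "x \<in> space L \<Longrightarrow> (AE v in tilt x. P v) \<longleftrightarrow> (AE v in m. P v)"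
proof (cases "Z x = \<infinity>")
  case False
  assume [measurable]: "x \<in> space L"
  have "(AE v in tilt x. P v) \<longleftrightarrow> (AE v in m. 0 < ennreal (wt v x) / Z x \<longrightarrow> P v)"
    unfolding tilt_eq if_not_P[OF False] by (rule AE_density) measurable
  also have "\<dots> \<longleftrightarrow> (AE v in m. P v)"
    using False by (simp add: ennreal_zero_less_divide less_top[symmetric])
  finally show ?thesis .
next
  case True
  then have "tilt x = m" by (simp add: tilt_eq)
  then show ?thesis by (rule arg_cong)
qed

lemma small_overlap_set_tilt: "x \<in> space L \<Longrightarrow> small_overlap_set a (tilt x) = small_overlap_set a m"
  by (simp add: small_overlap_set_def AE_tilt)

lemma nn_integral_tilt:
  assumes x: "x \<in> space L" and Z: "Z x \<noteq> \<infinity>" and [measurable]: "f \<in> borel_measurable ball_borel"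
  shows "(\<integral>\<^sup>+v. f v \<partial>tilt x) = (\<integral>\<^sup>+v. ennreal (wt v x) * f v \<partial>m) / Z x"
proof -
  have "(\<integral>\<^sup>+v. f v \<partial>tilt x) = (\<integral>\<^sup>+v. ennreal (wt v x) / Z x * f v \<partial>m)"
    using x Z by (simp add: tilt_eq nn_integral_density)
  also have "\<dots> = (\<integral>\<^sup>+v. ennreal (wt v x) * f v / Z x \<partial>m)"
    by (intro nn_integral_cong) (simp add: ennreal_times_divide mult.commute)
  also have "\<dots> = (\<integral>\<^sup>+v. ennreal (wt v x) * f v \<partial>m) / Z x"
    using x by (intro nn_integral_divide) measurable
  finally show ?thesis .
qed

end

text \<open>Joint measurability is required because the cavity mapping integrates over the random
  measure as well as over the field; hence the statement lives outside the locale that fixes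
  \<open>m\<close>.\<close>

lemma (in cavity) measurable_cavity_tilt:
  "(\<lambda>(m, x). cavity_tilt lam p (\<lambda>v. l v x) m) \<in> prob_algebra ball_borel \<Otimes>\<^sub>M L \<rightarrow>\<^sub>M prob_algebra ball_borel"
proof -
  let ?P = "prob_algebra (ball_borel :: 'h measure) \<Otimes>\<^sub>M L"
  let ?T = "\<lambda>mx. case mx of (m, x) \<Rightarrow> cavity_tilt lam p (\<lambda>v. l v x) m"
  have T: "?T mx \<in> space (prob_algebra ball_borel)" if mx: "mx \<in> space ?P" for mx
  proof -
    obtain m x where Pair: "mx = (m, x)" by (cases mx)
    with mx interpret cavity_measure p L l lam m
      by unfold_locales (simp add: space_pair_measure)
    show ?thesis using mx tilt_in[of x] Pair by (simp add: tilt_def space_pair_measure)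
  qed
  show ?thesis
  proof (intro measurable_prob_algebraI measurable_subprob_algebra)
    show "prob_space (?T mx)" "subprob_space (?T mx)" "sets (?T mx) = sets ball_borel" if "mx \<in> space ?P" for mx
      using T[OF that] by (simp_all add: space_prob_algebra prob_space_imp_subprob_space)
    fix A assume A [measurable]: "A \<in> sets (ball_borel :: 'h measure)"
    have fst_meas: "fst \<in> ?P \<rightarrow>\<^sub>M subprob_algebra ball_borel"
      by (rule measurable_prob_algebraD) measurable
    define ZZ where "ZZ mx = (\<integral>\<^sup>+v. ennreal (wt v (snd mx)) \<partial>fst mx)" for mx :: "'h measure \<times> 'l"
    have ZZ [measurable]: "ZZ \<in> borel_measurable ?P"
      unfolding ZZ_def by (rule nn_integral_measurable_subprob_algebra2[OF _ fst_meas]) measurable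
    have W: "(\<lambda>mx. \<integral>\<^sup>+v. ennreal (wt v (snd mx)) * indicator A v \<partial>fst mx) \<in> borel_measurable ?P"
      by (rule nn_integral_measurable_subprob_algebra2[OF _ fst_meas]) measurable
    have E: "(\<lambda>mx. emeasure (fst mx) A) \<in> borel_measurable ?P"
      by (rule measurable_compose[OF fst_meas measurable_emeasure_subprob_algebra]) simp
    have "(\<lambda>mx. if ZZ mx = \<infinity> then emeasure (fst mx) A else (\<integral>\<^sup>+v. ennreal (wt v (snd mx)) * indicator A v \<partial>fst mx) / ZZ mx) \<in> borel_measurable ?P"
      using W E by measurable
    also have "?this \<longleftrightarrow> (\<lambda>mx. emeasure (case mx of (m, x) \<Rightarrow> cavity_tilt lam p (\<lambda>v. l v x) m) A) \<in> borel_measurable ?P"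
    proof (intro measurable_cong)
      fix mx assume mx: "mx \<in> space ?P"
      obtain m x where Pair: "mx = (m, x)" by (cases mx)
      with mx interpret cavity_measure p L l lam m
        by unfold_locales (simp add: space_pair_measure)
      have "ZZ mx = Z x" "(\<integral>\<^sup>+v. ennreal (wt v (snd mx)) * indicator A v \<partial>fst mx) = W A x"
        by (simp_all add: ZZ_def Z_def W_def Pair)
      then show "(if ZZ mx = \<infinity> then emeasure (fst mx) A else (\<integral>\<^sup>+v. ennreal (wt v (snd mx)) * indicator A v \<partial>fst mx) / ZZ mx) =
          emeasure (case mx of (m, x) \<Rightarrow> cavity_tilt lam p (\<lambda>v. l v x) m) A"
        using emeasure_tilt[of x A] mx by (simp add: Pair space_pair_measure) (simp add: tilt_def tilt_eq[unfolded tilt_def])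
    qed
    finally show "(\<lambda>mx. emeasure (case mx of (m, x) \<Rightarrow> cavity_tilt lam p (\<lambda>v. l v x) m) A) \<in> borel_measurable ?P" .
  qed
qed

context cavity_measure
begin

lemma measurable_tilt [measurable]: "tilt \<in> L \<rightarrow>\<^sub>M prob_algebra ball_borel"
  unfolding tilt_def
  using measurable_compose[OF measurable_Pair1'[OF m_in] measurable_cavity_tilt] by simp

lemma K_le: "v \<in> cball 0 1 \<Longrightarrow> w \<in> cball 0 1 \<Longrightarrow> K v w \<le> exp (lam\<^sup>2)"
proof -
  assume "v \<in> cball 0 1" "w \<in> cball 0 1"
  then have "(v \<bullet> w) ^ p \<le> 1"
    using power_le_one[of "\<bar>v \<bullet> w\<bar>" p] abs_inner_ball_le[of v w] abs_ge_self[of "(v \<bullet> w) ^ p"]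
    by (simp add: power_abs)
  then show ?thesis by (simp add: K_def mult_left_le)
qed

definition e2 :: real where "e2 = enn2real (\<integral>\<^sup>+x. Z x * Z x \<partial>L)"
definition e3 :: real where "e3 = enn2real (\<integral>\<^sup>+x. Z x * (Z x * Z x) \<partial>L)"

lemma nn_integral_le_const:
  assumes "\<And>v. v \<in> space m \<Longrightarrow> f v \<le> c"
  shows "(\<integral>\<^sup>+v. f v \<partial>m) \<le> c"
proof -
  have "(\<integral>\<^sup>+v. f v \<partial>m) \<le> (\<integral>\<^sup>+v. c \<partial>m)" using assms by (intro nn_integral_mono)
  then show ?thesis using m.emeasure_space_1 by simp
qed

lemma e2: "(\<integral>\<^sup>+x. Z x * Z x \<partial>L) = ennreal e2" "0 \<le> e2" "e2 \<le> exp (lam\<^sup>2)"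
proof -
  have *: "(\<integral>\<^sup>+x. Z x * Z x \<partial>L) \<le> ennreal (exp (lam\<^sup>2))"
    unfolding nn_integral_Z2 by (intro nn_integral_le_const ennreal_leI K_le) auto
  then show "(\<integral>\<^sup>+x. Z x * Z x \<partial>L) = ennreal e2"
    unfolding e2_def by (intro ennreal_enn2real[symmetric]) (auto simp: le_less_trans)
  with * have "ennreal e2 \<le> ennreal (exp (lam\<^sup>2))" by simp
  then show "e2 \<le> exp (lam\<^sup>2)" by (simp add: ennreal_le_iff)
qed (simp add: e2_def)

lemma e3: "(\<integral>\<^sup>+x. Z x * (Z x * Z x) \<partial>L) = ennreal e3" "0 \<le> e3" "e3 \<le> exp (3 * lam\<^sup>2)"
proof -
  have *: "(\<integral>\<^sup>+x. Z x * (Z x * Z x) \<partial>L) \<le> ennreal (exp (3 * lam\<^sup>2))"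
  proof -
    have "K v b * K v c * K b c \<le> exp (lam\<^sup>2) * exp (lam\<^sup>2) * exp (lam\<^sup>2)"
      if "v \<in> space m" "b \<in> space m" "c \<in> space m" for v b c
      using that by (intro mult_mono K_le) auto
    then show ?thesis
      unfolding nn_integral_Z3 by (intro nn_integral_le_const ennreal_leI) (auto simp: exp_add[symmetric])
  qed
  then show "(\<integral>\<^sup>+x. Z x * (Z x * Z x) \<partial>L) = ennreal e3"
    unfolding e3_def by (intro ennreal_enn2real[symmetric]) (auto simp: le_less_trans)
  with * have "ennreal e3 \<le> ennreal (exp (3 * lam\<^sup>2))" by simp
  then show "e3 \<le> exp (3 * lam\<^sup>2)" by (simp add: ennreal_le_iff)
qed (simp add: e3_def)

lemma nn_integral_eq_integral2:
  assumes [measurable]: "(\<lambda>(v, w). f v w) \<in> borel_measurable (ball_borel \<Otimes>\<^sub>M ball_borel)"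
    and b: "\<And>v w. v \<in> space m \<Longrightarrow> w \<in> space m \<Longrightarrow> 0 \<le> f v w \<and> f v w \<le> B"
  shows "(\<integral>\<^sup>+v. (\<integral>\<^sup>+w. ennreal (f v w) \<partial>m) \<partial>m) = ennreal (\<integral>v. (\<integral>w. f v w \<partial>m) \<partial>m)"
proof -
  have i: "integrable m (f v)" if "v \<in> space m" for v
    using that b by (intro m.integrable_const_bound[where B=B]) (auto intro!: AE_I2)
  have le: "(\<integral>w. f v w \<partial>m) \<le> B" if "v \<in> space m" for v
  proof -
    have "(\<integral>w. f v w \<partial>m) \<le> (\<integral>w. B \<partial>m)" using that b i by (intro integral_mono) auto
    then show ?thesis by (simp add: m.prob_space[simplified])
  qed
  have ge: "0 \<le> (\<integral>w. f v w \<partial>m)" if "v \<in> space m" for v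
    using that b by (intro Bochner_Integration.integral_nonneg_AE AE_I2) auto
  have "(\<integral>\<^sup>+v. (\<integral>\<^sup>+w. ennreal (f v w) \<partial>m) \<partial>m) = (\<integral>\<^sup>+v. ennreal (\<integral>w. f v w \<partial>m) \<partial>m)"
    using i b by (intro nn_integral_cong nn_integral_eq_integral AE_I2) auto
  also have "\<dots> = ennreal (\<integral>v. (\<integral>w. f v w \<partial>m) \<partial>m)"
  proof (rule nn_integral_eq_integral)
    show "integrable m (\<lambda>v. \<integral>w. f v w \<partial>m)"
      by (rule m.integrable_const_bound[where B=B]) (use le ge in \<open>auto intro!: AE_I2\<close>)
  qed (use ge in \<open>auto intro!: AE_I2\<close>)
  finally show ?thesis .
qed

end

section \<open>The mass of the set of small overlaps\<close>

text \<open>Hermite interpolation: the difference of the two sides is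
  \<open>(z - 1)\<^sup>2 * (1 - t * z)\<^sup>2 / z\<close>, so the cubic touches
  \<open>1 / z\<close> at 1, the mean of the normalisation, and at the free node
  \<open>1 / t\<close>, which is placed later so that the cubic term does not spoil the
  gain.\<close>

lemma inverse_ge_cubic:
  fixes z t :: real
  assumes "0 < z"
  shows "(2 + 2 * t) - (1 + 4 * t + t\<^sup>2) * z + (2 * t + 2 * t\<^sup>2) * z\<^sup>2 - t\<^sup>2 * z ^ 3 \<le> 1 / z"
proof -
  have "1 / z - ((2 + 2 * t) - (1 + 4 * t + t\<^sup>2) * z + (2 * t + 2 * t\<^sup>2) * z\<^sup>2 - t\<^sup>2 * z ^ 3) =
    (z - 1)\<^sup>2 * (1 - t * z)\<^sup>2 / z"
    using assms by (simp add: field_simps power2_eq_square power3_eq_cube)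
  moreover have "0 \<le> (z - 1)\<^sup>2 * (1 - t * z)\<^sup>2 / z"
    using assms by simp
  ultimately show ?thesis by linarith
qed

text \<open>The numbers \<open>p1\<close>, \<open>p2\<close>, \<open>p3\<close> stand for the
  factors by which moments of \<open>Z\<close> change when weighted by a vector of \<open>N\<close>.
  If all are 1, the right-hand side equals
  \<open>1 + 2 * t * (e2 - 1) - t\<^sup>2 * (e3 - 2 * e2 + 1)\<close>, and the condition on
  \<open>t\<close> lets the last term consume at most half of the gain. The 6, 4 and 1 in the error
  are the coefficients of the cubic at \<open>t = 1\<close>.\<close>

lemma cubic_moment_bound:
  fixes t d E F e2 e3 p1 p2 p3 :: real
  assumes "0 < t" "t \<le> 1" "0 \<le> d" "p1 \<le> 1 + d" "1 - d \<le> p2" "p3 \<le> 1 + d" "1 \<le> e2" "0 \<le> e3"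
    and v: "t * (e3 - 2 * e2 + 1) \<le> e2 - 1"
  shows "1 + t * (e2 - 1) - d * (6 + 4 * e2 + e3) \<le>
    (2 + 2 * t) - (1 + 4 * t + t\<^sup>2) * p1 + (2 * t + 2 * t\<^sup>2) * (p2 * e2) - t\<^sup>2 * (p3 * e3)"
proof -
  have t2: "t\<^sup>2 \<le> 1" "t\<^sup>2 = t * t" "0 \<le> t\<^sup>2"
    using assms by (simp_all add: power_le_one) (simp add: power2_eq_square)
  have "(1 + 4 * t + t\<^sup>2) * p1 \<le> (1 + 4 * t + t\<^sup>2) * (1 + d)"
    using assms by (intro mult_left_mono) auto
  moreover have "(2 * t + 2 * t\<^sup>2) * ((1 - d) * e2) \<le> (2 * t + 2 * t\<^sup>2) * (p2 * e2)"
    using assms by (intro mult_left_mono mult_right_mono) auto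
  moreover have "t\<^sup>2 * (p3 * e3) \<le> t\<^sup>2 * ((1 + d) * e3)"
    using assms by (intro mult_left_mono mult_right_mono) auto
  moreover have "t * (t * (e3 - 2 * e2 + 1)) \<le> t * (e2 - 1)"
    using assms by (intro mult_left_mono) auto
  moreover have "d * ((1 + 4 * t + t\<^sup>2) + (2 * t + 2 * t\<^sup>2) * e2 + t\<^sup>2 * e3) \<le> d * (6 + 4 * e2 + 1 * e3)"
    using assms t2 by (intro mult_left_mono add_mono mult_right_mono) auto
  ultimately show ?thesis unfolding t2(2) by (simp add: algebra_simps)
qed

context cavity_measure
begin

abbreviation z :: "'l \<Rightarrow> real" where "z x \<equiv> enn2real (Z x)"

lemma integral_integral_K: "(\<integral>v. (\<integral>w. K v w \<partial>m) \<partial>m) = e2"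
proof -
  have "ennreal e2 = ennreal (\<integral>v. (\<integral>w. K v w \<partial>m) \<partial>m)"
    unfolding e2(1)[symmetric] nn_integral_Z2
    by (rule nn_integral_eq_integral2[where B="exp (lam\<^sup>2)"]) (auto intro: K_le)
  then show ?thesis
    using e2(2) by (simp add: ennreal_inj Bochner_Integration.integral_nonneg)
qed

lemma integral_z: "integrable L z" "(\<integral>x. z x \<partial>L) = 1"
  using integral_enn2real[of Z L 1] nn_integral_Z by auto

lemma integral_z2: "integrable L (\<lambda>x. z x * z x)" "(\<integral>x. z x * z x \<partial>L) = e2"
  using integral_enn2real[of "\<lambda>x. Z x * Z x" L e2] e2 by (auto simp: enn2real_mult)

text \<open>The number \<open>e2 - 1\<close> is the variance of the normalisation, which has mean
  1.\<close>

lemma e2_ge_1: "1 \<le> e2"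
proof -
  have "0 \<le> (\<integral>x. (z x - 1)\<^sup>2 \<partial>L)" by simp
  also have "\<dots> = (\<integral>x. z x * z x - 2 * z x + 1 \<partial>L)"
    by (simp add: power2_eq_square algebra_simps)
  also have "\<dots> = e2 - 2 * 1 + 1"
    using integral_z integral_z2 by (simp add: L.prob_space)
  finally show ?thesis by simp
qed

lemma integrable2:
  fixes f :: "'h \<Rightarrow> 'h \<Rightarrow> real"
  assumes [measurable]: "(\<lambda>(v, w). f v w) \<in> borel_measurable (ball_borel \<Otimes>\<^sub>M ball_borel)"
    and b: "\<And>v w. v \<in> space m \<Longrightarrow> w \<in> space m \<Longrightarrow> \<bar>f v w\<bar> \<le> B"
  shows "v \<in> space m \<Longrightarrow> integrable m (f v)" and "integrable m (\<lambda>v. \<integral>w. f v w \<partial>m)"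
    and "v \<in> space m \<Longrightarrow> \<bar>\<integral>w. f v w \<partial>m\<bar> \<le> B"
proof -
  show i: "integrable m (f v)" if "v \<in> space m" for v
    using that b by (intro m.integrable_const_bound[where B=B]) (auto intro!: AE_I2)
  show le: "\<bar>\<integral>w. f v w \<partial>m\<bar> \<le> B" if "v \<in> space m" for v
  proof -
    have "\<bar>\<integral>w. f v w \<partial>m\<bar> \<le> (\<integral>w. \<bar>f v w\<bar> \<partial>m)" by (rule integral_abs_bound)
    also have "\<dots> \<le> (\<integral>w. B \<partial>m)" using that b i by (intro integral_mono) auto
    finally show ?thesis by (simp add: m.prob_space[simplified])
  qed
  show "integrable m (\<lambda>v. \<integral>w. f v w \<partial>m)"
    by (rule m.integrable_const_bound[where B=B]) (use le in \<open>auto intro!: AE_I2\<close>)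
qed

lemma integral2_mono:
  fixes f g :: "'h \<Rightarrow> 'h \<Rightarrow> real"
  assumes "(\<lambda>(v, w). f v w) \<in> borel_measurable (ball_borel \<Otimes>\<^sub>M ball_borel)"
    and "\<And>v w. v \<in> space m \<Longrightarrow> w \<in> space m \<Longrightarrow> \<bar>f v w\<bar> \<le> B"
    and "(\<lambda>(v, w). g v w) \<in> borel_measurable (ball_borel \<Otimes>\<^sub>M ball_borel)"
    and "\<And>v w. v \<in> space m \<Longrightarrow> w \<in> space m \<Longrightarrow> \<bar>g v w\<bar> \<le> C"
    and "\<And>v w. v \<in> space m \<Longrightarrow> w \<in> space m \<Longrightarrow> f v w \<le> g v w"
  shows "(\<integral>v. (\<integral>w. f v w \<partial>m) \<partial>m) \<le> (\<integral>v. (\<integral>w. g v w \<partial>m) \<partial>m)"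
  using assms by (intro integral_mono integrable2[where f=f and B=B] integrable2[where f=g and B=C])

lemma integral2_add:
  fixes f g :: "'h \<Rightarrow> 'h \<Rightarrow> real"
  assumes "(\<lambda>(v, w). f v w) \<in> borel_measurable (ball_borel \<Otimes>\<^sub>M ball_borel)"
    and "\<And>v w. v \<in> space m \<Longrightarrow> w \<in> space m \<Longrightarrow> \<bar>f v w\<bar> \<le> B"
    and "(\<lambda>(v, w). g v w) \<in> borel_measurable (ball_borel \<Otimes>\<^sub>M ball_borel)"
    and "\<And>v w. v \<in> space m \<Longrightarrow> w \<in> space m \<Longrightarrow> \<bar>g v w\<bar> \<le> C"
  shows "(\<integral>v. (\<integral>w. f v w + g v w \<partial>m) \<partial>m) = (\<integral>v. (\<integral>w. f v w \<partial>m) \<partial>m) + (\<integral>v. (\<integral>w. g v w \<partial>m) \<partial>m)"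
proof -
  note f = integrable2[where f=f and B=B, OF assms(1,2)] and g = integrable2[where f=g and B=C, OF assms(3,4)]
  have "(\<integral>v. (\<integral>w. f v w + g v w \<partial>m) \<partial>m) = (\<integral>v. (\<integral>w. f v w \<partial>m) + (\<integral>w. g v w \<partial>m) \<partial>m)"
    using f(1) g(1) by (intro Bochner_Integration.integral_cong refl Bochner_Integration.integral_add) auto
  also have "\<dots> = (\<integral>v. (\<integral>w. f v w \<partial>m) \<partial>m) + (\<integral>v. (\<integral>w. g v w \<partial>m) \<partial>m)"
    using f(2) g(2) by (intro Bochner_Integration.integral_add) auto
  finally show ?thesis .
qed

lemma abs_power_inner_le: "v \<in> cball 0 1 \<Longrightarrow> w \<in> cball 0 1 \<Longrightarrow> \<bar>(v \<bullet> w) ^ k\<bar> \<le> 1"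
  using power_le_one[of "\<bar>v \<bullet> w\<bar>" k] abs_inner_ball_le[of v w] by (simp add: power_abs)

lemma abs_exponent_le:
  assumes "v \<in> cball 0 1" "w \<in> cball 0 1"
  shows "\<bar>s\<^sup>2 * (v \<bullet> w) ^ k\<bar> \<le> s\<^sup>2"
  using abs_power_inner_le[OF assms, of k] by (simp add: abs_mult mult_left_le)

text \<open>For every \<open>s > 0\<close> the normalisation at coupling \<open>sqrt s\<close> has mean 1, so its second moment
  \<open>\<integral>\<integral> exp (s (v \<bullet> w) ^ p)\<close> is at least 1; the claim is the first order of this as \<open>s\<close> tends to 0.\<close>

lemma overlap_moment_nonneg: "0 \<le> overlap_moment p m"
proof -
  have "- (2 * s) \<le> overlap_moment p m" if s: "0 < s" "s \<le> 1" for s :: real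
  proof -
    interpret s: cavity_measure p L l "sqrt s" m
      by unfold_locales (rule m_in)
    have sq: "(sqrt s)\<^sup>2 = s" using s by simp
    have "1 \<le> (\<integral>v. (\<integral>w. s.K v w \<partial>m) \<partial>m)"
      using s.e2_ge_1 s.integral_integral_K by simp
    also have "\<dots> \<le> (\<integral>v. (\<integral>w. (1 + exp 1 * s\<^sup>2 / 2) + s * (v \<bullet> w) ^ p \<partial>m) \<partial>m)"
    proof (rule integral2_mono)
      fix v w assume vw: "v \<in> space m" "w \<in> space m"
      then have x: "\<bar>s * (v \<bullet> w) ^ p\<bar> \<le> s"
        using abs_exponent_le[of v w "sqrt s" p] sq by simp
      have "s.K v w \<le> 1 + s * (v \<bullet> w) ^ p + exp s * (s * (v \<bullet> w) ^ p)\<^sup>2 / 2"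
        using exp_minus_one_bounds(3)[OF x] by (simp add: s.K_def sq)
      also have "\<dots> \<le> 1 + s * (v \<bullet> w) ^ p + exp 1 * s\<^sup>2 / 2"
      proof -
        have "(s * (v \<bullet> w) ^ p)\<^sup>2 \<le> s\<^sup>2" using x s by (simp add: abs_le_square_iff[symmetric])
        then have "exp s * (s * (v \<bullet> w) ^ p)\<^sup>2 \<le> exp 1 * s\<^sup>2" using s by (intro mult_mono) auto
        then show ?thesis by simp
      qed
      finally show "s.K v w \<le> (1 + exp 1 * s\<^sup>2 / 2) + s * (v \<bullet> w) ^ p" by simp
      show "\<bar>s.K v w\<bar> \<le> exp s" using s.K_le[of v w] vw sq by simp
      have "\<bar>(1 + exp 1 * s\<^sup>2 / 2) + s * (v \<bullet> w) ^ p\<bar> \<le> \<bar>1 + exp 1 * s\<^sup>2 / 2\<bar> + \<bar>s * (v \<bullet> w) ^ p\<bar>"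
        by (rule abs_triangle_ineq)
      also have "\<dots> \<le> \<bar>1 + exp 1 * s\<^sup>2 / 2\<bar> + s" using x by simp
      finally show "\<bar>(1 + exp 1 * s\<^sup>2 / 2) + s * (v \<bullet> w) ^ p\<bar> \<le> \<bar>1 + exp 1 * s\<^sup>2 / 2\<bar> + s" .
    qed measurable
    also have "\<dots> = (\<integral>v. (\<integral>w. (1 + exp 1 * s\<^sup>2 / 2) \<partial>m) \<partial>m) + (\<integral>v. (\<integral>w. s * (v \<bullet> w) ^ p \<partial>m) \<partial>m)"
      using s by (intro integral2_add[where B="\<bar>1 + exp 1 * s\<^sup>2 / 2\<bar>" and C=1])
        (auto simp: abs_mult intro!: mult_le_one abs_power_inner_le)
    also have "\<dots> = 1 + exp 1 * s\<^sup>2 / 2 + s * overlap_moment p m"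
      by (simp add: overlap_moment_def m.prob_space[simplified])
    finally have "0 \<le> s * (exp 1 * s / 2 + overlap_moment p m)"
      by (simp add: power2_eq_square algebra_simps)
    then have "- (exp 1 * s / 2) \<le> overlap_moment p m"
      using s by (simp add: zero_le_mult_iff)
    moreover have "exp 1 * s / 2 \<le> 3 * s / 2"
      using s exp_le by simp
    ultimately show ?thesis using s by linarith
  qed
  note * = this
  show ?thesis
  proof (rule ccontr)
    assume neg: "\<not> 0 \<le> overlap_moment p m"
    \<comment> \<open>With \<open>R\<close> the negative moment, \<open>s = min 1 (- R / 4)\<close>
      is admissible and gives \<open>- 2 * s \<ge> R / 2 > R\<close>, contrary to the bound just
      shown.\<close>
    then have "- (2 * min 1 (- overlap_moment p m / 4)) \<le> overlap_moment p m"
      by (intro *) auto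
    with neg show False by (auto simp: min_def split: if_splits)
  qed
qed

text \<open>This is \<open>1 + x \<le> exp x\<close>, integrated over two replicas: it makes the
  overlap moment visible in the variance of the normalisation.\<close>

lemma e2_minus_1_ge: "lam\<^sup>2 * overlap_moment p m \<le> e2 - 1"
proof -
  have "(\<integral>v. (\<integral>w. 1 + lam\<^sup>2 * (v \<bullet> w) ^ p \<partial>m) \<partial>m) \<le> (\<integral>v. (\<integral>w. K v w \<partial>m) \<partial>m)"
  proof (rule integral2_mono)
    fix v w assume vw: "v \<in> space m" "w \<in> space m"
    show "\<bar>1 + lam\<^sup>2 * (v \<bullet> w) ^ p\<bar> \<le> 1 + lam\<^sup>2"
      using abs_exponent_le[of v w lam p] vw by (simp add: abs_le_iff)
    show "\<bar>K v w\<bar> \<le> exp (lam\<^sup>2)" using K_le[of v w] vw by simp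
    show "1 + lam\<^sup>2 * (v \<bullet> w) ^ p \<le> K v w" by (simp add: K_def)
  qed measurable
  also have "(\<integral>v. (\<integral>w. 1 + lam\<^sup>2 * (v \<bullet> w) ^ p \<partial>m) \<partial>m) =
      (\<integral>v. (\<integral>w. 1 \<partial>m) \<partial>m) + (\<integral>v. (\<integral>w. lam\<^sup>2 * (v \<bullet> w) ^ p \<partial>m) \<partial>m)"
    by (rule integral2_add[where B=1 and C="lam\<^sup>2"]) (simp_all add: abs_exponent_le[simplified])
  also have "\<dots> = 1 + lam\<^sup>2 * overlap_moment p m"
    by (simp add: overlap_moment_def m.prob_space[simplified])
  finally show ?thesis by (simp add: integral_integral_K)
qed

section \<open>The third moment of the normalisation against its variance\<close>

definition y2 :: real where "y2 = (\<integral>v. (\<integral>w. (K v w - 1)\<^sup>2 \<partial>m) \<partial>m)"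

lemma abs_K_minus_1_le:
  assumes "v \<in> space m" "w \<in> space m"
  shows "\<bar>K v w - 1\<bar> \<le> lam\<^sup>2 * exp (lam\<^sup>2)"
proof -
  have x: "\<bar>lam\<^sup>2 * (v \<bullet> w) ^ p\<bar> \<le> lam\<^sup>2" using assms by (intro abs_exponent_le) auto
  have "\<bar>K v w - 1\<bar> \<le> \<bar>lam\<^sup>2 * (v \<bullet> w) ^ p\<bar> * exp (lam\<^sup>2)"
    using exp_minus_one_bounds(1)[OF x] by (simp add: K_def)
  also have "\<dots> \<le> lam\<^sup>2 * exp (lam\<^sup>2)" using x by (intro mult_right_mono) auto
  finally show ?thesis .
qed

lemma K_minus_1_square_le:
  assumes "v \<in> space m" "w \<in> space m"
  shows "(K v w - 1)\<^sup>2 \<le> (lam\<^sup>2 * exp (lam\<^sup>2))\<^sup>2"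
  using power_mono[OF abs_K_minus_1_le[OF assms], of 2] by simp

lemma y2_le: "y2 \<le> 2 * exp (3 * lam\<^sup>2) * (e2 - 1)"
proof -
  let ?c = "2 * exp (3 * lam\<^sup>2)"
  have "y2 \<le> (\<integral>v. (\<integral>w. (?c * K v w + ?c * (- 1 - lam\<^sup>2 * (v \<bullet> w) ^ p)) \<partial>m) \<partial>m)"
    unfolding y2_def
  proof (rule integral2_mono)
    fix v w assume vw: "v \<in> space m" "w \<in> space m"
    then have x: "\<bar>lam\<^sup>2 * (v \<bullet> w) ^ p\<bar> \<le> lam\<^sup>2" by (intro abs_exponent_le) auto
    show "\<bar>(K v w - 1)\<^sup>2\<bar> \<le> (lam\<^sup>2 * exp (lam\<^sup>2))\<^sup>2" using K_minus_1_square_le[OF vw] by simp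
    have "?c * K v w + ?c * (- 1 - lam\<^sup>2 * (v \<bullet> w) ^ p) = ?c * (K v w - 1 - lam\<^sup>2 * (v \<bullet> w) ^ p)"
      by (simp add: algebra_simps)
    then show "(K v w - 1)\<^sup>2 \<le> ?c * K v w + ?c * (- 1 - lam\<^sup>2 * (v \<bullet> w) ^ p)"
      using exp_minus_one_square_le[OF x] by (simp add: K_def)
    have "\<bar>?c * K v w + ?c * (- 1 - lam\<^sup>2 * (v \<bullet> w) ^ p)\<bar> \<le> \<bar>?c * K v w\<bar> + \<bar>?c * (- 1 - lam\<^sup>2 * (v \<bullet> w) ^ p)\<bar>"
      by (rule abs_triangle_ineq)
    also have "\<dots> \<le> ?c * exp (lam\<^sup>2) + ?c * (1 + lam\<^sup>2)"
    proof -
      have "\<bar>- 1 - lam\<^sup>2 * (v \<bullet> w) ^ p\<bar> \<le> 1 + lam\<^sup>2" using x by linarith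
      then show ?thesis
        using K_le[of v w] vw unfolding abs_mult[of ?c] by (intro add_mono mult_mono) auto
    qed
    finally show "\<bar>?c * K v w + ?c * (- 1 - lam\<^sup>2 * (v \<bullet> w) ^ p)\<bar> \<le> ?c * exp (lam\<^sup>2) + ?c * (1 + lam\<^sup>2)" .
  qed measurable
  also have "\<dots> = (\<integral>v. (\<integral>w. ?c * K v w \<partial>m) \<partial>m) + (\<integral>v. (\<integral>w. ?c * (- 1 - lam\<^sup>2 * (v \<bullet> w) ^ p) \<partial>m) \<partial>m)"
  proof (rule integral2_add)
    fix v w assume vw: "v \<in> space m" "w \<in> space m"
    then have x: "\<bar>lam\<^sup>2 * (v \<bullet> w) ^ p\<bar> \<le> lam\<^sup>2" by (intro abs_exponent_le) auto
    show "\<bar>?c * K v w\<bar> \<le> ?c * exp (lam\<^sup>2)" using K_le[of v w] vw by (simp add: abs_mult)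
    show "\<bar>?c * (- 1 - lam\<^sup>2 * (v \<bullet> w) ^ p)\<bar> \<le> ?c * (1 + lam\<^sup>2)"
    proof -
      have "\<bar>- 1 - lam\<^sup>2 * (v \<bullet> w) ^ p\<bar> \<le> 1 + lam\<^sup>2" using x by linarith
      then show ?thesis unfolding abs_mult[of ?c] by (intro mult_mono) auto
    qed
  qed measurable
  also have "(\<integral>v. (\<integral>w. ?c * (- 1 - lam\<^sup>2 * (v \<bullet> w) ^ p) \<partial>m) \<partial>m) =
      (\<integral>v. (\<integral>w. - ?c + (- ?c * lam\<^sup>2) * (v \<bullet> w) ^ p \<partial>m) \<partial>m)"
    by (intro Bochner_Integration.integral_cong refl) (simp add: algebra_simps)
  also have "\<dots> = (\<integral>v. (\<integral>w. - ?c \<partial>m) \<partial>m) + (\<integral>v. (\<integral>w. (- ?c * lam\<^sup>2) * (v \<bullet> w) ^ p \<partial>m) \<partial>m)"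
  proof (rule integral2_add[where B = ?c])
    fix v w assume vw: "v \<in> space m" "w \<in> space m"
    show "\<bar>(- ?c * lam\<^sup>2) * (v \<bullet> w) ^ p\<bar> \<le> \<bar>- ?c * lam\<^sup>2\<bar> * 1"
      unfolding abs_mult[of "- ?c * lam\<^sup>2"] using vw by (intro mult_left_mono abs_power_inner_le) auto
    show "\<bar>- ?c\<bar> \<le> ?c" by simp
  qed measurable
  also have "\<dots> = - ?c - ?c * lam\<^sup>2 * overlap_moment p m"
    by (simp add: overlap_moment_def m.prob_space[simplified])
  finally have "y2 \<le> ?c * e2 - ?c - ?c * lam\<^sup>2 * overlap_moment p m"
    by (simp add: integral_integral_K)
  also have "\<dots> \<le> ?c * (e2 - 1)"
    using overlap_moment_nonneg by (simp add: algebra_simps)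
  finally show ?thesis .
qed

text \<open>The 6 is the number of pairs among three replicas times the factor 2 of
  \<open>y2_le\<close>. Only \<open>lam\<close> enters, so the value is the same for every exponent
  and every measure.\<close>

definition C1 :: real where
  "C1 = 1 + 6 * (1 + lam\<^sup>2 * exp (lam\<^sup>2)) * exp (3 * lam\<^sup>2)"

text \<open>The left-hand side is the mean of \<open>z x * (z x - 1)\<^sup>2\<close>, so the third
  moment is controlled by the variance. By \<open>triple_product_le\<close> the kernel product over
  three replicas is bounded by a sum over the three pairs, and each pair integrates to
  \<open>e2\<close> plus a multiple of \<open>y2\<close>.\<close>

lemma e3_le: "e3 - 2 * e2 + 1 \<le> C1 * (e2 - 1)"
proof -
  let ?Y = "lam\<^sup>2 * exp (lam\<^sup>2)"
  define g where "g v w = K v w + (1 + ?Y) * (K v w - 1)\<^sup>2" for v w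
  have g0: "0 \<le> g v w" for v w by (simp add: g_def)
  have [measurable]: "(\<lambda>(v, w). g v w) \<in> borel_measurable (ball_borel \<Otimes>\<^sub>M ball_borel)"
    unfolding g_def by measurable
  have gK: "K a b * K a c * K b c + 2 \<le> g a b + g a c + g b c"
    if "a \<in> space m" "b \<in> space m" "c \<in> space m" for a b c
    using triple_product_le[OF abs_K_minus_1_le[OF that(1,2)], of "K a c" "K b c"]
    by (simp add: g_def algebra_simps)
  have G: "(\<integral>\<^sup>+v. (\<integral>\<^sup>+w. ennreal (g v w) \<partial>m) \<partial>m) = ennreal (e2 + (1 + ?Y) * y2)"
  proof -
    have "(\<integral>\<^sup>+v. (\<integral>\<^sup>+w. ennreal (g v w) \<partial>m) \<partial>m) = ennreal (\<integral>v. (\<integral>w. g v w \<partial>m) \<partial>m)"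
    proof (rule nn_integral_eq_integral2)
      fix v w assume "v \<in> space m" "w \<in> space m"
      then have "g v w \<le> exp (lam\<^sup>2) + (1 + ?Y) * ?Y\<^sup>2"
        unfolding g_def by (intro add_mono K_le mult_left_mono K_minus_1_square_le) auto
      then show "0 \<le> g v w \<and> g v w \<le> exp (lam\<^sup>2) + (1 + ?Y) * ?Y\<^sup>2" using g0 by simp
    qed measurable
    also have "(\<integral>v. (\<integral>w. g v w \<partial>m) \<partial>m) = (\<integral>v. (\<integral>w. K v w \<partial>m) \<partial>m) + (\<integral>v. (\<integral>w. (1 + ?Y) * (K v w - 1)\<^sup>2 \<partial>m) \<partial>m)"
      unfolding g_def
    proof (rule integral2_add)
      fix v w assume vw: "v \<in> space m" "w \<in> space m"
      show "\<bar>K v w\<bar> \<le> exp (lam\<^sup>2)" using K_le[of v w] vw by simp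
      show "\<bar>(1 + ?Y) * (K v w - 1)\<^sup>2\<bar> \<le> (1 + ?Y) * ?Y\<^sup>2"
        unfolding abs_mult using K_minus_1_square_le[OF vw] by (intro mult_mono) auto
    qed measurable
    finally show ?thesis by (simp add: integral_integral_K y2_def)
  qed
  have y0: "0 \<le> y2" by (simp add: y2_def)
  have one: "emeasure m (cball 0 1) = 1" using m.emeasure_space_1 by simp
  \<comment> \<open>The 2 of \<open>triple_product_le\<close> is kept on the left, so that all
    integrands are nonnegative and the comparison takes place in \<open>ennreal\<close>.\<close>
  have "ennreal e3 + 2 = (\<integral>\<^sup>+a. (\<integral>\<^sup>+b. (\<integral>\<^sup>+c. ennreal (K a b * K a c * K b c) + 2 \<partial>m) \<partial>m) \<partial>m)"
    unfolding e3(1)[symmetric] nn_integral_Z3 by (simp add: nn_integral_add one cong: nn_integral_cong_simp)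
  also have "\<dots> \<le> (\<integral>\<^sup>+a. (\<integral>\<^sup>+b. (\<integral>\<^sup>+c. ennreal (g a b) + ennreal (g a c) + ennreal (g b c) \<partial>m) \<partial>m) \<partial>m)"
  proof (intro nn_integral_mono)
    fix a b c assume "a \<in> space m" "b \<in> space m" "c \<in> space m"
    then have "ennreal (K a b * K a c * K b c + 2) \<le> ennreal (g a b + g a c + g b c)"
      by (intro ennreal_leI gK)
    then show "ennreal (K a b * K a c * K b c) + 2 \<le> ennreal (g a b) + ennreal (g a c) + ennreal (g b c)"
      using g0 by (simp add: ennreal_plus)
  qed
  also have "\<dots> = ennreal (e2 + (1 + ?Y) * y2) + ennreal (e2 + (1 + ?Y) * y2) + ennreal (e2 + (1 + ?Y) * y2)"
    by (simp add: nn_integral_add one G cong: nn_integral_cong_simp)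
  also have "\<dots> = ennreal (3 * (e2 + (1 + ?Y) * y2))"
  proof -
    have "ennreal q + ennreal q + ennreal q = ennreal (3 * q)" if "0 \<le> q" for q
      using that by (simp flip: ennreal_plus)
    note q = this
    show ?thesis using e2(2) y0 by (intro q) simp
  qed
  finally have "ennreal (e3 + 2) \<le> ennreal (3 * (e2 + (1 + ?Y) * y2))"
    using e3(2) by (simp add: ennreal_plus)
  then have "e3 + 2 \<le> 3 * (e2 + (1 + ?Y) * y2)"
    using e2(2) y0 by (subst (asm) ennreal_le_iff) auto
  moreover have "(1 + ?Y) * y2 \<le> (1 + ?Y) * (2 * exp (3 * lam\<^sup>2) * (e2 - 1))"
    by (intro mult_left_mono y2_le) auto
  ultimately show ?thesis by (simp add: C1_def algebra_simps)
qed

lemma measure_tilt: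
  assumes "x \<in> space L" "Z x \<noteq> \<infinity>" "A \<in> sets ball_borel"
  shows "measure (tilt x) A = enn2real (W A x) / z x"
proof -
  have "W A x \<noteq> \<infinity>" using W_le_Z[of A x] assms by (auto simp: top_unique)
  then show ?thesis
    using assms Z_pos[of x] emeasure_tilt[of x A]
    by (cases "W A x"; cases "Z x") (auto simp: measure_def divide_ennreal)
qed

lemma z_pos: "x \<in> space L \<Longrightarrow> Z x \<noteq> \<infinity> \<Longrightarrow> 0 < z x"
  using Z_pos[of x] by (simp add: enn2real_positive_iff less_top[symmetric])

lemma measurable_measure_tilt [measurable]:
  assumes "A \<in> sets ball_borel"
  shows "(\<lambda>x. measure (tilt x) A) \<in> borel_measurable L"
  by (rule measurable_compose[OF measurable_prob_algebraD[OF measurable_tilt] measurable_measure_subprob_algebra[OF assms]])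

section \<open>The mean mass of the small overlap set after tilting\<close>

context
  fixes a :: real
  assumes a: "0 \<le> a" "a \<le> 1"
begin

abbreviation N :: "'h set" where "N \<equiv> small_overlap_set a m"

text \<open>Bounds the exponent of \<open>K v w\<close> in absolute value for \<open>v\<close> in
  \<open>N\<close> and almost every \<open>w\<close>.\<close>

definition eps :: real where "eps = lam\<^sup>2 * a ^ p"

lemma sets_N [measurable]: "N \<in> sets ball_borel"
  using sets_small_overlap_set[OF m_in] sets_m by simp

lemma N_subset: "N \<subseteq> space m"
  by (auto simp: small_overlap_set_def)

lemma AE_K_bounds:
  assumes "v \<in> N"
  shows "AE w in m. exp (- eps) \<le> K v w \<and> K v w \<le> exp eps"
proof -
  have "AE w in m. \<bar>v \<bullet> w\<bar> \<le> a" using assms by (simp add: small_overlap_set_def)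
  then show ?thesis
  proof eventually_elim
    case (elim w)
    then have "\<bar>(v \<bullet> w) ^ p\<bar> \<le> a ^ p" by (simp add: power_abs power_mono)
    then have "\<bar>lam\<^sup>2 * (v \<bullet> w) ^ p\<bar> \<le> eps" unfolding eps_def abs_mult by (simp add: mult_left_mono)
    then show ?case by (auto simp: K_def abs_le_iff)
  qed
qed

text \<open>For \<open>v\<close> in \<open>N\<close> each kernel that involves \<open>v\<close> lies
  between \<open>exp (- eps)\<close> and \<open>exp eps\<close> and can be stripped; what remains is
  a moment of \<open>Z\<close> alone. The directions of the three bounds are those demanded by the
  signs in the cubic.\<close>

lemma nn_integral_wt_Z_N:
  assumes v: "v \<in> N"
  shows "(\<integral>\<^sup>+x. ennreal (wt v x) * Z x \<partial>L) \<le> ennreal (exp eps)"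
    and "ennreal (exp (- 2 * eps) * e2) \<le> (\<integral>\<^sup>+x. ennreal (wt v x) * (Z x * Z x) \<partial>L)"
    and "(\<integral>\<^sup>+x. ennreal (wt v x) * (Z x * (Z x * Z x)) \<partial>L) \<le> ennreal (exp (3 * eps) * e3)"
proof -
  have vm: "v \<in> space m" using v N_subset by auto
  note K = AE_K_bounds[OF v]
  have one: "emeasure m (cball 0 1) = 1" using m.emeasure_space_1 by simp
  have "(\<integral>\<^sup>+b. ennreal (K v b) \<partial>m) \<le> (\<integral>\<^sup>+b. ennreal (exp eps) \<partial>m)"
    by (rule nn_integral_mono_AE) (use K in eventually_elim, simp add: ennreal_leI)
  then show "(\<integral>\<^sup>+x. ennreal (wt v x) * Z x \<partial>L) \<le> ennreal (exp eps)"
    by (simp add: nn_integral_wt_Z[OF vm] one)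
  have "ennreal (exp (- 2 * eps) * e2) = ennreal (exp (- 2 * eps)) * (\<integral>\<^sup>+b. (\<integral>\<^sup>+c. ennreal (K b c) \<partial>m) \<partial>m)"
    using e2 by (simp add: nn_integral_Z2[symmetric] ennreal_mult)
  also have "\<dots> = (\<integral>\<^sup>+b. (\<integral>\<^sup>+c. ennreal (exp (- 2 * eps)) * ennreal (K b c) \<partial>m) \<partial>m)"
    by (simp add: nn_integral_cmult cong: nn_integral_cong_simp)
  also have "\<dots> \<le> (\<integral>\<^sup>+b. (\<integral>\<^sup>+c. ennreal (K v b * K v c * K b c) \<partial>m) \<partial>m)"
  proof (rule nn_integral_mono_AE)
    show "AE b in m. (\<integral>\<^sup>+c. ennreal (exp (- 2 * eps)) * ennreal (K b c) \<partial>m) \<le> (\<integral>\<^sup>+c. ennreal (K v b * K v c * K b c) \<partial>m)"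
      using K
    proof eventually_elim
      case (elim b)
      show ?case
      proof (rule nn_integral_mono_AE)
        show "AE c in m. ennreal (exp (- 2 * eps)) * ennreal (K b c) \<le> ennreal (K v b * K v c * K b c)"
          using K
        proof eventually_elim
          case (elim c)
          have "exp (- eps) * exp (- eps) * K b c \<le> K v b * K v c * K b c"
            using elim \<open>exp (- eps) \<le> K v b \<and> K v b \<le> exp eps\<close> by (intro mult_mono) auto
          then show ?case by (simp add: ennreal_mult'[symmetric] exp_add[symmetric] ennreal_leI)
        qed
      qed
    qed
  qed
  finally show "ennreal (exp (- 2 * eps) * e2) \<le> (\<integral>\<^sup>+x. ennreal (wt v x) * (Z x * Z x) \<partial>L)"
    by (simp add: nn_integral_wt_Z[OF vm])
  have "(\<integral>\<^sup>+b. (\<integral>\<^sup>+c. (\<integral>\<^sup>+d. ennreal (K v b * K v c * K v d * K b c * K b d * K c d) \<partial>m) \<partial>m) \<partial>m)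
    \<le> (\<integral>\<^sup>+b. (\<integral>\<^sup>+c. (\<integral>\<^sup>+d. ennreal (exp (3 * eps)) * ennreal (K b c * K b d * K c d) \<partial>m) \<partial>m) \<partial>m)"
  proof (rule nn_integral_mono_AE)
    show "AE b in m. (\<integral>\<^sup>+c. (\<integral>\<^sup>+d. ennreal (K v b * K v c * K v d * K b c * K b d * K c d) \<partial>m) \<partial>m) \<le>
       (\<integral>\<^sup>+c. (\<integral>\<^sup>+d. ennreal (exp (3 * eps)) * ennreal (K b c * K b d * K c d) \<partial>m) \<partial>m)"
      using K
    proof eventually_elim
      case b: (elim b)
      show ?case
      proof (rule nn_integral_mono_AE)
        show "AE c in m. (\<integral>\<^sup>+d. ennreal (K v b * K v c * K v d * K b c * K b d * K c d) \<partial>m) \<le>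
            (\<integral>\<^sup>+d. ennreal (exp (3 * eps)) * ennreal (K b c * K b d * K c d) \<partial>m)"
          using K
        proof eventually_elim
          case c: (elim c)
          show ?case
          proof (rule nn_integral_mono_AE)
            show "AE d in m. ennreal (K v b * K v c * K v d * K b c * K b d * K c d) \<le>
              ennreal (exp (3 * eps)) * ennreal (K b c * K b d * K c d)"
              using K
            proof eventually_elim
              case d: (elim d)
              have "K v b * K v c * K v d * (K b c * K b d * K c d) \<le> exp eps * exp eps * exp eps * (K b c * K b d * K c d)"
                using b c d by (intro mult_right_mono mult_mono) auto
              then show ?case by (simp add: ennreal_mult'[symmetric] exp_add[symmetric] ennreal_leI mult.assoc)
            qed
          qed
        qed
      qed
    qed
  qed
  also have "\<dots> = ennreal (exp (3 * eps)) * (\<integral>\<^sup>+b. (\<integral>\<^sup>+c. (\<integral>\<^sup>+d. ennreal (K b c * K b d * K c d) \<partial>m) \<partial>m) \<partial>m)"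
    by (simp add: nn_integral_cmult cong: nn_integral_cong_simp)
  also have "\<dots> = ennreal (exp (3 * eps) * e3)"
    unfolding nn_integral_Z3[symmetric] e3(1) by (simp add: ennreal_mult e3(2))
  finally show "(\<integral>\<^sup>+x. ennreal (wt v x) * (Z x * (Z x * Z x)) \<partial>L) \<le> ennreal (exp (3 * eps) * e3)"
    by (simp add: nn_integral_wt_Z[OF vm])
qed

abbreviation n :: real where "n \<equiv> measure m N"
abbreviation w :: "'l \<Rightarrow> real" where "w x \<equiv> enn2real (W N x)"

lemma emeasure_N: "(\<integral>\<^sup>+v. ennreal c * indicator N v \<partial>m) = ennreal (c * n)"
proof (cases "0 \<le> c")
  case True
  have "N \<in> sets m" using sets_N sets_m by simp
  then show ?thesis using True by (simp add: nn_integral_cmult_indicator m.emeasure_eq_measure ennreal_mult)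
next
  case False
  then show ?thesis by (simp add: ennreal_neg mult_nonpos_nonneg)
qed

lemma integral_w: "integrable L w" "(\<integral>x. w x \<partial>L) = n"
proof -
  have "(\<integral>\<^sup>+x. W N x * 1 \<partial>L) = (\<integral>\<^sup>+v. ennreal 1 * indicator N v \<partial>m)"
    using N_subset by (subst nn_integral_W_mult) (auto simp: nn_integral_wt(1) indicator_def intro!: nn_integral_cong)
  also have "\<dots> = ennreal (1 * n)" by (rule emeasure_N)
  finally have "(\<integral>\<^sup>+x. W N x \<partial>L) = ennreal n" by simp
  then show "integrable L w" "(\<integral>x. w x \<partial>L) = n"
    using integral_enn2real[of "W N" L n] by auto
qed

lemma integral_w_z: "integrable L (\<lambda>x. w x * z x)" "(\<integral>x. w x * z x \<partial>L) \<le> exp eps * n"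
proof -
  have "(\<integral>\<^sup>+x. W N x * Z x \<partial>L) \<le> (\<integral>\<^sup>+v. ennreal (exp eps) * indicator N v \<partial>m)"
    using nn_integral_wt_Z_N(1) by (subst nn_integral_W_mult) (auto simp: indicator_def intro!: nn_integral_mono)
  then have "(\<integral>\<^sup>+x. W N x * Z x \<partial>L) \<le> ennreal (exp eps * n)" by (simp add: emeasure_N)
  then show "integrable L (\<lambda>x. w x * z x)" "(\<integral>x. w x * z x \<partial>L) \<le> exp eps * n"
    using integral_enn2real_le[of "\<lambda>x. W N x * Z x" L "exp eps * n"] by (auto simp: enn2real_mult)
qed

lemma integral_w_z3: "integrable L (\<lambda>x. w x * z x ^ 3)" "(\<integral>x. w x * z x ^ 3 \<partial>L) \<le> exp (3 * eps) * e3 * n"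
proof -
  have "(\<integral>\<^sup>+x. W N x * (Z x * (Z x * Z x)) \<partial>L) \<le> (\<integral>\<^sup>+v. ennreal (exp (3 * eps) * e3) * indicator N v \<partial>m)"
    using nn_integral_wt_Z_N(3) by (subst nn_integral_W_mult) (auto simp: indicator_def intro!: nn_integral_mono)
  then have "(\<integral>\<^sup>+x. W N x * (Z x * (Z x * Z x)) \<partial>L) \<le> ennreal (exp (3 * eps) * e3 * n)" by (simp add: emeasure_N)
  then show "integrable L (\<lambda>x. w x * z x ^ 3)" "(\<integral>x. w x * z x ^ 3 \<partial>L) \<le> exp (3 * eps) * e3 * n"
    using integral_enn2real_le[of "\<lambda>x. W N x * (Z x * (Z x * Z x))" L "exp (3 * eps) * e3 * n"] e3(2)
    by (auto simp: enn2real_mult power3_eq_cube mult.assoc)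
qed

lemma integral_w_z2: "integrable L (\<lambda>x. w x * (z x)\<^sup>2)" "exp (- 2 * eps) * e2 * n \<le> (\<integral>x. w x * (z x)\<^sup>2 \<partial>L)"
proof -
  \<comment> \<open>The bound sought here is a lower one, so finiteness has to come from elsewhere:
    from the third moment of \<open>Z\<close>.\<close>
  have "(\<integral>\<^sup>+x. W N x * (Z x * Z x) \<partial>L) \<le> (\<integral>\<^sup>+x. Z x * (Z x * Z x) \<partial>L)"
    by (intro nn_integral_mono mult_right_mono W_le_Z) auto
  then obtain r where r: "(\<integral>\<^sup>+x. W N x * (Z x * Z x) \<partial>L) = ennreal r" "0 \<le> r"
    by (cases "\<integral>\<^sup>+x. W N x * (Z x * Z x) \<partial>L") (auto simp: e3(1) top_unique)
  have "(\<integral>\<^sup>+v. ennreal (exp (- 2 * eps) * e2) * indicator N v \<partial>m) \<le> (\<integral>\<^sup>+x. W N x * (Z x * Z x) \<partial>L)"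
    using nn_integral_wt_Z_N(2) by (subst nn_integral_W_mult) (auto simp: indicator_def intro!: nn_integral_mono)
  then have "exp (- 2 * eps) * e2 * n \<le> r"
    unfolding r emeasure_N by (simp add: r)
  then show "integrable L (\<lambda>x. w x * (z x)\<^sup>2)" "exp (- 2 * eps) * e2 * n \<le> (\<integral>x. w x * (z x)\<^sup>2 \<partial>L)"
    using integral_enn2real[of "\<lambda>x. W N x * (Z x * Z x)" L r] r by (auto simp: enn2real_mult power2_eq_square)
qed

text \<open>The tilted mass of \<open>N\<close> is almost surely \<open>w x / z x\<close>. With
  \<open>1 / z x\<close> replaced by the cubic, only the means of \<open>w\<close>,
  \<open>w z\<close>, \<open>w z\<^sup>2\<close> and \<open>w z\<^sup>3\<close> are left, and these
  are \<open>n\<close> times moments of \<open>z\<close> up to the error.\<close>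

lemma integral_measure_tilt_ge:
  "n * (1 + (lam\<^sup>2 / C1) * overlap_moment p m - 33 * exp (6 * lam\<^sup>2) * lam\<^sup>2 * a ^ p) \<le> (\<integral>x. measure (tilt x) N \<partial>L)"
proof -
  \<comment> \<open>With this node \<open>e3_le\<close> is exactly the condition on \<open>t\<close>
    in \<open>cubic_moment_bound\<close>.\<close>
  define t where "t = 1 / C1"
  have C1: "1 \<le> C1" by (simp add: C1_def)
  then have t: "0 < t" "t \<le> 1" by (simp_all add: t_def)
  \<comment> \<open>This dominates all three relative errors, \<open>exp eps - 1\<close>,
    \<open>1 - exp (- 2 * eps)\<close> and \<open>exp (3 * eps) - 1\<close>.\<close>
  define d where "d = exp (3 * eps) - 1"
  have eps: "0 \<le> eps" "eps \<le> lam\<^sup>2"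
    using a by (auto simp: eps_def mult_left_le power_le_one)
  have d0: "3 * eps \<le> d" unfolding d_def using exp_ge_add_one_self[of "3 * eps"] by linarith
  have "d \<le> 3 * eps * exp (3 * lam\<^sup>2)"
    using exp_minus_one_bounds(1)[of "3 * eps" "3 * lam\<^sup>2"] eps by (simp add: d_def)
  moreover have "6 + 4 * e2 + e3 \<le> 11 * exp (3 * lam\<^sup>2)"
  proof -
    have "1 \<le> exp (3 * lam\<^sup>2)" "exp (lam\<^sup>2) \<le> exp (3 * lam\<^sup>2)" by simp_all
    then show ?thesis using e2(3) e3(3) by linarith
  qed
  \<comment> \<open>The constant 33 is the 3 of \<open>3 * eps\<close> times
    \<open>6 + 4 + 1\<close>.\<close>
  ultimately have "d * (6 + 4 * e2 + e3) \<le> (3 * eps * exp (3 * lam\<^sup>2)) * (11 * exp (3 * lam\<^sup>2))"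
    using eps d0 e2 e3 by (intro mult_mono) auto
  also have "\<dots> = 33 * exp (6 * lam\<^sup>2) * lam\<^sup>2 * a ^ p"
  proof -
    have "exp (6 * lam\<^sup>2) = exp (3 * lam\<^sup>2) * exp (3 * lam\<^sup>2)" by (simp add: exp_add[symmetric])
    then show ?thesis by (simp add: eps_def)
  qed
  finally have dE: "d * (6 + 4 * e2 + e3) \<le> 33 * exp (6 * lam\<^sup>2) * lam\<^sup>2 * a ^ p" .
  let ?P = "\<lambda>x. (2 + 2 * t) * w x - (1 + 4 * t + t\<^sup>2) * (w x * z x) + (2 * t + 2 * t\<^sup>2) * (w x * (z x)\<^sup>2) - t\<^sup>2 * (w x * z x ^ 3)"
  note ints = integral_w(1) integral_w_z(1) integral_w_z2(1) integral_w_z3(1)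
  have lin: "(\<integral>x. ?P x \<partial>L) = (2 + 2 * t) * n - (1 + 4 * t + t\<^sup>2) * (\<integral>x. w x * z x \<partial>L) +
      (2 * t + 2 * t\<^sup>2) * (\<integral>x. w x * (z x)\<^sup>2 \<partial>L) - t\<^sup>2 * (\<integral>x. w x * z x ^ 3 \<partial>L)"
    using ints by (simp add: integral_w(2))
  have "n * (1 + t * (e2 - 1) - d * (6 + 4 * e2 + e3)) \<le>
    n * ((2 + 2 * t) - (1 + 4 * t + t\<^sup>2) * exp eps + (2 * t + 2 * t\<^sup>2) * (exp (- 2 * eps) * e2) - t\<^sup>2 * (exp (3 * eps) * e3))"
  proof (intro mult_left_mono cubic_moment_bound)
    show "exp eps \<le> 1 + d" using eps by (simp add: d_def)
    have "1 + - 2 * eps \<le> exp (- 2 * eps)" by (rule exp_ge_add_one_self)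
    then show "1 - d \<le> exp (- 2 * eps)" using d0 eps by linarith
    show "t * (e3 - 2 * e2 + 1) \<le> e2 - 1"
      using e3_le C1 by (simp add: t_def divide_le_eq mult.commute)
    show "1 \<le> e2" by (rule e2_ge_1)
  qed (use t d0 eps e3 in \<open>auto simp: d_def\<close>)
  also have "\<dots> = (2 + 2 * t) * n - (1 + 4 * t + t\<^sup>2) * (exp eps * n) +
      (2 * t + 2 * t\<^sup>2) * (exp (- 2 * eps) * e2 * n) - t\<^sup>2 * (exp (3 * eps) * e3 * n)"
    by (simp add: algebra_simps)
  also have "\<dots> \<le> (\<integral>x. ?P x \<partial>L)"
    unfolding lin using t
    by (intro add_mono diff_mono mult_left_mono integral_w_z integral_w_z2 integral_w_z3 order_refl) auto
  also have "\<dots> \<le> (\<integral>x. measure (tilt x) N \<partial>L)"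
  proof (rule integral_mono_AE)
    show "integrable L ?P" using ints by auto
    show "integrable L (\<lambda>x. measure (tilt x) N)"
    proof (rule L.integrable_const_bound[where B=1])
      have "prob_space (tilt x)" if "x \<in> space L" for x
        using tilt_in[OF that] by (simp add: space_prob_algebra)
      then show "AE x in L. norm (measure (tilt x) N) \<le> 1"
        by (auto intro!: AE_I2 prob_space.prob_le_1)
    qed measurable
    show "AE x in L. ?P x \<le> measure (tilt x) N"
      using AE_Z_finite AE_space
    proof eventually_elim
      case (elim x)
      then have z: "0 < z x" by (rule z_pos[rotated])
      have "?P x = w x * ((2 + 2 * t) - (1 + 4 * t + t\<^sup>2) * z x + (2 * t + 2 * t\<^sup>2) * (z x)\<^sup>2 - t\<^sup>2 * z x ^ 3)"
        by (simp add: algebra_simps)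
      also have "\<dots> \<le> w x * (1 / z x)"
        by (intro mult_left_mono inverse_ge_cubic z) auto
      also have "\<dots> = measure (tilt x) N" using elim by (simp add: measure_tilt)
      finally show ?case .
    qed
  qed
  finally have main: "n * (1 + t * (e2 - 1) - d * (6 + 4 * e2 + e3)) \<le> (\<integral>x. measure (tilt x) N \<partial>L)" .
  have "n * (1 + (lam\<^sup>2 / C1) * overlap_moment p m - 33 * exp (6 * lam\<^sup>2) * lam\<^sup>2 * a ^ p) \<le> n * (1 + t * (e2 - 1) - d * (6 + 4 * e2 + e3))"
  proof (intro mult_left_mono diff_mono add_mono order_refl dE)
    show "(lam\<^sup>2 / C1) * overlap_moment p m \<le> t * (e2 - 1)"
      using mult_left_mono[OF e2_minus_1_ge, of t] t by (simp add: t_def)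
  qed auto
  with main show ?thesis by linarith
qed

end

end

section \<open>Overlap moments of the tilted measure\<close>

text \<open>Convexity of the inverse square, with the tangent taken at \<open>c\<close>; integrated,
  it serves as Jensen's inequality.\<close>

lemma cube_tangent:
  fixes y c :: real
  assumes "0 < y" "0 < c"
  shows "3 / c\<^sup>2 \<le> 1 / y\<^sup>2 + 2 / c ^ 3 * y"
proof -
  have "1 / y\<^sup>2 + 2 / c ^ 3 * y - 3 / c\<^sup>2 = (c - y)\<^sup>2 * (c + 2 * y) / (y\<^sup>2 * c ^ 3)"
    using assms by (simp add: field_simps power2_eq_square power3_eq_cube)
  moreover have "0 \<le> (c - y)\<^sup>2 * (c + 2 * y) / (y\<^sup>2 * c ^ 3)" using assms by simp
  ultimately show ?thesis by linarith
qed

lemma exp_minus_one_mult_nonneg: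
  fixes x y :: real
  assumes "0 \<le> x * y"
  shows "0 \<le> (exp x - 1) * y"
  using assms by (cases x "0 :: real" rule: linorder_cases) (auto simp: zero_le_mult_iff)

text \<open>Equal parity gives \<open>r ^ p\<close> and \<open>r ^ k\<close> compatible signs, so
  the extra weight only helps, even where \<open>r ^ k\<close> is negative. In the application
  \<open>p\<close> belongs to the one fixed field and \<open>k\<close> is the exponent that tends to
  infinity.\<close>

lemma tilted_exp_lower:
  fixes r s :: real
  assumes pk: "even (p + k)" and r: "\<bar>r\<bar> \<le> 1"
  shows "r ^ k + s\<^sup>2 * exp (- s\<^sup>2) * \<bar>r\<bar> ^ (p + k) \<le> exp (s\<^sup>2 * r ^ p) * r ^ k"
proof -
  let ?x = "s\<^sup>2 * r ^ p"
  have x: "\<bar>?x\<bar> \<le> s\<^sup>2"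
    using r by (simp add: abs_mult power_abs mult_left_le power_le_one)
  have "0 \<le> s\<^sup>2 * r ^ (p + k)" using pk by (simp add: zero_le_even_power)
  then have "0 \<le> ?x * r ^ k" by (simp add: power_add mult.assoc)
  then have "0 \<le> (exp ?x - 1) * r ^ k" by (rule exp_minus_one_mult_nonneg)
  then have "(exp ?x - 1) * r ^ k = \<bar>exp ?x - 1\<bar> * \<bar>r\<bar> ^ k"
    by (metis abs_mult abs_of_nonneg power_abs)
  also have "\<dots> \<ge> \<bar>?x\<bar> * exp (- s\<^sup>2) * \<bar>r\<bar> ^ k"
    by (intro mult_right_mono exp_minus_one_bounds(4)[OF x]) simp
  also have "\<bar>?x\<bar> * exp (- s\<^sup>2) * \<bar>r\<bar> ^ k = s\<^sup>2 * exp (- s\<^sup>2) * \<bar>r\<bar> ^ (p + k)"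
    by (simp add: abs_mult power_abs power_add)
  finally show ?thesis by (simp add: algebra_simps)
qed

text \<open>At threshold 1 every vector of the ball belongs to the small overlap set. Written as an
  integral against the overlap law, the moment is seen to depend measurably on the measure.\<close>

lemma overlap_moment_eq_test:
  fixes m :: "'h::{real_inner, second_countable_topology} measure"
  assumes m: "m \<in> space (prob_algebra ball_borel)"
  shows "overlap_moment k m = (\<integral>Q. overlap_test 1 k Q \<partial>overlap_law m)"
proof -
  have s: "sets m = sets ball_borel" and "prob_space m" using m by (auto simp: space_prob_algebra)
  interpret prob_space m by fact
  have sp: "space m = cball 0 1" using sets_eq_imp_space_eq[OF s] by simp
  have "small_overlap_set 1 m = space m"
    using abs_inner_ball_le by (auto simp: small_overlap_set_def sp intro!: AE_I2)
  then show ?thesis by (simp add: integral_overlap_test[OF m] prob_space)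
qed

lemma measurable_integral_overlap_law [measurable]:
  "(\<lambda>m. \<integral>Q. overlap_test a k Q \<partial>overlap_law m) \<in>
     borel_measurable (prob_algebra (ball_borel :: 'h::{real_inner, second_countable_topology} measure))"
  by (rule measurable_compose[OF measurable_prob_algebraD[OF measurable_overlap_law] integral_measurable_subprob_algebra]) measurable

context cavity_measure
begin

text \<open>Induction on the power of \<open>Z\<close>, generalised over the replicas already
  expanded: one \<open>Z\<close> becomes the replica with index \<open>j\<close>. The exponent
  counts all ordered pairs, which is crude but gives finiteness.\<close>

lemma nn_integral_prod_wt_Z_power:
  fixes v :: "nat \<Rightarrow> 'h"
  assumes "\<And>i. i < j \<Longrightarrow> v i \<in> cball 0 1"
  shows "(\<integral>\<^sup>+x. ennreal (\<Prod>i<j. wt (v i) x) * Z x ^ k \<partial>L) \<le> ennreal (exp (lam\<^sup>2 / 2 * (real (j + k))\<^sup>2))"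
  using assms
proof (induction k arbitrary: j v)
  case 0
  have "(\<Sum>i<j. \<Sum>i'<j. (v i \<bullet> v i') ^ p) \<le> (\<Sum>i<j. \<Sum>i'<j. 1)"
    using abs_power_inner_le[OF 0 0] by (intro sum_mono) (auto simp: abs_le_iff)
  moreover have "0 \<le> (\<Sum>i<j. (v i \<bullet> v i) ^ p)"
    by (intro sum_nonneg) auto
  ultimately have "(\<Sum>i<j. \<Sum>i'<j. (v i \<bullet> v i') ^ p) - (\<Sum>i<j. (v i \<bullet> v i) ^ p) \<le> (real j)\<^sup>2"
    by (simp add: power2_eq_square)
  then have "lam\<^sup>2 / 2 * ((\<Sum>i<j. \<Sum>i'<j. (v i \<bullet> v i') ^ p) - (\<Sum>i<j. (v i \<bullet> v i) ^ p)) \<le> lam\<^sup>2 / 2 * (real j)\<^sup>2"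
    by (intro mult_left_mono) auto
  then show ?case using nn_integral_prod_wt[of j v] 0 by (simp add: ennreal_leI)
next
  case (Suc k)
  have nv: "norm (v i) \<le> 1" if "i < j" for i using Suc.prems[OF that] by simp
  have "(\<integral>\<^sup>+x. ennreal (\<Prod>i<j. wt (v i) x) * Z x ^ Suc k \<partial>L) =
    (\<integral>\<^sup>+u. (\<integral>\<^sup>+x. ennreal (\<Prod>i<j. wt (v i) x) * (ennreal (wt u x) * Z x ^ k) \<partial>L) \<partial>m)"
    unfolding power_Suc by (rule nn_integral_mult_Z_mult) (measurable, simp_all add: nv)
  also have "\<dots> \<le> ennreal (exp (lam\<^sup>2 / 2 * (real (j + Suc k))\<^sup>2))"
  proof (rule nn_integral_le_const)
    fix u assume u: "u \<in> space m"
    let ?v = "v(j := u)"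
    have "(\<Prod>i<Suc j. wt (?v i) x) = (\<Prod>i<j. wt (v i) x) * wt u x" for x by simp
    then have "(\<integral>\<^sup>+x. ennreal (\<Prod>i<j. wt (v i) x) * (ennreal (wt u x) * Z x ^ k) \<partial>L) =
        (\<integral>\<^sup>+x. ennreal (\<Prod>i<Suc j. wt (?v i) x) * Z x ^ k \<partial>L)"
      by (simp only: ennreal_mult' wt_nonneg prod_nonneg mult.assoc)
    also have "\<dots> \<le> ennreal (exp (lam\<^sup>2 / 2 * (real (Suc j + k))\<^sup>2))"
      using Suc.prems u by (intro Suc.IH) (auto simp: less_Suc_eq)
    finally show "(\<integral>\<^sup>+x. ennreal (\<Prod>i<j. wt (v i) x) * (ennreal (wt u x) * Z x ^ k) \<partial>L) \<le> ennreal (exp (lam\<^sup>2 / 2 * (real (j + Suc k))\<^sup>2))"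
      by simp
  qed
  finally show ?case .
qed

lemma enn2real_power: "enn2real (y ^ k) = enn2real y ^ k"
  by (induction k) (auto simp: enn2real_mult)

lemma integrable_z_power: "integrable L (\<lambda>x. z x ^ k)"
  using integral_enn2real_le(1)[of "\<lambda>x. Z x ^ k" L] nn_integral_prod_wt_Z_power[of 0 undefined k]
  by (simp add: enn2real_power)

lemma measurable_overlap_moment_tilt [measurable]: "(\<lambda>x. overlap_moment k (tilt x)) \<in> borel_measurable L"
proof -
  have "(\<lambda>x. \<integral>Q. overlap_test 1 k Q \<partial>overlap_law (tilt x)) \<in> borel_measurable L"
    by measurable
  then show ?thesis
    by (rule measurable_cong[THEN iffD2, rotated]) (simp add: overlap_moment_eq_test tilt_in)
qed

lemma overlap_moment_le:
  assumes "AE v in m. AE u in m. \<bar>v \<bullet> u\<bar> \<le> r"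
  shows "overlap_moment k m \<le> r ^ k"
proof -
  note i = integrable2[where f="\<lambda>v u. (v \<bullet> u) ^ k" and B=1]
  have "AE v in m. (\<integral>u. (v \<bullet> u) ^ k \<partial>m) \<le> r ^ k"
    using assms AE_space
  proof eventually_elim
    case (elim v)
    have "(\<integral>u. (v \<bullet> u) ^ k \<partial>m) \<le> (\<integral>u. r ^ k \<partial>m)"
    proof (rule integral_mono_AE)
      show "AE u in m. (v \<bullet> u) ^ k \<le> r ^ k"
        using elim(1)
      proof eventually_elim
        case (elim u)
        then have "\<bar>(v \<bullet> u) ^ k\<bar> \<le> r ^ k" by (simp add: power_abs power_mono)
        then show ?case by simp
      qed
    qed (use elim in \<open>auto intro!: i abs_power_inner_le\<close>)
    then show ?case by (simp add: m.prob_space[simplified])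
  qed
  then have "overlap_moment k m \<le> (\<integral>v. r ^ k \<partial>m)"
    unfolding overlap_moment_def by (intro integral_mono_AE i) (auto intro!: abs_power_inner_le)
  then show ?thesis by (simp add: m.prob_space[simplified])
qed

text \<open>The factor \<open>(z x)\<^sup>2\<close> cancels both normalising constants of the tilted
  double integral, so Fubini and the two-replica formula give an exact value.\<close>

lemma integral_z2_overlap_moment_tilt:
  shows "integrable L (\<lambda>x. (z x)\<^sup>2 * overlap_moment k (tilt x))"
    and "(\<integral>x. (z x)\<^sup>2 * overlap_moment k (tilt x) \<partial>L) = (\<integral>v. (\<integral>u. K v u * (v \<bullet> u) ^ k \<partial>m) \<partial>m)"
proof -
  let ?A = "\<integral>v. (\<integral>u. K v u * (v \<bullet> u) ^ k \<partial>m) \<partial>m"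
  define T where "T x = overlap_moment k (tilt x)" for x
  have T [measurable]: "T \<in> borel_measurable L" unfolding T_def by measurable
  have R: "0 \<le> 1 + (v \<bullet> u) ^ k \<and> 1 + (v \<bullet> u) ^ k \<le> 2" if "v \<in> cball 0 1" "u \<in> cball 0 1" for v u :: 'h
    using abs_power_inner_le[OF that, of k] by (simp add: abs_le_iff)
  have KR: "\<bar>K v u * (v \<bullet> u) ^ k\<bar> \<le> exp (lam\<^sup>2) * 1" if "v \<in> space m" "u \<in> space m" for v u
    unfolding abs_mult using that by (intro mult_mono abs_power_inner_le) (auto intro: K_le)
  \<comment> \<open>Adding 1 to the power makes the integrand nonnegative, so that Fubini applies to
    nonnegative integrals; the surplus \<open>e2\<close> is subtracted at the end.\<close>
  have eq: "Z x * (Z x * ennreal (1 + T x)) = (\<integral>\<^sup>+v. (\<integral>\<^sup>+u. ennreal (wt v x) * (ennreal (wt u x) * ennreal (1 + (v \<bullet> u) ^ k)) \<partial>m) \<partial>m)"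
    and T1: "0 \<le> 1 + T x"
    if x: "x \<in> space L" and fin: "Z x \<noteq> \<infinity>" for x
  proof -
    interpret t: cavity_measure p L l lam "tilt x"
      by unfold_locales (rule tilt_in[OF x])
    have "(\<integral>v. (\<integral>u. 1 + (v \<bullet> u) ^ k \<partial>tilt x) \<partial>tilt x) =
        (\<integral>v. (\<integral>u. 1 \<partial>tilt x) \<partial>tilt x) + (\<integral>v. (\<integral>u. (v \<bullet> u) ^ k \<partial>tilt x) \<partial>tilt x)"
      by (rule t.integral2_add[where B=1 and C=1]) (auto intro!: abs_power_inner_le)
    also have "\<dots> = 1 + T x" by (simp add: T_def overlap_moment_def t.m.prob_space[simplified])
    finally have e: "(\<integral>v. (\<integral>u. 1 + (v \<bullet> u) ^ k \<partial>tilt x) \<partial>tilt x) = 1 + T x" .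
    have "0 \<le> (\<integral>v. (\<integral>u. 1 + (v \<bullet> u) ^ k \<partial>tilt x) \<partial>tilt x)"
      using R by (intro integral_nonneg_AE AE_I2) auto
    then show "0 \<le> 1 + T x" by (simp add: e)
    have "ennreal (1 + T x) = (\<integral>\<^sup>+v. (\<integral>\<^sup>+u. ennreal (1 + (v \<bullet> u) ^ k) \<partial>tilt x) \<partial>tilt x)"
      unfolding e[symmetric] using R by (intro t.nn_integral_eq_integral2[where B=2, symmetric]) auto
    also have "\<dots> = (\<integral>\<^sup>+v. (\<integral>\<^sup>+u. ennreal (wt u x) * ennreal (1 + (v \<bullet> u) ^ k) \<partial>m) / Z x \<partial>tilt x)"
      by (intro nn_integral_cong nn_integral_tilt x fin) measurable
    also have "\<dots> = (\<integral>\<^sup>+v. ennreal (wt v x) * ((\<integral>\<^sup>+u. ennreal (wt u x) * ennreal (1 + (v \<bullet> u) ^ k) \<partial>m) / Z x) \<partial>m) / Z x"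
      using x by (intro nn_integral_tilt fin) measurable
    also have "\<dots> = (\<integral>\<^sup>+v. (\<integral>\<^sup>+u. ennreal (wt v x) * (ennreal (wt u x) * ennreal (1 + (v \<bullet> u) ^ k)) \<partial>m) / Z x \<partial>m) / Z x"
      using x by (intro arg_cong2[where f="(/)"] refl nn_integral_cong)
        (simp add: nn_integral_cmult ennreal_times_divide)
    also have "\<dots> = (\<integral>\<^sup>+v. (\<integral>\<^sup>+u. ennreal (wt v x) * (ennreal (wt u x) * ennreal (1 + (v \<bullet> u) ^ k)) \<partial>m) \<partial>m) / Z x / Z x"
      using x by (subst nn_integral_divide) auto
    finally show "Z x * (Z x * ennreal (1 + T x)) = (\<integral>\<^sup>+v. (\<integral>\<^sup>+u. ennreal (wt v x) * (ennreal (wt u x) * ennreal (1 + (v \<bullet> u) ^ k)) \<partial>m) \<partial>m)"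
      using Z_pos[OF x] fin
      by (simp add: ennreal_times_divide ennreal_mult_divide_eq mult.commute[of "Z x"] ennreal_divide_times)
  qed
  have "(\<integral>\<^sup>+x. Z x * (Z x * ennreal (1 + T x)) \<partial>L) =
      (\<integral>\<^sup>+x. (\<integral>\<^sup>+v. (\<integral>\<^sup>+u. ennreal (wt v x) * (ennreal (wt u x) * ennreal (1 + (v \<bullet> u) ^ k)) \<partial>m) \<partial>m) \<partial>L)"
    by (rule nn_integral_cong_AE) (use AE_Z_finite AE_space in eventually_elim, rule eq)
  also have "\<dots> = (\<integral>\<^sup>+v. (\<integral>\<^sup>+x. (\<integral>\<^sup>+u. ennreal (wt v x) * (ennreal (wt u x) * ennreal (1 + (v \<bullet> u) ^ k)) \<partial>m) \<partial>L) \<partial>m)"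
    by (rule mL.Fubini') measurable
  also have "\<dots> = (\<integral>\<^sup>+v. (\<integral>\<^sup>+u. (\<integral>\<^sup>+x. ennreal (wt v x) * (ennreal (wt u x) * ennreal (1 + (v \<bullet> u) ^ k)) \<partial>L) \<partial>m) \<partial>m)"
    by (intro nn_integral_cong mL.Fubini') measurable
  also have "\<dots> = (\<integral>\<^sup>+v. (\<integral>\<^sup>+u. ennreal (K v u + K v u * (v \<bullet> u) ^ k) \<partial>m) \<partial>m)"
  proof (intro nn_integral_cong)
    fix v u assume vu: "v \<in> space m" "u \<in> space m"
    have "(\<integral>\<^sup>+x. ennreal (wt v x) * (ennreal (wt u x) * ennreal (1 + (v \<bullet> u) ^ k)) \<partial>L) =
        (\<integral>\<^sup>+x. (ennreal (wt v x) * ennreal (wt u x)) * ennreal (1 + (v \<bullet> u) ^ k) \<partial>L)"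
      by (simp add: mult.assoc)
    also have "\<dots> = (\<integral>\<^sup>+x. ennreal (wt v x) * ennreal (wt u x) \<partial>L) * ennreal (1 + (v \<bullet> u) ^ k)"
    proof (rule nn_integral_multc)
      have [measurable]: "wt v \<in> borel_measurable L" "wt u \<in> borel_measurable L"
        using measurable_wt[of "\<lambda>_. v" L "\<lambda>x. x"] measurable_wt[of "\<lambda>_. u" L "\<lambda>x. x"] vu by simp_all
      show "(\<lambda>x. ennreal (wt v x) * ennreal (wt u x)) \<in> borel_measurable L" by measurable
    qed
    also have "\<dots> = ennreal (K v u) * ennreal (1 + (v \<bullet> u) ^ k)"
      using vu by (simp add: nn_integral_wt(2) K_def)
    also have "\<dots> = ennreal (K v u + K v u * (v \<bullet> u) ^ k)"
      by (simp add: ennreal_mult'[symmetric] distrib_left)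
    finally show "(\<integral>\<^sup>+x. ennreal (wt v x) * (ennreal (wt u x) * ennreal (1 + (v \<bullet> u) ^ k)) \<partial>L) = ennreal (K v u + K v u * (v \<bullet> u) ^ k)" .
  qed
  also have "\<dots> = ennreal (\<integral>v. (\<integral>u. K v u + K v u * (v \<bullet> u) ^ k \<partial>m) \<partial>m)"
  proof (rule nn_integral_eq_integral2)
    fix v u assume vu: "v \<in> space m" "u \<in> space m"
    have "0 \<le> K v u * (1 + (v \<bullet> u) ^ k)" using R[of v u] vu by simp
    moreover have "K v u * (1 + (v \<bullet> u) ^ k) \<le> exp (lam\<^sup>2) * 2"
      using R[of v u] vu K_le[of v u] by (intro mult_mono) auto
    ultimately show "0 \<le> K v u + K v u * (v \<bullet> u) ^ k \<and> K v u + K v u * (v \<bullet> u) ^ k \<le> exp (lam\<^sup>2) * 2"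
      by (simp add: distrib_left)
  qed measurable
  also have eA: "(\<integral>v. (\<integral>u. K v u + K v u * (v \<bullet> u) ^ k \<partial>m) \<partial>m) = e2 + ?A"
    unfolding integral_integral_K[symmetric]
    by (rule integral2_add[where B="exp (lam\<^sup>2)" and C="exp (lam\<^sup>2) * 1"]) (use KR in \<open>auto intro: K_le\<close>)
  finally have tot: "(\<integral>\<^sup>+x. Z x * (Z x * ennreal (1 + T x)) \<partial>L) = ennreal (e2 + ?A)" .
  have pos: "0 \<le> e2 + ?A"
  proof -
    have "0 \<le> (\<integral>v. (\<integral>u. K v u + K v u * (v \<bullet> u) ^ k \<partial>m) \<partial>m)"
    proof (intro Bochner_Integration.integral_nonneg_AE AE_I2)
      fix v u assume vu: "v \<in> space m" "u \<in> space m"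
      have "0 \<le> K v u * (1 + (v \<bullet> u) ^ k)" using R[of v u] vu by simp
      then show "0 \<le> K v u + K v u * (v \<bullet> u) ^ k" by (simp add: distrib_left)
    qed
    then show ?thesis by (simp only: eA)
  qed
  have ae: "AE x in L. enn2real (Z x * (Z x * ennreal (1 + T x))) = z x * z x + (z x)\<^sup>2 * T x"
    using AE_Z_finite AE_space
  proof eventually_elim
    case (elim x)
    then show ?case using T1[of x] by (simp add: enn2real_mult power2_eq_square algebra_simps)
  qed
  note tot2 = integral_enn2real[OF _ tot pos]
  have i: "integrable L (\<lambda>x. z x * z x + (z x)\<^sup>2 * T x)"
    by (rule integrable_cong_AE_imp[OF tot2(1) _ ae]) measurable
  have e: "(\<integral>x. z x * z x + (z x)\<^sup>2 * T x \<partial>L) = e2 + ?A"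
    using integral_cong_AE[OF _ _ ae] tot2(2) by simp
  have "integrable L (\<lambda>x. (z x * z x + (z x)\<^sup>2 * T x) - z x * z x)"
    using i integral_z2(1) by (rule Bochner_Integration.integrable_diff)
  then show i2: "integrable L (\<lambda>x. (z x)\<^sup>2 * overlap_moment k (tilt x))" by (simp add: T_def)
  show "(\<integral>x. (z x)\<^sup>2 * overlap_moment k (tilt x) \<partial>L) = ?A"
    using e i2 integral_z2 by (simp add: T_def)
qed

lemma overlap_moment_le_1: "\<bar>overlap_moment k m\<bar> \<le> 1"
proof -
  note i = integrable2[where f="\<lambda>v u. (v \<bullet> u) ^ k" and B=1]
  have "\<bar>overlap_moment k m\<bar> \<le> (\<integral>v. \<bar>\<integral>u. (v \<bullet> u) ^ k \<partial>m\<bar> \<partial>m)"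
    unfolding overlap_moment_def by (rule integral_abs_bound)
  also have "\<dots> \<le> (\<integral>v. 1 \<partial>m)"
    by (intro integral_mono integrable_abs i) (auto intro!: abs_power_inner_le i)
  finally show ?thesis by (simp add: m.prob_space[simplified])
qed

section \<open>A negative moment of the tilted mass\<close>

lemma W_pos:
  assumes x: "x \<in> space L" and n: "0 < measure m (small_overlap_set a m)"
  shows "0 < W (small_overlap_set a m) x"
proof -
  let ?S = "small_overlap_set a m"
  have S [measurable]: "?S \<in> sets ball_borel" "?S \<in> sets m"
    using sets_small_overlap_set[OF m_in] sets_m by simp_all
  have "W ?S x \<noteq> 0"
  proof
    assume "W ?S x = 0"
    then have "AE v in m. ennreal (wt v x) * indicator ?S v = 0"
      unfolding W_def using x by (subst (asm) nn_integral_0_iff_AE) auto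
    then have "AE v in m. v \<notin> ?S"
      by eventually_elim (auto simp: indicator_def ennreal_eq_0_iff not_le[THEN iffD2, OF wt_pos] split: if_splits)
    then have "emeasure m ?S = 0"
      using S by (subst (asm) AE_iff_null_sets[symmetric]) auto
    then show False using n by (simp add: measure_def)
  qed
  then show ?thesis by (simp add: zero_less_iff_neq_zero)
qed

text \<open>Jensen's inequality for the inverse square under \<open>m\<close> restricted to
  \<open>S\<close> and normalised. The number \<open>c\<close> is the mean weight on
  \<open>S\<close>, and the tangent at \<open>c\<close> is what gets integrated.\<close>

lemma nn_integral_inverse_square_ge:
  fixes a :: real
  defines "S \<equiv> small_overlap_set a m"
  assumes x: "x \<in> space L" and Z: "Z x \<noteq> \<infinity>" and n: "0 < measure m S"
  shows "ennreal (measure m S ^ 3 / (enn2real (W S x))\<^sup>2) \<le> (\<integral>\<^sup>+v. ennreal (wt v x powr - 2) * indicator S v \<partial>m)"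
proof -
  have S [measurable]: "S \<in> sets ball_borel" "S \<in> sets m"
    using sets_small_overlap_set[OF m_in] sets_m by (simp_all add: S_def)
  define c where "c = enn2real (W S x) / measure m S"
  have Wfin: "W S x \<noteq> \<infinity>" using W_le_Z[of S x] Z by (auto simp: top_unique)
  have "0 < enn2real (W S x)"
    using W_pos[OF x n[unfolded S_def]] Wfin by (simp add: S_def enn2real_positive_iff less_top[symmetric])
  then have c: "0 < c" "enn2real (W S x) = c * measure m S" using n by (simp_all add: c_def)
  have W: "W S x = ennreal (c * measure m S)"
    using Wfin by (simp add: c(2)[symmetric] less_top[symmetric])
  let ?I = "\<integral>\<^sup>+v. ennreal (wt v x powr - 2) * indicator S v \<partial>m"
  have "ennreal (3 / c\<^sup>2 * measure m S) = (\<integral>\<^sup>+v. ennreal (3 / c\<^sup>2) * indicator S v \<partial>m)"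
    using S by (simp add: nn_integral_cmult_indicator m.emeasure_eq_measure ennreal_mult'[symmetric])
  also have "\<dots> \<le> (\<integral>\<^sup>+v. ennreal (wt v x powr - 2) * indicator S v + ennreal (2 / c ^ 3) * (ennreal (wt v x) * indicator S v) \<partial>m)"
  proof (rule nn_integral_mono)
    fix v
    have "3 / c\<^sup>2 \<le> wt v x powr - 2 + 2 / c ^ 3 * wt v x"
      using cube_tangent[OF wt_pos c(1), of v x] by (simp add: powr_minus divide_inverse powr_numeral)
    then have "ennreal (3 / c\<^sup>2) \<le> ennreal (wt v x powr - 2) + ennreal (2 / c ^ 3) * ennreal (wt v x)"
      using c by (simp add: ennreal_leI flip: ennreal_plus ennreal_mult')
    then show "ennreal (3 / c\<^sup>2) * indicator S v \<le> ennreal (wt v x powr - 2) * indicator S v + ennreal (2 / c ^ 3) * (ennreal (wt v x) * indicator S v)"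
      by (simp add: indicator_def)
  qed
  also have "\<dots> = ?I + ennreal (2 / c ^ 3) * W S x"
    unfolding W_def using x by (simp add: nn_integral_add nn_integral_cmult)
  also have "ennreal (2 / c ^ 3) * W S x = ennreal (2 / c\<^sup>2 * measure m S)"
    unfolding W using c by (simp add: ennreal_mult'[symmetric] power2_eq_square power3_eq_cube)
  finally have le: "ennreal (3 / c\<^sup>2 * measure m S) \<le> ?I + ennreal (2 / c\<^sup>2 * measure m S)" .
  have "ennreal (measure m S / c\<^sup>2) \<le> ?I"
  proof (cases ?I)
    case (real r)
    then have "ennreal (3 / c\<^sup>2 * measure m S) \<le> ennreal (r + 2 / c\<^sup>2 * measure m S)"
      using le by simp
    then have "3 / c\<^sup>2 * measure m S \<le> r + 2 / c\<^sup>2 * measure m S"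
      using real by (subst (asm) ennreal_le_iff) auto
    then show ?thesis using real by (simp add: ennreal_leI)
  qed simp
  also have "measure m S / c\<^sup>2 = measure m S ^ 3 / (enn2real (W S x))\<^sup>2"
    unfolding c(2) using n c(1) by (simp add: power2_eq_square power3_eq_cube)
  finally show ?thesis .
qed

text \<open>Provides the second factor of the Cauchy-Schwarz estimate below. A product is at most
  the sum of the squares, so it is enough to integrate \<open>z x ^ 10\<close> and the inverse
  square of the mass; the latter is handled by Jensen and the moment of order -2 of a single
  weight.\<close>

lemma integrable_z5_div_w:
  fixes a :: real
  defines "S \<equiv> small_overlap_set a m"
  assumes n: "0 < measure m S"
  shows "integrable L (\<lambda>x. z x ^ 5 / enn2real (W S x))"
proof -
  have S [measurable]: "S \<in> sets ball_borel" "S \<in> sets m"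
    using sets_small_overlap_set[OF m_in] sets_m by (simp_all add: S_def)
  let ?h = "\<lambda>x. measure m S ^ 3 / (enn2real (W S x))\<^sup>2"
  have "(\<integral>\<^sup>+x. ennreal (?h x) \<partial>L) \<le> (\<integral>\<^sup>+x. (\<integral>\<^sup>+v. ennreal (wt v x powr - 2) * indicator S v \<partial>m) \<partial>L)"
    by (rule nn_integral_mono_AE)
      (use AE_Z_finite AE_space in eventually_elim, use n in \<open>auto simp: S_def intro!: nn_integral_inverse_square_ge\<close>)
  also have "\<dots> = (\<integral>\<^sup>+v. (\<integral>\<^sup>+x. ennreal (wt v x powr - 2) * indicator S v \<partial>L) \<partial>m)"
    by (rule mL.Fubini') measurable
  also have "\<dots> \<le> (\<integral>\<^sup>+v. (\<integral>\<^sup>+x. ennreal (wt v x powr - 2) \<partial>L) \<partial>m)"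
    by (intro nn_integral_mono) (auto simp: indicator_def)
  also have "\<dots> \<le> ennreal (exp (lam\<^sup>2 * ((- 2)\<^sup>2 + \<bar>- 2\<bar>)))"
    by (intro nn_integral_le_const nn_integral_wt_powr) simp
  finally have "(\<integral>\<^sup>+x. ennreal (?h x) \<partial>L) < \<infinity>" by (rule le_less_trans) simp
  then have ih: "integrable L ?h" by (intro integrableI_nonneg) auto
  show ?thesis
  proof (rule Bochner_Integration.integrable_bound)
    show "integrable L (\<lambda>x. z x ^ 10 + ?h x / measure m S ^ 3)"
      by (intro Bochner_Integration.integrable_add integrable_z_power integrable_divide_zero ih)
    have "\<bar>z x ^ 5 / enn2real (W S x)\<bar> \<le> \<bar>z x ^ 10 + ?h x / measure m S ^ 3\<bar>" for x
    proof -
      let ?s = "z x ^ 5" and ?t = "1 / enn2real (W S x)"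
      have "2 * ?s * ?t \<le> ?s\<^sup>2 + ?t\<^sup>2" by (rule sum_squares_bound)
      moreover have "0 \<le> ?s * ?t" by simp
      ultimately have "?s * ?t \<le> ?s\<^sup>2 + ?t\<^sup>2" by linarith
      then show ?thesis using n by (simp add: power_mult[symmetric] power_divide)
    qed
    then show "AE x in L. norm (z x ^ 5 / enn2real (W S x)) \<le> norm (z x ^ 10 + ?h x / measure m S ^ 3)"
      by simp
  qed measurable
qed

text \<open>With \<open>T\<close> the tilted moment and \<open>y\<close> the unnormalised mass of
  \<open>S\<close>, Cauchy-Schwarz bounds the square of the mean of \<open>z\<^sup>2 * T\<close> by
  the mean of \<open>y / z * T\<close> times the mean of \<open>z ^ 5 / y * T\<close>. The first
  mean is known exactly and the last is at most \<open>r ^ k\<close> times a constant free of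
  \<open>k\<close>, whence the rate \<open>b\<^sup>2 / r\<close>. Nonnegativity of the moments of
  order \<open>k\<close> is a premise because it comes from a field of exponent \<open>k\<close>,
  while the locale holds the one of exponent \<open>p\<close>.\<close>

lemma overlap_moment_tilt_lower:
  fixes a b r :: real
  defines "S \<equiv> small_overlap_set a m"
  assumes n: "0 < measure m S" and r: "0 < r" "AE v in m. AE u in m. \<bar>v \<bullet> u\<bar> \<le> r"
    and b: "0 < b" "0 < (\<integral>v. measure m {u \<in> space m. b < \<bar>v \<bullet> u\<bar>} \<partial>m)" and lam: "lam \<noteq> 0"
  shows "\<exists>c>0. \<forall>k. even (p + k) \<and> (\<forall>m'\<in>space (prob_algebra (ball_borel :: 'h measure)). 0 \<le> overlap_moment k m') \<longrightarrow>
    c * (b\<^sup>2 / r) ^ k \<le> (\<integral>x. measure (tilt x) S * overlap_moment k (tilt x) \<partial>L)"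
proof -
  have S [measurable]: "S \<in> sets ball_borel" "S \<in> sets m"
    using sets_small_overlap_set[OF m_in] sets_m by (simp_all add: S_def)
  define q where "q = (\<integral>v. measure m {u \<in> space m. b < \<bar>v \<bullet> u\<bar>} \<partial>m)"
  \<comment> \<open>The summand 1 makes \<open>B\<close> positive, as it is used as a
    divisor.\<close>
  define B where "B = (\<integral>x. z x ^ 5 / enn2real (W S x) \<partial>L) + 1"
  have B: "0 < B" unfolding B_def by (intro add_nonneg_pos integral_nonneg) auto
  define c1 where "c1 = lam\<^sup>2 * exp (- lam\<^sup>2)"
  have c1: "0 < c1" using lam by (simp add: c1_def)
  have q: "0 < q" using b by (simp add: q_def)
  have "c1\<^sup>2 * (b ^ p)\<^sup>2 * q\<^sup>2 / B * (b\<^sup>2 / r) ^ k \<le> (\<integral>x. measure (tilt x) S * overlap_moment k (tilt x) \<partial>L)"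
    if pk: "even (p + k)" and pos: "\<And>m'. m' \<in> space (prob_algebra (ball_borel :: 'h measure)) \<Longrightarrow> 0 \<le> overlap_moment k m'" for k
  proof -
    define A where "A = (\<integral>v. (\<integral>u. K v u * (v \<bullet> u) ^ k \<partial>m) \<partial>m)"
    \<comment> \<open>What \<open>tilted_exp_lower\<close> yields when only pairs with overlap above
      \<open>b\<close> are kept and the untilted moment is dropped as nonnegative.\<close>
    define A' where "A' = c1 * b ^ (p + k) * q"
    have A'0: "0 < A'" using c1 b q by (simp add: A'_def)
    have "A' \<le> A"
    proof -
      have R: "\<bar>(v \<bullet> u) ^ j\<bar> \<le> 1" if "v \<in> space m" "u \<in> space m" for v u j
        using that by (intro abs_power_inner_le) auto
      have ball: "{u. norm u \<le> 1 \<and> b < \<bar>v \<bullet> u\<bar>} \<inter> cball 0 1 = {u. norm u \<le> 1 \<and> b < \<bar>v \<bullet> u\<bar>}" for v :: 'h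
        by auto
      have "overlap_moment k m + A' = (\<integral>v. (\<integral>u. (v \<bullet> u) ^ k \<partial>m) \<partial>m) +
          (\<integral>v. (\<integral>u. c1 * b ^ (p + k) * indicator {u \<in> space m. b < \<bar>v \<bullet> u\<bar>} u \<partial>m) \<partial>m)"
        by (simp add: overlap_moment_def A'_def q_def ball)
      also have "(\<integral>v. (\<integral>u. c1 * b ^ (p + k) * indicator {u \<in> space m. b < \<bar>v \<bullet> u\<bar>} u \<partial>m) \<partial>m) =
        (\<integral>v. (\<integral>u. c1 * b ^ (p + k) * of_bool (b < \<bar>v \<bullet> u\<bar>) \<partial>m) \<partial>m)"
        by (intro Bochner_Integration.integral_cong refl) (auto simp: indicator_def)
      also have "(\<integral>v. (\<integral>u. (v \<bullet> u) ^ k \<partial>m) \<partial>m) + \<dots> = (\<integral>v. (\<integral>u. (v \<bullet> u) ^ k + c1 * b ^ (p + k) * of_bool (b < \<bar>v \<bullet> u\<bar>) \<partial>m) \<partial>m)"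
        by (rule integral2_add[symmetric, where B=1 and C="\<bar>c1 * b ^ (p + k)\<bar>"]) (use R in \<open>auto simp: abs_mult\<close>)
      also have "\<dots> \<le> A"
        unfolding A_def
      proof (rule integral2_mono)
        fix v u assume vu: "v \<in> space m" "u \<in> space m"
        show "\<bar>(v \<bullet> u) ^ k + c1 * b ^ (p + k) * of_bool (b < \<bar>v \<bullet> u\<bar>)\<bar> \<le> 1 + \<bar>c1 * b ^ (p + k)\<bar>"
          by (rule order_trans[OF abs_triangle_ineq add_mono]) (use R vu in \<open>auto simp: abs_mult\<close>)
        show "\<bar>K v u * (v \<bullet> u) ^ k\<bar> \<le> exp (lam\<^sup>2) * 1"
          unfolding abs_mult using vu R by (intro mult_mono) (auto intro: K_le)
        have "c1 * b ^ (p + k) * of_bool (b < \<bar>v \<bullet> u\<bar>) \<le> c1 * \<bar>v \<bullet> u\<bar> ^ (p + k)"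
          using b c1 by (auto simp: power_mono)
        also have "(v \<bullet> u) ^ k + c1 * \<bar>v \<bullet> u\<bar> ^ (p + k) \<le> K v u * (v \<bullet> u) ^ k"
          unfolding c1_def K_def using vu by (intro tilted_exp_lower pk abs_inner_ball_le) auto
        finally show "(v \<bullet> u) ^ k + c1 * b ^ (p + k) * of_bool (b < \<bar>v \<bullet> u\<bar>) \<le> K v u * (v \<bullet> u) ^ k" by simp
      qed measurable
      finally show ?thesis using pos[OF m_in] by simp
    qed
    define T where "T x = overlap_moment k (tilt x)" for x
    have T: "0 \<le> T x \<and> T x \<le> r ^ k \<and> T x \<le> 1" if x: "x \<in> space L" for x
    proof -
      interpret t: cavity_measure p L l lam "tilt x" by unfold_locales (rule tilt_in[OF x])
      have "T x \<le> r ^ k" unfolding T_def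
        using r(2) by (intro t.overlap_moment_le) (simp add: AE_tilt[OF x])
      moreover have "T x \<le> 1" using t.overlap_moment_le_1[of k] by (simp add: T_def)
      ultimately show ?thesis using pos[OF tilt_in[OF x]] by (simp add: T_def)
    qed
    \<comment> \<open>The maximiser of \<open>2 * t * A' - t\<^sup>2 * r ^ k * B\<close>;
      Cauchy-Schwarz is used in linearised form, as a pointwise inequality that is then
      integrated.\<close>
    define t where "t = A' / (r ^ k * B)"
    have t: "0 < t" using A'0 r B by (simp add: t_def)
    let ?F = "\<lambda>x. 2 * t * ((z x)\<^sup>2 * T x) - t\<^sup>2 * r ^ k * (z x ^ 5 / enn2real (W S x))"
    have i1: "integrable L (\<lambda>x. (z x)\<^sup>2 * T x)"
      unfolding T_def by (rule integral_z2_overlap_moment_tilt)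
    have i2: "integrable L (\<lambda>x. z x ^ 5 / enn2real (W S x))"
      using integrable_z5_div_w[OF n[unfolded S_def]] by (simp only: S_def)
    have iF: "integrable L ?F"
      by (intro Bochner_Integration.integrable_diff integrable_mult_right i1 i2)
    have "c1\<^sup>2 * (b ^ p)\<^sup>2 * q\<^sup>2 / B * (b\<^sup>2 / r) ^ k = A'\<^sup>2 / (r ^ k * B)"
      using r by (simp add: A'_def power_mult_distrib power_add power_divide power_mult[symmetric] mult.commute)
    also have "\<dots> = 2 * t * A' - t\<^sup>2 * r ^ k * B"
      unfolding t_def using r B by (simp add: power2_eq_square field_simps)
    also have "\<dots> \<le> 2 * t * A - t\<^sup>2 * r ^ k * (B - 1)"
      using \<open>A' \<le> A\<close> t r by (intro diff_mono mult_left_mono) auto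
    also have "\<dots> = (\<integral>x. ?F x \<partial>L)"
    proof -
      have "(\<integral>x. ?F x \<partial>L) = (\<integral>x. 2 * t * ((z x)\<^sup>2 * T x) \<partial>L) - (\<integral>x. t\<^sup>2 * r ^ k * (z x ^ 5 / enn2real (W S x)) \<partial>L)"
        by (intro Bochner_Integration.integral_diff integrable_mult_right i1 i2)
      also have "\<dots> = 2 * t * A - t\<^sup>2 * r ^ k * (B - 1)"
        unfolding integral_mult_right_zero by (simp add: A_def B_def T_def integral_z2_overlap_moment_tilt)
      finally show ?thesis by simp
    qed
    also have "\<dots> \<le> (\<integral>x. measure (tilt x) S * T x \<partial>L)"
    proof (rule integral_mono_AE[OF iF])
      have tp: "prob_space (tilt x)" if "x \<in> space L" for x
        using tilt_in[OF that] by (simp add: space_prob_algebra)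
      have m1: "measure (tilt x) S \<le> 1" if "x \<in> space L" for x
        using tp[OF that] by (rule prob_space.prob_le_1)
      show "integrable L (\<lambda>x. measure (tilt x) S * T x)"
      proof (rule L.integrable_const_bound[where B=1])
        show "AE x in L. norm (measure (tilt x) S * T x) \<le> 1"
          using m1 T by (auto intro!: AE_I2 mult_le_one simp: abs_mult)
        show "(\<lambda>x. measure (tilt x) S * T x) \<in> borel_measurable L" unfolding T_def by measurable
      qed
      show "AE x in L. ?F x \<le> measure (tilt x) S * T x"
        using AE_Z_finite AE_space
      proof eventually_elim
        case (elim x)
        then have z: "0 < z x" by (rule z_pos[rotated])
        have Wfin: "W S x \<noteq> \<infinity>" using W_le_Z[of S x] elim by (auto simp: top_unique)
        define y where "y = enn2real (W S x)"
        have y: "0 < y" unfolding y_def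
          using W_pos[OF elim(2) n[unfolded S_def]] Wfin by (simp add: S_def enn2real_positive_iff less_top[symmetric])
        have mt: "measure (tilt x) S = y / z x"
          using elim by (simp add: measure_tilt y_def)
        have "2 * t * (z x)\<^sup>2 - t\<^sup>2 * (z x ^ 5 / y) \<le> y / z x"
        proof -
          have "y / z x - (2 * t * (z x)\<^sup>2 - t\<^sup>2 * (z x ^ 5 / y)) = (y - t * z x ^ 3)\<^sup>2 / (y * z x)"
            using y z by (simp add: field_simps eval_nat_numeral)
          moreover have "0 \<le> (y - t * z x ^ 3)\<^sup>2 / (y * z x)" using y z by simp
          ultimately show ?thesis by linarith
        qed
        then have "(2 * t * (z x)\<^sup>2 - t\<^sup>2 * (z x ^ 5 / y)) * T x \<le> y / z x * T x"
          using T[OF elim(2)] by (intro mult_right_mono) auto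
        \<comment> \<open>The bound \<open>T x \<le> r ^ k\<close> is spent on the subtracted term
          only, so a single factor \<open>r ^ k\<close> is lost.\<close>
        moreover have "t\<^sup>2 * (z x ^ 5 / y) * T x \<le> t\<^sup>2 * (z x ^ 5 / y) * r ^ k"
          using T[OF elim(2)] y by (intro mult_left_mono) auto
        ultimately show ?case unfolding mt y_def[symmetric] by (simp add: algebra_simps)
      qed
    qed
    finally show ?thesis by (simp add: T_def)
  qed
  moreover have "0 < c1\<^sup>2 * (b ^ p)\<^sup>2 * q\<^sup>2 / B" using c1 b q B by simp
  ultimately show ?thesis by blast
qed

end

section \<open>Invariance and the radius\<close>

text \<open>Integrating the conditional probabilities of \<open>Q\<close> given \<open>\<mu>\<close>
  exhibits its law as a mixture of overlap laws.\<close>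

lemma distr_eq_bind_overlap_law:
  fixes \<mu> :: "'w \<Rightarrow> 'h::{real_inner, second_countable_topology} measure"
  assumes "sampling_measure M Q \<mu>"
  shows "distr M matrices Q = M \<bind> (\<lambda>\<omega>. overlap_law (\<mu> \<omega>))"
proof -
  have ROSt: "is_ROSt M Q" and \<mu> [measurable]: "\<mu> \<in> M \<rightarrow>\<^sub>M prob_algebra ball_borel"
    and cond: "\<And>A. A \<in> sets matrices \<Longrightarrow> AE \<omega> in M.
        real_cond_exp M (vimage_algebra (space M) \<mu> (prob_algebra ball_borel))
          (\<lambda>\<omega>. indicator A (Q \<omega>)) \<omega> = measure (overlap_law (\<mu> \<omega>)) A"
    using assms by (auto simp: sampling_measure_def)
  then have M: "prob_space M" and Q [measurable]: "Q \<in> M \<rightarrow>\<^sub>M matrices" by (auto simp: is_ROSt_def)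
  interpret prob_space M by fact
  let ?F = "vimage_algebra (space M) \<mu> (prob_algebra (ball_borel :: 'h measure))"
  interpret F: finite_measure_subalgebra M ?F
  proof unfold_locales
    show "subalgebra M ?F"
      using measurable_sets[OF \<mu>] measurable_space[OF \<mu>]
      by (auto simp: subalgebra_def sets_vimage_algebra2)
  qed
  have ol: "(\<lambda>\<omega>. overlap_law (\<mu> \<omega>)) \<in> M \<rightarrow>\<^sub>M prob_algebra matrices" by measurable
  show ?thesis
  proof (rule measure_eqI)
    show "sets (distr M matrices Q) = sets (M \<bind> (\<lambda>\<omega>. overlap_law (\<mu> \<omega>)))"
      using measurable_prob_algebraD[OF ol] not_empty by (subst sets_bind_measurable) auto
    fix A assume "A \<in> sets (distr M matrices Q)"
    then have A [measurable]: "A \<in> sets matrices" by simp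
    have p: "prob_space (overlap_law (\<mu> \<omega>))" if "\<omega> \<in> space M" for \<omega>
      using measurable_space[OF ol that] by (simp add: space_prob_algebra)
    have mm: "(\<lambda>\<omega>. measure (overlap_law (\<mu> \<omega>)) A) \<in> borel_measurable M"
      by (rule measurable_compose[OF measurable_prob_algebraD[OF ol] measurable_measure_subprob_algebra]) measurable
    have "measure (distr M matrices Q) A = (\<integral>\<omega>. indicator A (Q \<omega>) \<partial>M)"
    proof -
      have "(\<integral>\<omega>. indicator A (Q \<omega>) \<partial>M) = (\<integral>\<omega>. indicator (Q -` A \<inter> space M) \<omega> \<partial>M :: real)"
        by (intro Bochner_Integration.integral_cong refl) (auto simp: indicator_def)
      then show ?thesis by (simp add: measure_distr)
    qed
    also have "\<dots> = (\<integral>\<omega>. real_cond_exp M ?F (\<lambda>\<omega>. indicator A (Q \<omega>)) \<omega> \<partial>M)"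
      by (intro F.real_cond_exp_int(2)[symmetric] integrable_const_bound[where B=1]) auto
    also have "\<dots> = (\<integral>\<omega>. measure (overlap_law (\<mu> \<omega>)) A \<partial>M)"
      by (intro integral_cong_AE cond A mm) measurable
    finally have eq: "measure (distr M matrices Q) A = (\<integral>\<omega>. measure (overlap_law (\<mu> \<omega>)) A \<partial>M)" .
    have "emeasure (M \<bind> (\<lambda>\<omega>. overlap_law (\<mu> \<omega>))) A = (\<integral>\<^sup>+\<omega>. emeasure (overlap_law (\<mu> \<omega>)) A \<partial>M)"
      by (rule emeasure_bind_prob_algebra[OF _ ol]) (auto simp: space_prob_algebra M)
    also have "\<dots> = (\<integral>\<^sup>+\<omega>. ennreal (measure (overlap_law (\<mu> \<omega>)) A) \<partial>M)"
      using p by (intro nn_integral_cong finite_measure.emeasure_eq_measure) (simp add: prob_space.finite_measure)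
    also have "\<dots> = ennreal (\<integral>\<omega>. measure (overlap_law (\<mu> \<omega>)) A \<partial>M)"
      using p mm by (intro nn_integral_eq_integral integrable_const_bound[where B=1])
        (auto intro!: AE_I2 prob_space.prob_le_1)
    also have "\<dots> = emeasure (distr M matrices Q) A"
      unfolding eq[symmetric]
      by (intro finite_measure.emeasure_eq_measure[symmetric] prob_space.finite_measure prob_space_distr Q)
    finally show "emeasure (distr M matrices Q) A = emeasure (M \<bind> (\<lambda>\<omega>. overlap_law (\<mu> \<omega>))) A" by simp
  qed
qed

lemma integral_bind_prob:
  fixes f :: "'b \<Rightarrow> real"
  assumes "prob_space M" "f \<in> borel_measurable K" "\<And>x. \<bar>f x\<bar> \<le> B" "N \<in> M \<rightarrow>\<^sub>M prob_algebra K"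
  shows "(\<integral>x. f x \<partial>(M \<bind> N)) = (\<integral>x. (\<integral>y. f y \<partial>N x) \<partial>M)"
proof (rule integral_bind[where K=K and B=B and B'=1])
  have "prob_space (N x)" if "x \<in> space M" for x
    using measurable_space[OF assms(4) that] by (simp add: space_prob_algebra)
  then show "AE x in M. emeasure (N x) (space (N x)) \<le> ennreal 1"
    by (auto intro!: AE_I2 simp: prob_space.emeasure_space_1)
qed (use assms in \<open>auto intro: measurable_prob_algebraD prob_space.finite_measure\<close>)

text \<open>Both sides integrate the test against the law of \<open>Q\<close>, written once as a
  mixture over \<open>\<mu>\<close> and once as the cavity image.\<close>

lemma invariant_integral_overlap_test:
  fixes \<mu> :: "'w \<Rightarrow> 'h::{real_inner, polish_space} measure"
  assumes samp: "sampling_measure M Q \<mu>" and cf: "cavity_field p L l"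
    and inv: "cavity_invariant lam p L l M Q \<mu>"
  shows "(\<integral>\<omega>. (\<integral>R. overlap_test a k R \<partial>overlap_law (\<mu> \<omega>)) \<partial>M) =
    (\<integral>\<omega>. (\<integral>x. (\<integral>R. overlap_test a k R \<partial>overlap_law (cavity_tilt lam p (\<lambda>v. l v x) (\<mu> \<omega>))) \<partial>L) \<partial>M)"
proof -
  interpret cavity p L l lam by unfold_locales (rule cf)
  have \<mu> [measurable]: "\<mu> \<in> M \<rightarrow>\<^sub>M prob_algebra ball_borel" and "prob_space M"
    using samp by (auto simp: sampling_measure_def is_ROSt_def)
  interpret M: prob_space M by fact
  let ?D = "distr M (prob_algebra ball_borel) \<mu>"
  interpret D: prob_space ?D by (rule M.prob_space_distr) (rule \<mu>)
  interpret DL: pair_prob_space ?D L ..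
  define h where "h m = (\<integral>R. overlap_test a k R \<partial>overlap_law m)" for m :: "'h measure"
  have h [measurable]: "h \<in> borel_measurable (prob_algebra ball_borel)" unfolding h_def by measurable
  have hB: "\<bar>h m\<bar> \<le> 1" if "m \<in> space (prob_algebra ball_borel)" for m
  proof -
    interpret O: prob_space "overlap_law m"
      using measurable_space[OF measurable_overlap_law that] by (simp add: space_prob_algebra)
    have "\<bar>h m\<bar> \<le> (\<integral>R. \<bar>overlap_test a k R\<bar> \<partial>overlap_law m)" unfolding h_def by (rule integral_abs_bound)
    also have "\<dots> \<le> (\<integral>R. 1 \<partial>overlap_law m)"
      by (intro integral_mono_AE' AE_I2 abs_overlap_test_le) auto
    finally show ?thesis by (simp add: O.prob_space)
  qed
  let ?T = "\<lambda>(m, x). cavity_tilt lam p (\<lambda>v. l v x) m"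
  have T [measurable]: "?T \<in> ?D \<Otimes>\<^sub>M L \<rightarrow>\<^sub>M prob_algebra ball_borel"
    using measurable_cavity_tilt by (subst measurable_cong_sets[OF sets_pair_measure_cong refl]) auto
  have "(\<integral>\<omega>. h (\<mu> \<omega>) \<partial>M) = (\<integral>R. overlap_test a k R \<partial>(M \<bind> (\<lambda>\<omega>. overlap_law (\<mu> \<omega>))))"
    unfolding h_def by (rule integral_bind_prob[symmetric, where K=matrices and B=1]) (auto simp: abs_overlap_test_le M.prob_space_axioms)
  also have "\<dots> = (\<integral>R. overlap_test a k R \<partial>cavity_mapping lam p L l ?D)"
    using inv by (simp add: cavity_invariant_def distr_eq_bind_overlap_law[OF samp])
  also have "\<dots> = (\<integral>y. (\<integral>R. overlap_test a k R \<partial>overlap_law (?T y)) \<partial>(?D \<Otimes>\<^sub>M L))"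
  proof -
    have "cavity_mapping lam p L l ?D = (?D \<Otimes>\<^sub>M L) \<bind> (\<lambda>y. overlap_law (?T y))"
      unfolding cavity_mapping_def by (simp add: case_prod_unfold)
    then show ?thesis
      using measurable_compose[OF T measurable_overlap_law]
      by (simp add: integral_bind_prob[where K=matrices and B=1] abs_overlap_test_le DL.prob_space_axioms)
  qed
  also have "\<dots> = (\<integral>y. h (?T y) \<partial>(?D \<Otimes>\<^sub>M L))"
    by (simp only: h_def)
  also have "\<dots> = (\<integral>m. (\<integral>x. h (?T (m, x)) \<partial>L) \<partial>?D)"
  proof (rule DL.integral_fst'[symmetric])
    show "integrable (?D \<Otimes>\<^sub>M L) (\<lambda>y. h (?T y))"
      by (rule DL.integrable_const_bound[where B=1, OF AE_I2 measurable_compose[OF T h]])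
        (use measurable_space[OF T] in \<open>auto intro!: hB\<close>)
  qed
  also have "\<dots> = (\<integral>\<omega>. (\<integral>x. h (?T (\<mu> \<omega>, x)) \<partial>L) \<partial>M)"
  proof (rule integral_distr[OF \<mu>])
    have "(\<lambda>y. h (?T y)) \<in> borel_measurable (prob_algebra ball_borel \<Otimes>\<^sub>M L)"
      using measurable_compose[OF measurable_cavity_tilt h] .
    then show "(\<lambda>m. \<integral>x. h (?T (m, x)) \<partial>L) \<in> borel_measurable (prob_algebra ball_borel)"
      by (intro L.borel_measurable_lebesgue_integral) (simp add: case_prod_beta)
  qed
  finally show ?thesis by (simp add: h_def)
qed

lemma overlap_moment_0:
  fixes m :: "'h::{real_inner, second_countable_topology} measure"
  assumes "m \<in> space (prob_algebra ball_borel)"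
  shows "overlap_moment 0 m = 1"
proof -
  interpret prob_space m using assms by (simp add: space_prob_algebra)
  show ?thesis by (simp add: overlap_moment_def prob_space)
qed

section \<open>The radius as essential supremum of norms and of overlaps\<close>

context
  fixes m :: "'h::{real_inner, second_countable_topology} measure"
  assumes m: "m \<in> space (prob_algebra ball_borel)"
begin

interpretation prob_space m using m by (simp add: space_prob_algebra)

lemma sets_eq_ball_borel: "sets m = sets ball_borel" using m by (simp add: space_prob_algebra)
lemma space_eq_cball: "space m = cball 0 1" using sets_eq_imp_space_eq[OF sets_eq_ball_borel] by simp

lemma sets_norm_ge: "{v \<in> cball 0 1. r \<le> norm v} \<in> sets m"
proof -
  have "{v \<in> space ball_borel. r \<le> norm (v :: 'h)} \<in> sets ball_borel" by measurable
  then show ?thesis by (simp add: sets_eq_ball_borel)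
qed

lemma r_max_set: "0 \<in> {r. 0 \<le> r \<and> r \<le> 1 \<and> measure m {v \<in> cball 0 1. r \<le> norm v} > 0}"
  using prob_space by (simp add: space_eq_cball cball_def)

lemma r_max_bounds: "0 \<le> r_max m" "r_max m \<le> 1"
proof -
  let ?S = "{r. 0 \<le> r \<and> r \<le> 1 \<and> measure m {v \<in> cball 0 1. r \<le> norm v} > 0}"
  have bdd: "bdd_above ?S" by (rule bdd_aboveI[of _ 1]) auto
  show "0 \<le> r_max m" unfolding r_max_def by (rule cSup_upper[OF r_max_set bdd])
  show "r_max m \<le> 1" unfolding r_max_def by (rule cSup_least) (use r_max_set in blast, simp)
qed

text \<open>Radii exceeding the supremum by \<open>1 / Suc n\<close> carry no mass, and countably
  many null sets are removed. Radii above 1, over which the supremum does not range, are excluded by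
  the ball.\<close>

lemma AE_norm_le_r_max: "AE v in m. norm v \<le> r_max m"
proof -
  let ?S = "{r. 0 \<le> r \<and> r \<le> 1 \<and> measure m {v \<in> cball 0 1. r \<le> norm v} > 0}"
  have bdd: "bdd_above ?S" by (rule bdd_aboveI[of _ 1]) auto
  have "AE v in m. \<not> r_max m + 1 / Suc n \<le> norm v" for n
  proof (cases "r_max m + 1 / Suc n \<le> 1")
    case True
    have "r_max m + 1 / Suc n \<notin> ?S"
    proof
      assume "r_max m + 1 / Suc n \<in> ?S"
      then have "r_max m + 1 / Suc n \<le> r_max m" unfolding r_max_def by (rule cSup_upper[OF _ bdd])
      then show False by simp
    qed
    moreover have "0 \<le> r_max m + 1 / Suc n" using r_max_bounds by simp
    ultimately have "measure m {v \<in> cball 0 1. r_max m + 1 / Suc n \<le> norm v} = 0"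
      using True by (auto simp: not_less measure_le_0_iff)
    then have "{v \<in> cball 0 1. r_max m + 1 / Suc n \<le> norm v} \<in> null_sets m"
      unfolding null_sets_def using sets_norm_ge[of "r_max m + 1 / Suc n"] by (simp add: emeasure_eq_measure)
    then have "AE v in m. v \<notin> {v \<in> cball 0 1. r_max m + 1 / Suc n \<le> norm v}"
      by (rule AE_not_in)
    then show ?thesis using AE_space by eventually_elim (auto simp: space_eq_cball)
  next
    case False
    then show ?thesis by (intro AE_I2) (auto simp: space_eq_cball)
  qed
  then have "AE v in m. \<forall>n. \<not> r_max m + 1 / Suc n \<le> norm v" by (simp add: AE_all_countable)
  then show ?thesis
  proof eventually_elim
    case (elim v)
    show ?case
    proof (rule ccontr)
      assume "\<not> norm v \<le> r_max m"
      then have "0 < norm v - r_max m" by simp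
      then obtain n where "inverse (of_nat (Suc n)) < norm v - r_max m"
        using reals_Archimedean by blast
      then have "r_max m + 1 / Suc n \<le> norm v" by (simp add: inverse_eq_divide)
      with elim show False by blast
    qed
  qed
qed

lemma AE_abs_inner_le: "AE u in m. \<bar>v \<bullet> u\<bar> \<le> norm v * r_max m"
  using AE_norm_le_r_max
proof eventually_elim
  case (elim u)
  have "\<bar>v \<bullet> u\<bar> \<le> norm v * norm u" by (rule Cauchy_Schwarz_ineq2)
  also have "\<dots> \<le> norm v * r_max m" using elim by (intro mult_left_mono) auto
  finally show ?case .
qed

lemma AE_AE_abs_inner_le: "AE v in m. AE u in m. \<bar>v \<bullet> u\<bar> \<le> (r_max m)\<^sup>2"
  using AE_norm_le_r_max
proof eventually_elim
  case (elim v)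
  show ?case using AE_abs_inner_le[of v]
  proof eventually_elim
    case (elim u)
    have "norm v * r_max m \<le> r_max m * r_max m" using \<open>norm v \<le> r_max m\<close> r_max_bounds by (intro mult_right_mono)
    with elim show ?case by (simp add: power2_eq_square)
  qed
qed

text \<open>By separability some small ball meets the shell of vectors with norm at least
  \<open>r\<close> in positive mass. Two vectors of this piece are long and close together, so
  polarisation makes their overlap exceed \<open>(r\<^sup>2 + b) / 2\<close>.\<close>

lemma large_overlap_pos:
  assumes b: "0 < b" "b < (r_max m)\<^sup>2"
  shows "0 < (\<integral>v. measure m {u \<in> space m. b < \<bar>v \<bullet> u\<bar>} \<partial>m)"
proof -
  let ?S = "{r. 0 \<le> r \<and> r \<le> 1 \<and> measure m {v \<in> cball 0 1. r \<le> norm v} > 0}"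
  have "sqrt b < r_max m" using b r_max_bounds by (simp add: real_less_lsqrt)
  then obtain r where r: "r \<in> ?S" "sqrt b < r"
    unfolding r_max_def by (rule less_cSupE) (use r_max_set in blast)
  have r2: "b < r\<^sup>2" using power_strict_mono[OF r(2), of 2] b by simp
  define A where "A = {v \<in> cball 0 1 :: 'h set. r \<le> norm v}"
  have A: "A \<in> sets m" unfolding A_def by (rule sets_norm_ge)
  \<comment> \<open>Chosen so that \<open>(2 * e)\<^sup>2 = r\<^sup>2 - b\<close>, the squared
    distance that polarisation can afford.\<close>
  define e where "e = sqrt ((r\<^sup>2 - b) / 4)"
  have e: "0 < e" "e\<^sup>2 = (r\<^sup>2 - b) / 4" using r2 by (auto simp: e_def)
  obtain D :: "'h set" where D: "countable D" "\<And>X. open X \<Longrightarrow> X \<noteq> {} \<Longrightarrow> \<exists>d\<in>D. d \<in> X"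
    by (rule countable_dense_setE) blast
  have ballm: "A \<inter> ball d e \<in> sets m" for d
  proof -
    have "ball d e \<inter> cball 0 1 \<in> sets m"
      unfolding sets_eq_ball_borel ball_borel_def by (auto simp: sets_restrict_space)
    then have "A \<inter> (ball d e \<inter> cball 0 1) \<in> sets m" using A by auto
    moreover have "A \<inter> (ball d e \<inter> cball 0 1) = A \<inter> ball d e" by (auto simp: A_def)
    ultimately show ?thesis by simp
  qed
  have "\<exists>d\<in>D. emeasure m (A \<inter> ball d e) \<noteq> 0"
  proof (rule ccontr)
    assume "\<not> ?thesis"
    then have "(\<Union>d\<in>D. A \<inter> ball d e) \<in> null_sets m"
      using D(1) ballm by (intro null_sets_UN') (auto intro!: null_setsI)
    moreover have "A \<subseteq> (\<Union>d\<in>D. A \<inter> ball d e)"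
    proof
      fix v assume v: "v \<in> A"
      obtain d where "d \<in> D" "d \<in> ball v e" using D(2)[of "ball v e"] e by auto
      then show "v \<in> (\<Union>d\<in>D. A \<inter> ball d e)" using v by (auto simp: dist_commute)
    qed
    ultimately have "A \<in> null_sets m" using A null_sets_subset by blast
    then show False using r(1) by (auto simp: A_def measure_def)
  qed
  then obtain d where d: "0 < measure m (A \<inter> ball d e)"
    by (auto simp: emeasure_eq_measure zero_less_measure_iff)
  let ?G = "A \<inter> ball d e"
  have big: "b < \<bar>v \<bullet> u\<bar>" if "v \<in> ?G" "u \<in> ?G" for v u
  proof -
    have "dist v u < 2 * e" using that dist_triangle2[of v u d] by (auto simp: dist_commute)
    then have "(norm (v - u))\<^sup>2 < (2 * e)\<^sup>2" by (intro power_strict_mono) (auto simp: dist_norm)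
    then have "(norm (v - u))\<^sup>2 < r\<^sup>2 - b" by (simp add: power_mult_distrib e(2))
    moreover have "(norm (v - u))\<^sup>2 = (norm v)\<^sup>2 + (norm u)\<^sup>2 - 2 * (v \<bullet> u)"
      by (simp add: power2_norm_eq_inner inner_diff inner_commute)
    moreover have "r\<^sup>2 \<le> (norm v)\<^sup>2" "r\<^sup>2 \<le> (norm u)\<^sup>2"
      using that r(1) by (auto simp: A_def power_mono)
    ultimately have "r\<^sup>2 + b < 2 * (v \<bullet> u)" by linarith
    with r2 show ?thesis by linarith
  qed
  have [measurable_cong]: "sets m = sets ball_borel" by (rule sets_eq_ball_borel)
  have meas: "(\<lambda>v. measure m {u \<in> space m. b < \<bar>v \<bullet> u\<bar>}) \<in> borel_measurable m"
    unfolding measure_def by measurable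
  have "0 < measure m ?G * measure m ?G" using d by simp
  also have "\<dots> = (\<integral>v. measure m ?G * indicator ?G v \<partial>m)"
    using ballm[of d] sets.Int_space_eq2[OF ballm[of d]] by simp
  also have "\<dots> \<le> (\<integral>v. measure m {u \<in> space m. b < \<bar>v \<bullet> u\<bar>} \<partial>m)"
  proof (rule integral_mono)
    show "integrable m (\<lambda>v. measure m ?G * indicator ?G v)"
      using ballm[of d] by (intro integrable_mult_right) (auto simp: emeasure_eq_measure)
    show "integrable m (\<lambda>v. measure m {u \<in> space m. b < \<bar>v \<bullet> u\<bar>})"
      by (rule integrable_const_bound[where B=1]) (auto intro!: meas)
    fix v assume v: "v \<in> space m"
    show "measure m ?G * indicator ?G v \<le> measure m {u \<in> space m. b < \<bar>v \<bullet> u\<bar>}"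
    proof (cases "v \<in> ?G")
      case True
      have "measure m ?G \<le> measure m {u \<in> space m. b < \<bar>v \<bullet> u\<bar>}"
      proof (rule finite_measure_mono)
        show "?G \<subseteq> {u \<in> space m. b < \<bar>v \<bullet> u\<bar>}"
          using big[OF True] by (auto simp: space_eq_cball A_def)
        show "{u \<in> space m. b < \<bar>v \<bullet> u\<bar>} \<in> sets m" using v by measurable
      qed
      with True show ?thesis by simp
    qed simp
  qed
  finally show ?thesis .
qed

end

text \<open>The exponent \<open>p\<close> is taken from the selected class itself, so that
  invariance under its field is available for the fixed tilt.\<close>

lemma infinite_same_parity:
  assumes "infinite (S :: nat set)"
  obtains S' p where "S' \<subseteq> S" "infinite S'" "p \<in> S'" "\<And>k. k \<in> S' \<Longrightarrow> even (p + k)"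
proof -
  have "S = {k \<in> S. even k} \<union> {k \<in> S. odd k}" by auto
  then have "infinite {k \<in> S. even k} \<or> infinite {k \<in> S. odd k}"
    using assms finite_Un by metis
  then show thesis
  proof
    assume i: "infinite {k \<in> S. even k}"
    then obtain p where "p \<in> {k \<in> S. even k}" using infinite_imp_nonempty by blast
    with i show thesis by (intro that[of "{k \<in> S. even k}" p]) auto
  next
    assume i: "infinite {k \<in> S. odd k}"
    then obtain p where "p \<in> {k \<in> S. odd k}" using infinite_imp_nonempty by blast
    with i show thesis by (intro that[of "{k \<in> S. odd k}" p]) auto
  qed
qed

lemma measure_small_overlap_set_eq_0:
  fixes \<mu> :: "'w \<Rightarrow> 'h::{real_inner, polish_space} measure"
    and L :: "nat \<Rightarrow> 'l measure"
  assumes samp: "sampling_measure M Q \<mu>"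
    and fields: "\<And>p. 1 \<le> p \<Longrightarrow> cavity_field p (L p) (l p)"
    and lam: "0 < lam"
    and inv: "infinite {p. 1 \<le> p \<and> cavity_invariant lam p (L p) (l p) M Q \<mu>}"
    and a: "0 < a" "a < 1"
  shows "AE \<omega> in M. a < (r_max (\<mu> \<omega>))\<^sup>2 \<longrightarrow> measure (\<mu> \<omega>) (small_overlap_set a (\<mu> \<omega>)) = 0"
proof -
  have \<mu> [measurable]: "\<mu> \<in> M \<rightarrow>\<^sub>M prob_algebra ball_borel" and "prob_space M"
    using samp by (auto simp: sampling_measure_def is_ROSt_def)
  interpret M: prob_space M by fact
  obtain S p where S: "S \<subseteq> {p. 1 \<le> p \<and> cavity_invariant lam p (L p) (l p) M Q \<mu>}" "infinite S"
    and p: "p \<in> S" and even: "\<And>k. k \<in> S \<Longrightarrow> even (p + k)"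
    by (rule infinite_same_parity[OF inv]) blast
  have cf: "cavity_field k (L k) (l k)" and ci: "cavity_invariant lam k (L k) (l k) M Q \<mu>" if "k \<in> S" for k
    using that S fields by auto
  have cm: "cavity_measure k (L k) (l k) m" if "k \<in> S" "m \<in> space (prob_algebra ball_borel)" for k m
    using cf[OF that(1)] that(2) by (simp add: cavity_measure_def cavity_def cavity_measure_axioms_def)
  have \<mu>in: "\<mu> \<omega> \<in> space (prob_algebra ball_borel)" if "\<omega> \<in> space M" for \<omega>
    using measurable_space[OF \<mu> that] .
  have pos: "0 \<le> overlap_moment k m" if "k \<in> S" "m \<in> space (prob_algebra (ball_borel :: 'h measure))" for k m
    using cavity_measure.overlap_moment_nonneg[OF cm[OF that]] .
  have le1: "\<bar>overlap_moment k m\<bar> \<le> 1" if "m \<in> space (prob_algebra (ball_borel :: 'h measure))" for k m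
    using cavity_measure.overlap_moment_le_1[OF cm[OF p that]] .

  define n where "n m = measure m (small_overlap_set a m)" for m :: "'h measure"
  define H where "H k m = n m * overlap_moment k m" for k and m :: "'h measure"
  have H: "H k m = (\<integral>R. overlap_test a k R \<partial>overlap_law m)" if "m \<in> space (prob_algebra ball_borel)" for k m
    using integral_overlap_test[OF that, of a k] by (simp add: H_def n_def)
  have n01: "0 \<le> n m" "n m \<le> 1" if "m \<in> space (prob_algebra ball_borel)" for m
    using that by (auto simp: n_def space_prob_algebra intro: prob_space.prob_le_1)
  have H0: "H 0 m = n m" if "m \<in> space (prob_algebra ball_borel)" for m
    using overlap_moment_0[OF that] by (simp add: H_def)
  have HB: "\<bar>H k m\<bar> \<le> 1" if "m \<in> space (prob_algebra ball_borel)" for k m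
    using n01[OF that] le1[OF that, of k] by (simp add: H_def abs_mult mult_le_one)
  have Hm [measurable]: "H k \<in> borel_measurable (prob_algebra ball_borel)" for k
    by (rule measurable_cong[THEN iffD2, OF H measurable_integral_overlap_law])
  have iH: "integrable M (\<lambda>\<omega>. H k (\<mu> \<omega>))" for k
    by (rule M.integrable_const_bound[where B=1]) (auto intro!: AE_I2 HB \<mu>in)
  define T where "T k m x = cavity_tilt lam k (\<lambda>v. l k v x) m" for k and m :: "'h measure" and x
  have Tin: "T k m x \<in> space (prob_algebra ball_borel)" if "k \<in> S" "m \<in> space (prob_algebra ball_borel)" "x \<in> space (L k)" for k m x
    using cavity_measure.tilt_in[OF cm[OF that(1,2)] that(3)] cavity_measure.tilt_def[OF cm[OF that(1,2)]]
    by (simp add: T_def)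
  have nT: "n (T k m x) = measure (T k m x) (small_overlap_set a m)" if "k \<in> S" "m \<in> space (prob_algebra ball_borel)" "x \<in> space (L k)" for k m x
    using cavity_measure.small_overlap_set_tilt[OF cm[OF that(1,2)] that(3)] cavity_measure.tilt_def[OF cm[OF that(1,2)]]
    by (simp add: T_def n_def)
  have invH: "(\<integral>\<omega>. H j (\<mu> \<omega>) \<partial>M) = (\<integral>\<omega>. (\<integral>x. H j (T k (\<mu> \<omega>) x) \<partial>L k) \<partial>M)" if "k \<in> S" for j k
  proof -
    have "(\<integral>\<omega>. H j (\<mu> \<omega>) \<partial>M) = (\<integral>\<omega>. (\<integral>R. overlap_test a j R \<partial>overlap_law (\<mu> \<omega>)) \<partial>M)"
      by (intro Bochner_Integration.integral_cong refl H \<mu>in)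
    also have "\<dots> = (\<integral>\<omega>. (\<integral>x. (\<integral>R. overlap_test a j R \<partial>overlap_law (T k (\<mu> \<omega>) x)) \<partial>L k) \<partial>M)"
      unfolding T_def by (rule invariant_integral_overlap_test[OF samp cf[OF that] ci[OF that]])
    also have "\<dots> = (\<integral>\<omega>. (\<integral>x. H j (T k (\<mu> \<omega>) x) \<partial>L k) \<partial>M)"
      by (intro Bochner_Integration.integral_cong refl H[symmetric] Tin[OF that] \<mu>in)
    finally show ?thesis .
  qed
  \<comment> \<open>The mean of \<open>H j\<close> after tilting by the field \<open>l k\<close>; by
    \<open>invH\<close> its average over \<open>M\<close> is that of \<open>H j\<close>, whichever
    \<open>k\<close> in \<open>S\<close> is used.\<close>
  define h where "h k j \<omega> = (\<integral>x. H j (T k (\<mu> \<omega>) x) \<partial>L k)" for k j \<omega>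
  have hm: "h k j \<in> borel_measurable M" if "k \<in> S" for k j
  proof -
    interpret cavity k "L k" "l k" lam by unfold_locales (rule cf[OF that])
    have "(\<lambda>(m, x). T k m x) \<in> prob_algebra ball_borel \<Otimes>\<^sub>M L k \<rightarrow>\<^sub>M prob_algebra ball_borel"
      unfolding T_def by (rule measurable_cavity_tilt)
    then have "(\<lambda>(m, x). H j (T k m x)) \<in> borel_measurable (prob_algebra ball_borel \<Otimes>\<^sub>M L k)"
      using measurable_compose[OF _ Hm] by (force simp: case_prod_beta)
    then have "(\<lambda>m. \<integral>x. H j (T k m x) \<partial>L k) \<in> borel_measurable (prob_algebra ball_borel)"
      by (rule L.borel_measurable_lebesgue_integral)
    then show ?thesis unfolding h_def using measurable_compose[OF \<mu>] by simp
  qed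
  have hB: "\<bar>h k j \<omega>\<bar> \<le> 1" if "k \<in> S" "\<omega> \<in> space M" for k j \<omega>
  proof -
    interpret cavity k "L k" "l k" lam by unfold_locales (rule cf[OF that(1)])
    have "\<bar>h k j \<omega>\<bar> \<le> (\<integral>x. \<bar>H j (T k (\<mu> \<omega>) x)\<bar> \<partial>L k)" unfolding h_def by (rule integral_abs_bound)
    also have "\<dots> \<le> (\<integral>x. 1 \<partial>L k)"
      by (intro integral_mono_AE' AE_I2 HB Tin that \<mu>in) auto
    finally show ?thesis by (simp add: L.prob_space)
  qed
  have ih: "integrable M (h k j)" if "k \<in> S" for k j
    by (rule M.integrable_const_bound[where B=1]) (use hB[OF that] hm[OF that] in \<open>auto intro!: AE_I2\<close>)

  \<comment> \<open>Neither \<open>kap\<close> nor \<open>C\<close> depends on the exponent or on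
    \<open>\<omega>\<close>.\<close>
  define kap where "kap = lam\<^sup>2 / cavity_measure.C1 lam"
  define C where "C = 33 * exp (6 * lam\<^sup>2) * lam\<^sup>2"
  have kap: "0 < kap"
  proof -
    obtain \<omega> where "\<omega> \<in> space M" using M.not_empty by auto
    then interpret cavity_measure p "L p" "l p" lam "\<mu> \<omega>" by (intro cm p \<mu>in)
    have "0 < C1" unfolding C1_def by (intro add_pos_nonneg) auto
    then show ?thesis using lam by (simp add: kap_def)
  qed
  \<comment> \<open>By invariance the mean of \<open>n\<close> is the same before and after the
    tilt, so it cancels in \<open>integral_measure_tilt_ge\<close> and the gain is bounded by the
    error.\<close>
  have EH: "(\<integral>\<omega>. H k (\<mu> \<omega>) \<partial>M) \<le> C / kap * a ^ k" if k: "k \<in> S" for k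
  proof -
    have "n (\<mu> \<omega>) + kap * H k (\<mu> \<omega>) - C * a ^ k \<le> h k 0 \<omega>" if \<omega>: "\<omega> \<in> space M" for \<omega>
    proof -
      interpret cavity_measure k "L k" "l k" lam "\<mu> \<omega>" by (intro cm k \<mu>in \<omega>)
      have "n (\<mu> \<omega>) * (1 + kap * overlap_moment k (\<mu> \<omega>) - C * a ^ k) \<le> (\<integral>x. measure (tilt x) (small_overlap_set a (\<mu> \<omega>)) \<partial>L k)"
        unfolding n_def kap_def C_def by (rule integral_measure_tilt_ge) (use a in auto)
      also have "\<dots> = h k 0 \<omega>"
        unfolding h_def using \<omega> by (intro Bochner_Integration.integral_cong refl)
          (simp add: H0 Tin k \<mu>in nT, simp add: tilt_def T_def)
      finally have "n (\<mu> \<omega>) + kap * H k (\<mu> \<omega>) - n (\<mu> \<omega>) * (C * a ^ k) \<le> h k 0 \<omega>"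
        by (simp add: H_def algebra_simps)
      moreover have "n (\<mu> \<omega>) * (C * a ^ k) \<le> C * a ^ k"
        using n01[OF \<mu>in[OF \<omega>]] a by (intro mult_left_le_one_le) (auto simp: C_def)
      ultimately show ?thesis by linarith
    qed
    then have "(\<integral>\<omega>. H 0 (\<mu> \<omega>) + kap * H k (\<mu> \<omega>) - C * a ^ k \<partial>M) \<le> (\<integral>\<omega>. h k 0 \<omega> \<partial>M)"
      by (intro integral_mono ih k) (auto simp: H0 \<mu>in iH)
    also have "\<dots> = (\<integral>\<omega>. H 0 (\<mu> \<omega>) \<partial>M)"
      unfolding h_def by (rule invH[OF k, symmetric])
    finally have "kap * (\<integral>\<omega>. H k (\<mu> \<omega>) \<partial>M) \<le> C * a ^ k"
      by (simp add: iH M.prob_space)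
    then show ?thesis using kap by (simp add: field_simps)
  qed
  have h0: "0 \<le> h p k \<omega>" if "k \<in> S" "\<omega> \<in> space M" for k \<omega>
    unfolding h_def using that p
    by (intro Bochner_Integration.integral_nonneg_AE AE_I2) (auto simp: H_def intro!: mult_nonneg_nonneg n01 pos Tin \<mu>in)

  define e where "e = enumerate S"
  have eS: "e i \<in> S" and ei: "i \<le> e i" for i
    using S(2) by (auto simp: e_def enumerate_in_set le_enumerate)
  \<comment> \<open>Fatou's lemma. The averages of \<open>h p k \<omega> / a ^ k\<close> stay
    bounded: invariance under the fixed field replaces \<open>h p k\<close> by \<open>H k\<close>,
    to which \<open>EH\<close> applies.\<close>
  have "(\<integral>\<^sup>+\<omega>. liminf (\<lambda>i. ennreal (h p (e i) \<omega> / a ^ e i)) \<partial>M) \<le> liminf (\<lambda>i. \<integral>\<^sup>+\<omega>. ennreal (h p (e i) \<omega> / a ^ e i) \<partial>M)"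
    using hm[OF p] by (intro nn_integral_liminf) auto
  also have "\<dots> \<le> liminf (\<lambda>i. ennreal (C / kap))"
  proof (intro Liminf_mono eventuallyI)
    fix i
    have "(\<integral>\<^sup>+\<omega>. ennreal (h p (e i) \<omega> / a ^ e i) \<partial>M) = ennreal (\<integral>\<omega>. h p (e i) \<omega> / a ^ e i \<partial>M)"
      using h0[OF eS] a ih[OF p] by (intro nn_integral_eq_integral) (auto intro!: AE_I2)
    also have "(\<integral>\<omega>. h p (e i) \<omega> / a ^ e i \<partial>M) = (\<integral>\<omega>. H (e i) (\<mu> \<omega>) \<partial>M) / a ^ e i"
      using invH[OF p, of "e i"] by (simp add: h_def)
    also have "\<dots> \<le> C / kap"
      using EH[OF eS[of i]] a by (simp add: divide_le_eq)
    finally show "(\<integral>\<^sup>+\<omega>. ennreal (h p (e i) \<omega> / a ^ e i) \<partial>M) \<le> ennreal (C / kap)" by (simp add: ennreal_leI)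
  qed
  also have "\<dots> = ennreal (C / kap)" by (simp add: Liminf_const)
  finally have "(\<integral>\<^sup>+\<omega>. liminf (\<lambda>i. ennreal (h p (e i) \<omega> / a ^ e i)) \<partial>M) \<noteq> \<infinity>"
    by (auto simp: top_unique)
  then have "AE \<omega> in M. liminf (\<lambda>i. ennreal (h p (e i) \<omega> / a ^ e i)) \<noteq> \<infinity>"
    using hm[OF p] by (intro nn_integral_PInf_AE) auto
  then show ?thesis
    using AE_space
  proof eventually_elim
    case (elim \<omega>)
    interpret cavity_measure p "L p" "l p" lam "\<mu> \<omega>" by (intro cm p \<mu>in elim)
    show ?case
    proof (intro impI, rule ccontr)
      assume ar: "a < (r_max (\<mu> \<omega>))\<^sup>2" and n0: "measure (\<mu> \<omega>) (small_overlap_set a (\<mu> \<omega>)) \<noteq> 0"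
      define r where "r = (r_max (\<mu> \<omega>))\<^sup>2"
      \<comment> \<open>The target rate \<open>q\<close> is placed strictly between \<open>a\<close>
        and \<open>r\<close>, and \<open>b\<close> solves \<open>b\<^sup>2 / r = q\<close>, the rate
        of \<open>overlap_moment_tilt_lower\<close>; then \<open>b < r\<close>, so overlaps above
        \<open>b\<close> have positive mass.\<close>
      define q where "q = (a + r) / 2"
      define b where "b = sqrt (q * r)"
      have r: "a < r" "0 < r" using ar a by (auto simp: r_def)
      have q: "a < q" "q < r" "0 < q" using r a by (auto simp: q_def)
      have b: "0 < b" "b < r" "b\<^sup>2 / r = q"
      proof -
        show "0 < b" using q r by (simp add: b_def)
        have "q * r < r\<^sup>2" using q r by (simp add: power2_eq_square)
        then show "b < r" unfolding b_def using r by (intro real_less_lsqrt) auto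
        show "b\<^sup>2 / r = q" using q r by (simp add: b_def)
      qed
      have "0 < measure (\<mu> \<omega>) (small_overlap_set a (\<mu> \<omega>))" using n0 by (simp add: zero_less_measure_iff)
      from overlap_moment_tilt_lower[OF this r(2) AE_AE_abs_inner_le[OF m_in, folded r_def] b(1)
          large_overlap_pos[OF m_in b(1) b(2)[unfolded r_def]]] lam
      obtain c where c: "0 < c"
        and lower: "\<And>k. even (p + k) \<Longrightarrow> (\<forall>m'\<in>space (prob_algebra (ball_borel :: 'h measure)). 0 \<le> overlap_moment k m') \<Longrightarrow>
          c * q ^ k \<le> (\<integral>x. measure (tilt x) (small_overlap_set a (\<mu> \<omega>)) * overlap_moment k (tilt x) \<partial>L p)"
        unfolding b(3) by auto
      have low: "c * (q / a) ^ i \<le> h p (e i) \<omega> / a ^ e i" for i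
      proof -
        have "c * q ^ e i \<le> (\<integral>x. measure (tilt x) (small_overlap_set a (\<mu> \<omega>)) * overlap_moment (e i) (tilt x) \<partial>L p)"
          using even[OF eS] pos[OF eS] by (intro lower) auto
        also have "\<dots> = h p (e i) \<omega>"
          unfolding h_def H_def using elim(2) by (intro Bochner_Integration.integral_cong refl)
            (simp add: nT p \<mu>in, simp add: tilt_def T_def)
        finally have "c * q ^ e i / a ^ e i \<le> h p (e i) \<omega> / a ^ e i"
          using a by (intro divide_right_mono) auto
        \<comment> \<open>Since \<open>q / a > 1\<close> and \<open>i \<le> e i\<close>, growth
          along the exponents of \<open>S\<close> becomes geometric growth in the index.\<close>
        moreover have "c * (q / a) ^ i \<le> c * (q / a) ^ e i"
          using c q a ei[of i] by (intro mult_left_mono power_increasing) auto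
        ultimately show ?thesis by (simp add: power_divide)
      qed
      have "filterlim (\<lambda>i. c * (q / a) ^ i) at_top sequentially"
        using c q a by (intro filterlim_tendsto_pos_mult_at_top[OF tendsto_const]
          filterlim_at_infinity_imp_filterlim_at_top filterlim_realpow_sequentially_gt1) auto
      then have "filterlim (\<lambda>i. h p (e i) \<omega> / a ^ e i) at_top sequentially"
        by (rule filterlim_at_top_mono) (intro always_eventually allI low)
      then have "(\<lambda>i. ennreal (h p (e i) \<omega> / a ^ e i)) \<longlonglongrightarrow> \<infinity>"
        by (simp add: ennreal_tendsto_top_eq_at_top)
      then have "liminf (\<lambda>i. ennreal (h p (e i) \<omega> / a ^ e i)) = \<infinity>"
        by (intro lim_imp_Liminf) auto
      with elim show False by simp
    qed
  qed
qed

theorem theorem1p8: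
  fixes M :: "'w measure"
    and Q :: "'w \<Rightarrow> nat \<times> nat \<Rightarrow> real"
    and \<mu> :: "'w \<Rightarrow> 'h::{real_inner, polish_space} measure"
    and L :: "nat \<Rightarrow> 'l measure"
    and l :: "nat \<Rightarrow> 'h \<Rightarrow> 'l \<Rightarrow> real"
    and lam :: real
  assumes infinite_dimensional: "\<And>B :: 'h set. finite B \<Longrightarrow> span B \<noteq> UNIV"
    and ROSt: "is_ROSt M Q"
    and sampling: "sampling_measure M Q \<mu>"
    and fields: "\<And>p. 1 \<le> p \<Longrightarrow> cavity_field p (L p) (l p)"
    and lam_pos: "0 < lam"
    and invariant: "infinite {p. 1 \<le> p \<and> cavity_invariant lam p (L p) (l p) M Q \<mu>}"
    and atom: "measure M {\<omega> \<in> space M.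
        measure (\<mu> \<omega> \<Otimes>\<^sub>M \<mu> \<omega>)
          {(v, v'). v \<in> cball 0 1 \<and> v' \<in> cball 0 1 \<and> \<bar>v \<bullet> v'\<bar> = (r_max (\<mu> \<omega>))\<^sup>2} > 0} > 0"
  shows "AE \<omega> in M. measure (\<mu> \<omega>) {v \<in> cball 0 1. norm v = r_max (\<mu> \<omega>)} = 1"
proof -
  have \<mu>: "\<mu> \<in> M \<rightarrow>\<^sub>M prob_algebra ball_borel"
    using sampling by (auto simp: sampling_measure_def)
  \<comment> \<open>Rational thresholds suffice and keep the exceptional null set independent of
    \<open>a\<close>.\<close>
  have "AE \<omega> in M. \<forall>a\<in>\<rat> \<inter> {0<..<1}. a < (r_max (\<mu> \<omega>))\<^sup>2 \<longrightarrow> measure (\<mu> \<omega>) (small_overlap_set a (\<mu> \<omega>)) = 0"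
    using measure_small_overlap_set_eq_0[OF sampling fields lam_pos invariant]
    by (subst AE_ball_countable) (auto intro: countable_rat countable_subset[of "\<rat> \<inter> {0<..<1}" "\<rat>"])
  then show ?thesis
    using AE_space
  proof eventually_elim
    case (elim \<omega>)
    let ?m = "\<mu> \<omega>" and ?r = "r_max (\<mu> \<omega>)"
    have m: "?m \<in> space (prob_algebra ball_borel)" using measurable_space[OF \<mu> elim(2)] .
    then have s: "sets ?m = sets ball_borel" and "prob_space ?m" by (auto simp: space_prob_algebra)
    interpret prob_space ?m by fact
    have sp: "space ?m = cball 0 1" using sets_eq_imp_space_eq[OF s] by simp
    note r = r_max_bounds[OF m]
    have "AE v in ?m. \<forall>a\<in>\<rat> \<inter> {0<..<1}. a < ?r\<^sup>2 \<longrightarrow> v \<notin> small_overlap_set a ?m"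
    proof (subst AE_ball_countable)
      show "countable (\<rat> \<inter> {0<..<1 :: real})"
        using countable_rat by (rule countable_subset[rotated]) auto
      show "\<forall>a\<in>\<rat> \<inter> {0<..<1}. AE v in ?m. a < ?r\<^sup>2 \<longrightarrow> v \<notin> small_overlap_set a ?m"
      proof
        fix a assume a: "a \<in> \<rat> \<inter> {0<..<1 :: real}"
        show "AE v in ?m. a < ?r\<^sup>2 \<longrightarrow> v \<notin> small_overlap_set a ?m"
        proof (cases "a < ?r\<^sup>2")
          case True
          then have "small_overlap_set a ?m \<in> null_sets ?m"
            using elim(1) a sets_small_overlap_set[OF m] by (intro null_setsI) (auto simp: emeasure_eq_measure)
          then show ?thesis using AE_not_in by auto
        qed simp
      qed
    qed
    then have "AE v in ?m. norm v = ?r"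
      using AE_norm_le_r_max[OF m] AE_space
    proof eventually_elim
      case (elim v)
      show ?case
      proof (rule ccontr)
        assume "norm v \<noteq> ?r"
        with elim(2) have lt: "norm v < ?r" by simp
        have "norm v * ?r < ?r * ?r"
          using lt le_less_trans[OF norm_ge_zero lt] by (rule mult_strict_right_mono)
        then have "norm v * ?r < ?r\<^sup>2" by (simp add: power2_eq_square)
        \<comment> \<open>The overlaps of \<open>v\<close> with almost all vectors are at most
          \<open>norm v * ?r\<close>, so a rational threshold between this and
          \<open>?r\<^sup>2\<close> would put \<open>v\<close> into a small overlap set that it
          avoids.\<close>
        then obtain a where a: "a \<in> \<rat>" "norm v * ?r < a" "a < ?r\<^sup>2" using Rats_dense_in_real by blast
        have "0 < a" using a(2) r(1) by (smt (verit) mult_nonneg_nonneg norm_ge_zero)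
        moreover have "a < 1" using a(3) r power_le_one[of ?r 2] by simp
        moreover have "v \<in> small_overlap_set a ?m"
          using AE_abs_inner_le[OF m, of v] elim(3) a(2) by (auto simp: small_overlap_set_def sp elim: eventually_mono)
        ultimately show False using elim(1) a by auto
      qed
    qed
    moreover have "{v \<in> cball 0 1. norm v = ?r} \<in> sets ?m"
    proof -
      have "{v \<in> space ball_borel. norm (v :: 'h) = ?r} \<in> sets ball_borel" by measurable
      then show ?thesis by (simp add: s)
    qed
    ultimately show ?case
      by (subst prob_eq_1) (auto elim: eventually_elim2[OF AE_space] simp: sp)
  qed
qed

end
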